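(* Let $\mu(dx)=Z e^{-V(x)}dx$ be a probability measure on $\mathbb{R}^n$ with $V$ smooth, $L=\Delta-\nabla V\cdot\nabla$, and let $d$ be the Euclidean distance. Suppose that there exist a $C^2$ function $W\ge 1$, a point $x_0\in\mathbb{R}^n$ and constants $b\in\mathbb{R}$, $c>0$ such that for all $x$ $$LW(x)\le \big(-c\,d^2(x,x_0)+b\big)W(x) .$$ Then there exists a constant $K>0$ such that for every probability density $f$ with respect to $\mu$ $$W_2(f\,d\mu,\mu)\le\sqrt{K\,H(f\,d\mu,d\mu)} .$$
   Context: $Z$ is the normalizing constant. For a probability density $f$ with respect to $\mu$, $H(f\,d\mu,d\mu)=\mathrm{Ent}_\mu(f)=\int f\log f\,d\mu\in[0,+\infty]$ is the Kullback information. The Wasserstein distance is $W_2(\nu,\mu)=\inf\{\mathbb{E}(d^2(X,Y))^{1/2}:\ X\sim\nu,\ Y\sim\mu\}$. (The function $W$ is unrelated to the distance $W_2$.) *)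

theory Defs
  imports "HOL-Probability.Probability"
begin

definition partial_deriv :: "'n::finite \<Rightarrow> (real^'n \<Rightarrow> real) \<Rightarrow> real^'n \<Rightarrow> real" where
  "partial_deriv i f x = deriv (\<lambda>t. f (x + t *\<^sub>R axis i 1)) 0"

text \<open>
  Total differentiability is required at each step, so that no partial derivative is
  a junk value of \<open>deriv\<close>.
\<close>

primrec C_k :: "nat \<Rightarrow> (real^'n::finite \<Rightarrow> real) \<Rightarrow> bool" where
  "C_k 0 f \<longleftrightarrow> continuous_on UNIV f"
| "C_k (Suc k) f \<longleftrightarrow> f differentiable_on UNIV \<and> (\<forall>i. C_k k (partial_deriv i f))"

definition smooth :: "(real^'n::finite \<Rightarrow> real) \<Rightarrow> bool" where
  "smooth f \<longleftrightarrow> (\<forall>k. C_k k f)"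

definition grad :: "(real^'n::finite \<Rightarrow> real) \<Rightarrow> real^'n \<Rightarrow> real^'n" where
  "grad f x = (\<chi> i. partial_deriv i f x)"

definition laplacian :: "(real^'n::finite \<Rightarrow> real) \<Rightarrow> real^'n \<Rightarrow> real" where
  "laplacian f x = (\<Sum>i\<in>UNIV. partial_deriv i (partial_deriv i f) x)"

definition generator :: "(real^'n::finite \<Rightarrow> real) \<Rightarrow> (real^'n \<Rightarrow> real) \<Rightarrow> real^'n \<Rightarrow> real" where
  "generator V g x = laplacian g x - grad V x \<bullet> grad g x"

text \<open>
  When this is a probability measure, \<open>Z\<close> is automatically positive and equal to the inverse of the
  integral of \<open>exp (- V x)\<close>.
\<close>

definition gibbs_measure :: "real \<Rightarrow> (real^'n::finite \<Rightarrow> real) \<Rightarrow> (real^'n) measure" where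
  "gibbs_measure Z V = density lborel (\<lambda>x. ennreal (Z * exp (- V x)))"

definition prob_density :: "'a measure \<Rightarrow> ('a \<Rightarrow> real) \<Rightarrow> bool" where
  "prob_density M f \<longleftrightarrow>
     f \<in> borel_measurable M \<and> (\<forall>x. 0 \<le> f x) \<and> (\<integral>\<^sup>+x. ennreal (f x) \<partial>M) = 1"

text \<open>
  The integral of \<open>f ln f\<close> as positive part minus negative part. For a probability density \<open>f\<close>
  on a probability space the negative part is finite, since \<open>- (t * ln t) \<le> exp (- 1)\<close> for
  \<open>t \<ge> 0\<close> (with \<open>0 * ln 0 = 0\<close>), so the difference is never \<open>\<infinity> - \<infinity>\<close>. The library's
  \<open>KL_divergence\<close> cannot be used: it is a Bochner integral, which returns 0 when the entropy is
  infinite.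
\<close>

definition kullback :: "'a measure \<Rightarrow> ('a \<Rightarrow> real) \<Rightarrow> ereal" where
  "kullback M f =
     enn2ereal (\<integral>\<^sup>+x. ennreal (f x * ln (f x)) \<partial>M)
     - enn2ereal (\<integral>\<^sup>+x. ennreal (- (f x * ln (f x))) \<partial>M)"

lemma kullback_eq_KL_divergence:
  assumes "sigma_finite_measure M" "prob_density M f" "integrable M (\<lambda>x. f x * ln (f x))"
  shows "kullback M f = ereal (KL_divergence (exp 1) M (density M (\<lambda>x. ennreal (f x))))"
proof -
  interpret sigma_finite_measure M by fact
  have "KL_divergence (exp 1) M (density M (\<lambda>x. ennreal (f x))) = (\<integral>x. f x * ln (f x) \<partial>M)"
    using assms(2) by (subst KL_density) (auto simp: prob_density_def log_def)
  moreover have "(\<integral>\<^sup>+x. ennreal (f x * ln (f x)) \<partial>M) \<noteq> \<infinity>"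
    "(\<integral>\<^sup>+x. ennreal (- (f x * ln (f x))) \<partial>M) \<noteq> \<infinity>"
    using assms(3) by (auto simp: real_integrable_def)
  ultimately show ?thesis
    using assms(3)
    by (cases "\<integral>\<^sup>+x. ennreal (f x * ln (f x)) \<partial>M"; cases "\<integral>\<^sup>+x. ennreal (- (f x * ln (f x))) \<partial>M")
      (auto simp: kullback_def real_lebesgue_integral_def)
qed

text \<open>Extends the square root to \<open>[0, \<infinity>]\<close>; the values at negative arguments are immaterial.\<close>

definition ereal_sqrt :: "ereal \<Rightarrow> ereal" where
  "ereal_sqrt x = (if \<bar>x\<bar> = \<infinity> then x else ereal (sqrt (real_of_ereal x)))"

text \<open>
  A definition cannot quantify over the type of the sample space, so the random variables live on
  probability spaces over the type \<open>'a \<times> 'a\<close>. This loses nothing: the pair \<open>(X, Y)\<close> may always be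
  replaced by the two projections under its joint law, see \<open>wasserstein2_le\<close> below.
\<close>

definition wasserstein2 ::
  "'a::{metric_space, second_countable_topology} measure \<Rightarrow> 'a measure \<Rightarrow> ereal" where
  "wasserstein2 \<nu> \<mu> =
     Inf {ereal_sqrt (enn2ereal (\<integral>\<^sup>+\<omega>. ennreal ((dist (X \<omega>) (Y \<omega>))\<^sup>2) \<partial>M)) |
          (M :: ('a \<times> 'a) measure) X Y.
          prob_space M \<and> X \<in> borel_measurable M \<and> Y \<in> borel_measurable M \<and>
          distr M borel X = \<nu> \<and> distr M borel Y = \<mu>}"

lemma wasserstein2_le:
  fixes M :: "'b measure" and X Y :: "'b \<Rightarrow> 'a::{metric_space, second_countable_topology}"
  assumes "prob_space M" and [measurable]: "X \<in> borel_measurable M" "Y \<in> borel_measurable M"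
    and "distr M borel X = \<nu>" "distr M borel Y = \<mu>"
  shows "wasserstein2 \<nu> \<mu>
    \<le> ereal_sqrt (enn2ereal (\<integral>\<^sup>+\<omega>. ennreal ((dist (X \<omega>) (Y \<omega>))\<^sup>2) \<partial>M))"
proof -
  interpret prob_space M by fact
  define P where "P = distr M (borel \<Otimes>\<^sub>M borel) (\<lambda>\<omega>. (X \<omega>, Y \<omega>))"
  have "prob_space P"
    unfolding P_def by (rule prob_space_distr) measurable
  moreover have "fst \<in> borel_measurable P" "snd \<in> borel_measurable P"
    unfolding P_def by measurable
  moreover have "distr P borel fst = \<nu>" "distr P borel snd = \<mu>"
    using assms by (auto simp: P_def distr_distr comp_def)
  moreover have "(\<integral>\<^sup>+\<omega>. ennreal ((dist (fst \<omega>) (snd \<omega>))\<^sup>2) \<partial>P)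
      = (\<integral>\<^sup>+\<omega>. ennreal ((dist (X \<omega>) (Y \<omega>))\<^sup>2) \<partial>M)"
    unfolding P_def by (subst nn_integral_distr) auto
  ultimately show ?thesis
    unfolding wasserstein2_def
    by (intro Inf_lower CollectI exI[of _ P] exI[of _ fst] exI[of _ snd] conjI) simp_all
qed

end

theory Submission
  imports Defs
begin

text \<open>
  Write \<open>d = dist x x0\<close>. Integrating by parts against \<open>g\<^sup>2 \<nabla>W / W\<close> turns the Lyapunov condition into
  \<open>c \<integral> d\<^sup>2 g\<^sup>2 d\<mu> \<le> \<integral> \<bar>\<nabla>g\<bar>\<^sup>2 d\<mu> + b \<integral> g\<^sup>2 d\<mu>\<close>. This gives a square exponential moment, together
  with the Poincare inequality on balls it gives a Poincare inequality, and it gives a logarithmic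
  Sobolev inequality for those \<open>h\<close> with \<open>\<integral> h\<^sup>2 d\<mu> = 1\<close> and \<open>h\<^sup>2 \<le> exp (A + \<eta> d\<^sup>2)\<close>. The latter
  suffices to run the Hamilton-Jacobi argument of Bobkov, Gentil and Ledoux, because \<open>exp (\<rho> t u)\<close>
  satisfies the growth constraint for Hopf-Lax solutions \<open>u\<close> and small \<open>\<rho>\<close>.

  Kantorovich duality and the regularity theory of Hopf-Lax solutions are avoided by entropic
  regularization: \<open>\<mu>\<close> is replaced by its image under a map \<open>T\<close> with finite range \<open>I\<close> close to the
  identity, and the infimum in the Hopf-Lax formula by a soft minimum over \<open>I\<close>, which is smooth
  and still satisfies \<open>u\<^sub>t + \<bar>\<nabla>u\<bar>\<^sup>2 / 2 \<le> 0\<close>. The potentials maximizing the regularized dual problem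
  yield an explicit coupling whose cost exceeds the dual value by an arbitrarily small amount.
\<close>

section \<open>Continuously differentiable functions\<close>

text \<open>No lower bound on the Hessian of V is assumed, so no logarithmic Sobolev inequality for
  arbitrary h is at hand: where h is large, nothing controls its logarithm. The growth constraint
  supplies this control, with a constant C that depends on A but not on \<eta> \<le> 1. The order of
  choices therefore decides the proof: A is fixed by the second moment of \<mu>, C by A, and only
  then \<rho> \<le> 2 / C, small enough for the exponential moment as well. Density, discretization
  and potential enter afterwards; subtracting the constant M from the potential's soft minimum keeps
  A independent of them. The result is K = 8 / \<rho>. The flow runs from time 1 to time 2 and ends
  with the cost d^2 / 4, which gives a factor 4; replacing T y by y in d(x, T y)^2 gives a factor 2.
  The entropic error \<epsilon> * card I and the discretization error are both at most e, and e
  tends to 0 at the end.\<close>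

definition C1_grad :: "('a::euclidean_space \<Rightarrow> real) \<Rightarrow> ('a \<Rightarrow> 'a) \<Rightarrow> bool" where
  "C1_grad f Df \<longleftrightarrow> (\<forall>x. GDERIV f x :> Df x) \<and> continuous_on UNIV Df"

lemma C1_grad_D: "C1_grad f Df \<Longrightarrow> GDERIV f x :> Df x"
  by (simp add: C1_grad_def)

lemma C1_grad_continuous_grad: "C1_grad f Df \<Longrightarrow> continuous_on UNIV Df"
  by (simp add: C1_grad_def)

lemma C1_grad_continuous: "C1_grad f Df \<Longrightarrow> continuous_on UNIV f"
  unfolding C1_grad_def gderiv_def
  by (meson continuous_at_imp_continuous_on has_derivative_continuous)

lemma C1_grad_measurable:
  assumes "C1_grad f Df"
  shows "f \<in> borel_measurable borel" "Df \<in> borel_measurable borel"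
  using C1_grad_continuous[OF assms] C1_grad_continuous_grad[OF assms]
  by (auto intro: borel_measurable_continuous_onI)

lemma C1_grad_const: "C1_grad (\<lambda>_. a) (\<lambda>_. 0)"
  by (auto simp: C1_grad_def intro: GDERIV_const)

lemma C1_grad_add:
  "C1_grad f Df \<Longrightarrow> C1_grad g Dg \<Longrightarrow> C1_grad (\<lambda>x. f x + g x) (\<lambda>x. Df x + Dg x)"
  by (auto simp: C1_grad_def intro: GDERIV_add continuous_intros)

lemma C1_grad_diff_const:
  "C1_grad f Df \<Longrightarrow> C1_grad (\<lambda>x. f x - a) Df"
  using C1_grad_add[OF _ C1_grad_const[of "-a"]] by simp

lemma C1_grad_mult:
  assumes "C1_grad f Df" "C1_grad g Dg"
  shows "C1_grad (\<lambda>x. f x * g x) (\<lambda>x. f x *\<^sub>R Dg x + g x *\<^sub>R Df x)"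
  using assms C1_grad_continuous[OF assms(1)] C1_grad_continuous[OF assms(2)]
  by (auto simp: C1_grad_def intro: GDERIV_mult continuous_intros)

lemma C1_grad_cmult:
  assumes "C1_grad f Df"
  shows "C1_grad (\<lambda>x. a * f x) (\<lambda>x. a *\<^sub>R Df x)"
  using C1_grad_mult[OF C1_grad_const[of a] assms] by simp

text \<open>Continuity of \<phi>' is required only on the range of f, which admits
  \<open>inverse\<close> and \<open>ln\<close> on functions whose range avoids 0.\<close>

lemma C1_grad_compose:
  fixes \<phi> :: "real \<Rightarrow> real"
  assumes f: "C1_grad f Df" and \<phi>: "\<And>x. DERIV \<phi> (f x) :> \<phi>' (f x)"
    and c: "continuous_on (range f) \<phi>'"
  shows "C1_grad (\<lambda>x. \<phi> (f x)) (\<lambda>x. \<phi>' (f x) *\<^sub>R Df x)"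
proof -
  have "continuous_on UNIV (\<lambda>x. \<phi>' (f x))"
    using continuous_on_compose2[OF c C1_grad_continuous[OF f]] by auto
  with f \<phi> show ?thesis
    by (auto simp: C1_grad_def intro: GDERIV_DERIV_compose continuous_intros)
qed

lemma C1_grad_inverse:
  assumes f: "C1_grad f Df" and "\<And>x. f x \<noteq> 0"
  shows "C1_grad (\<lambda>x. inverse (f x)) (\<lambda>x. (- (inverse (f x))\<^sup>2) *\<^sub>R Df x)"
proof (rule C1_grad_compose[OF f, where \<phi>'="\<lambda>r. - (inverse r)\<^sup>2"])
  show "DERIV inverse (f x) :> - (inverse (f x))\<^sup>2" for x
    using DERIV_inverse[OF assms(2)[of x]] by (simp add: numeral_2_eq_2)
  show "continuous_on (range f) (\<lambda>r. - (inverse r)\<^sup>2)"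
    using assms(2) by (intro continuous_intros) auto
qed

lemma C1_grad_exp:
  assumes f: "C1_grad f Df"
  shows "C1_grad (\<lambda>x. exp (f x)) (\<lambda>x. exp (f x) *\<^sub>R Df x)"
  by (rule C1_grad_compose[OF f]) (auto intro!: derivative_eq_intros continuous_intros)

lemma C1_grad_dist_square:
  "C1_grad (\<lambda>x. (dist x a)\<^sup>2) (\<lambda>x. 2 *\<^sub>R (x - a))"
proof -
  have "GDERIV (\<lambda>x. (dist x a)\<^sup>2) x :> 2 *\<^sub>R (x - a)" for x
    unfolding gderiv_def dist_norm power2_norm_eq_inner
    by (auto intro!: derivative_eq_intros simp: inner_commute algebra_simps)
  then show ?thesis
    by (auto simp: C1_grad_def intro!: continuous_intros)
qed

lemma gderiv_along_line:
  assumes "C1_grad f Df"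
  shows "((\<lambda>t. f (x + t *\<^sub>R v)) has_real_derivative Df (x + t *\<^sub>R v) \<bullet> v) (at t within S)"
proof -
  have "(f has_derivative (\<lambda>h. h \<bullet> Df (x + t *\<^sub>R v))) (at (x + t *\<^sub>R v))"
    using C1_grad_D[OF assms] by (auto simp: gderiv_def)
  moreover have "((\<lambda>t. x + t *\<^sub>R v) has_derivative (\<lambda>h. h *\<^sub>R v)) (at t within S)"
    by (auto intro!: derivative_eq_intros)
  ultimately have "((\<lambda>t. f (x + t *\<^sub>R v)) has_derivative (\<lambda>h. (h *\<^sub>R v) \<bullet> Df (x + t *\<^sub>R v))) (at t within S)"
    by (rule has_derivative_compose[rotated])
  moreover have "(\<lambda>h. (h *\<^sub>R v) \<bullet> Df (x + t *\<^sub>R v)) = (*) (Df (x + t *\<^sub>R v) \<bullet> v)"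
    by (auto simp: fun_eq_iff inner_commute)
  ultimately show ?thesis
    by (simp add: has_field_derivative_def)
qed

section \<open>Integrals of compactly supported derivatives, and differentiation under the
  integral\<close>

lemma integrable_lborel_compact_support:
  fixes f :: "'a::euclidean_space \<Rightarrow> 'b::{banach, second_countable_topology}"
  assumes "continuous_on UNIV f" "\<And>x. x \<notin> cball a R \<Longrightarrow> f x = 0"
  shows "integrable lborel f"
proof -
  have "integrable lborel (\<lambda>x. indicator (cball a R) x *\<^sub>R f x)"
    using assms(1) by (intro borel_integrable_compact) (auto intro: continuous_on_subset)
  also have "(\<lambda>x. indicator (cball a R) x *\<^sub>R f x) = f"
    using assms(2) by (auto simp: indicator_def fun_eq_iff)
  finally show ?thesis .
qed

text \<open>By translation invariance the difference quotients of g in direction v have integral 0;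
  dominated convergence passes to the derivative.\<close>

lemma integral_directional_deriv_eq_0:
  fixes g :: "'a::euclidean_space \<Rightarrow> real"
  assumes g: "C1_grad g Dg" and supp: "\<And>x. x \<notin> cball a R \<Longrightarrow> g x = 0" and v: "norm v \<le> 1"
  shows "(\<integral>x. Dg x \<bullet> v \<partial>lborel) = 0"
proof -
  have Dg_cont: "continuous_on UNIV (\<lambda>x. norm (Dg x))"
    using C1_grad_continuous_grad[OF g] by (intro continuous_intros)
  \<comment> \<open>R + 2: for a point of \<open>cball a (R + 1)\<close> the mean value point of the
    quotient lies at distance at most 1 from it, and outside that ball the quotients vanish.\<close>
  define K where "K = cball a (R + 2)"
  have "bounded ((\<lambda>x. norm (Dg x)) ` K)"
    by (intro compact_imp_bounded compact_continuous_image continuous_on_subset[OF Dg_cont])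
      (auto simp: K_def)
  then obtain B where B: "\<And>x. x \<in> K \<Longrightarrow> norm (Dg x) \<le> B" and "B > 0"
    unfolding bounded_pos by auto
  define s where "s n = 1 / real (Suc n)" for n
  have s_pos: "0 < s n" and s_le: "s n \<le> 1" for n
    by (auto simp: s_def)
  have s0: "s \<longlonglongrightarrow> 0"
    unfolding s_def using LIMSEQ_inverse_real_of_nat by (simp add: inverse_eq_divide)
  define q where "q n x = (g (x + s n *\<^sub>R v) - g x) / s n" for n x
  have meas_g[measurable]: "g \<in> borel_measurable borel" and meas_Dg[measurable]: "Dg \<in> borel_measurable borel"
    using C1_grad_measurable[OF g] by auto
  have int_g: "integrable lborel g"
    by (rule integrable_lborel_compact_support[OF C1_grad_continuous[OF g] supp])
  have int_shift: "integrable lborel (\<lambda>x. g (x + s n *\<^sub>R v))"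
    and shift: "(\<integral>x. g (x + s n *\<^sub>R v) \<partial>lborel) = (\<integral>x. g x \<partial>lborel)" for n
  proof -
    have "distr lborel borel ((+) (s n *\<^sub>R v)) = (lborel :: 'a measure)"
      by (rule lborel_distr_plus)
    moreover have "integrable (distr lborel borel ((+) (s n *\<^sub>R v))) g"
      using int_g by (simp add: lborel_distr_plus)
    ultimately show "integrable lborel (\<lambda>x. g (x + s n *\<^sub>R v))"
      by (subst (asm) integrable_distr_eq) (auto simp: add.commute)
    have "(\<integral>x. g x \<partial>lborel) = (\<integral>x. g x \<partial>distr lborel borel ((+) (s n *\<^sub>R v)))"
      by (simp add: lborel_distr_plus)
    also have "\<dots> = (\<integral>x. g (x + s n *\<^sub>R v) \<partial>lborel)"
      by (subst integral_distr) (auto simp: add.commute)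
    finally show "(\<integral>x. g (x + s n *\<^sub>R v) \<partial>lborel) = (\<integral>x. g x \<partial>lborel)" by simp
  qed
  have q0: "(\<integral>x. q n x \<partial>lborel) = 0" for n
    unfolding q_def using int_shift int_g shift by simp
  have bound: "norm (q n x) \<le> indicator K x * B" for n x
  proof (cases "x \<in> cball a (R + 1)")
    case True
    have "\<exists>z. 0 < z \<and> z < s n \<and> g (x + s n *\<^sub>R v) - g (x + 0 *\<^sub>R v) = (s n - 0) * (Dg (x + z *\<^sub>R v) \<bullet> v)"
      by (rule MVT2[OF s_pos]) (use gderiv_along_line[OF g] in auto)
    then obtain z where z: "0 < z" "z < s n" "g (x + s n *\<^sub>R v) - g x = s n * (Dg (x + z *\<^sub>R v) \<bullet> v)"
      by auto
    have "norm (z *\<^sub>R v) \<le> 1"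
      using z s_le[of n] v by (auto intro!: mult_le_one)
    then have "x + z *\<^sub>R v \<in> K"
      using True norm_triangle_ineq[of "x - a" "z *\<^sub>R v"]
      by (auto simp: K_def dist_norm norm_minus_commute algebra_simps)
    have "norm (q n x) = \<bar>Dg (x + z *\<^sub>R v) \<bullet> v\<bar>"
      using s_pos[of n] by (simp add: q_def z(3))
    also have "\<dots> \<le> norm (Dg (x + z *\<^sub>R v)) * norm v"
      by (rule Cauchy_Schwarz_ineq2)
    also have "\<dots> \<le> B * 1"
      using B[OF \<open>x + z *\<^sub>R v \<in> K\<close>] v \<open>B > 0\<close> by (intro mult_mono) auto
    finally show ?thesis
      using True by (simp add: K_def)
  next
    case False
    have "norm (s n *\<^sub>R v) \<le> 1"
      using s_pos[of n] s_le[of n] v by (auto intro!: mult_le_one)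
    then have "x + s n *\<^sub>R v \<notin> cball a R"
      using False norm_triangle_ineq[of "x + s n *\<^sub>R v - a" "- (s n *\<^sub>R v)"]
      by (auto simp: dist_norm norm_minus_commute algebra_simps)
    moreover have "x \<notin> cball a R" using False by auto
    ultimately show ?thesis using supp \<open>B > 0\<close> by (simp add: q_def)
  qed
  have lim: "(\<lambda>n. q n x) \<longlonglongrightarrow> Dg x \<bullet> v" for x
  proof -
    have "((\<lambda>t. g (x + t *\<^sub>R v)) has_real_derivative Dg (x + 0 *\<^sub>R v) \<bullet> v) (at 0)"
      by (rule gderiv_along_line[OF g])
    then have "((\<lambda>h. (g (x + h *\<^sub>R v) - g x) / h) \<longlongrightarrow> Dg x \<bullet> v) (at 0)"
      by (simp add: DERIV_def)
    moreover have "filterlim s (at 0) sequentially"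
      using s0 s_pos by (auto simp: filterlim_at eventually_sequentially less_imp_neq[symmetric])
    ultimately show ?thesis
      unfolding q_def by (rule filterlim_compose)
  qed
  have "(\<lambda>n. \<integral>x. q n x \<partial>lborel) \<longlonglongrightarrow> (\<integral>x. Dg x \<bullet> v \<partial>lborel)"
  proof (rule integral_dominated_convergence[where w="\<lambda>x. indicator K x * B"])
    show "integrable lborel (\<lambda>x. indicator K x * B)"
      unfolding K_def
      by (intro integrable_mult_left integrable_real_indicator) (use emeasure_lborel_cball_finite[of a "R + 2"] in auto)
  qed (use lim bound in \<open>auto simp: q_def\<close>)
  then show ?thesis
    using q0 by (simp add: LIMSEQ_const_iff)
qed

text \<open>The mean value inequality turns the bound w on F' into a majorant of the difference
  quotients.\<close>

lemma has_real_derivative_integral_dominated: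
  fixes F F' :: "real \<Rightarrow> 'a \<Rightarrow> real"
  assumes t: "t \<in> {a<..<b}"
    and int: "\<And>s. s \<in> {a<..<b} \<Longrightarrow> integrable M (F s)"
    and deriv: "\<And>s x. s \<in> {a<..<b} \<Longrightarrow> ((\<lambda>s. F s x) has_real_derivative F' s x) (at s)"
    and bound: "\<And>s x. s \<in> {a<..<b} \<Longrightarrow> \<bar>F' s x\<bar> \<le> w x"
    and w: "integrable M w" and meas: "F' t \<in> borel_measurable M"
  shows "((\<lambda>s. \<integral>x. F s x \<partial>M) has_real_derivative (\<integral>x. F' t x \<partial>M)) (at t)"
  unfolding DERIV_def tendsto_at_iff_sequentially comp_def
proof (intro allI impI)
  fix X :: "nat \<Rightarrow> real" assume X0: "\<forall>i. X i \<in> UNIV - {0}" and X: "X \<longlonglongrightarrow> 0"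
  have "eventually (\<lambda>n. t + X n \<in> {a<..<b}) sequentially"
    using t by (intro topological_tendstoD[OF tendsto_add[OF tendsto_const X]]) auto
  then obtain N where N: "\<And>n. n \<ge> N \<Longrightarrow> t + X n \<in> {a<..<b}"
    by (auto simp: eventually_sequentially)
  \<comment> \<open>Dropping the first N terms puts every t + Y n into the interval, so that the
    majorant holds for all n and not only eventually.\<close>
  define Y where "Y n = X (n + N)" for n
  have Y: "t + Y n \<in> {a<..<b}" "Y n \<noteq> 0" for n
    using N[of "n + N"] X0 by (auto simp: Y_def)
  have Ylim: "Y \<longlonglongrightarrow> 0"
    unfolding Y_def using X by (rule LIMSEQ_ignore_initial_segment)
  have eq: "((\<integral>x. F (t + Y n) x \<partial>M) - (\<integral>x. F t x \<partial>M)) / Y n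
      = (\<integral>x. (F (t + Y n) x - F t x) / Y n \<partial>M)" for n
    using int[OF Y(1)[of n]] int[OF t] by simp
  have "(\<lambda>n. \<integral>x. (F (t + Y n) x - F t x) / Y n \<partial>M) \<longlonglongrightarrow> (\<integral>x. F' t x \<partial>M)"
  proof (rule integral_dominated_convergence[OF meas _ w])
    show "(\<lambda>x. (F (t + Y n) x - F t x) / Y n) \<in> borel_measurable M" for n
      using int[OF Y(1)[of n]] int[OF t] by auto
    show "AE x in M. (\<lambda>n. (F (t + Y n) x - F t x) / Y n) \<longlonglongrightarrow> F' t x"
    proof (rule AE_I2)
      fix x
      have "((\<lambda>h. (F (t + h) x - F t x) / h) \<longlongrightarrow> F' t x) (at 0)"
        using deriv[OF t] by (simp add: DERIV_def)
      moreover have "filterlim Y (at 0) sequentially"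
        using Ylim Y(2) by (auto simp: filterlim_at)
      ultimately show "(\<lambda>n. (F (t + Y n) x - F t x) / Y n) \<longlonglongrightarrow> F' t x"
        by (rule filterlim_compose)
    qed
    show "AE x in M. norm ((F (t + Y n) x - F t x) / Y n) \<le> w x" for n
    proof (rule AE_I2)
      fix x
      have "norm (F (t + Y n) x - F t x) \<le> w x * norm (t + Y n - t)"
      proof (rule field_differentiable_bound[of "{a<..<b}" "\<lambda>s. F s x" "\<lambda>s. F' s x"])
        show "((\<lambda>s. F s x) has_field_derivative F' s x) (at s within {a<..<b})" if "s \<in> {a<..<b}" for s
          using deriv[OF that] by (rule has_field_derivative_at_within)
      qed (use bound Y t in auto)
      then show "norm ((F (t + Y n) x - F t x) / Y n) \<le> w x"
        using Y(2)[of n] by (simp add: divide_le_eq)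
    qed
  qed
  then have "(\<lambda>n. ((\<integral>x. F (t + Y n) x \<partial>M) - (\<integral>x. F t x \<partial>M)) / Y n) \<longlonglongrightarrow> (\<integral>x. F' t x \<partial>M)"
    by (simp add: eq)
  then show "(\<lambda>n. ((\<integral>x. F (t + X n) x \<partial>M) - (\<integral>x. F t x \<partial>M)) / X n) \<longlonglongrightarrow> (\<integral>x. F' t x \<partial>M)"
    unfolding Y_def by (rule LIMSEQ_offset)
qed

section \<open>Integration by parts and local Poincare inequalities\<close>

text \<open>Total differentiability identifies each coordinate \<open>deriv\<close> with the
  derivative applied to an axis vector, so \<open>grad\<close> is the true gradient.\<close>

lemma gderiv_grad:
  assumes "f differentiable (at x)"
  shows "GDERIV f x :> grad f x"
proof -
  from assms obtain f' where f': "(f has_derivative f') (at x)"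
    by (auto simp: differentiable_def)
  then interpret bounded_linear f' by (rule has_derivative_bounded_linear)
  have "partial_deriv i f x = f' (axis i 1)" for i
  proof -
    have "((\<lambda>t. x + t *\<^sub>R axis i (1::real)) has_derivative (\<lambda>h. h *\<^sub>R axis i 1)) (at 0)"
      by (auto intro!: derivative_eq_intros)
    moreover have "(f has_derivative f') (at (x + 0 *\<^sub>R axis i (1::real)))"
      using f' by simp
    ultimately have "((\<lambda>t. f (x + t *\<^sub>R axis i 1)) has_derivative (\<lambda>h. f' (h *\<^sub>R axis i 1))) (at 0)"
      by (rule has_derivative_compose)
    moreover have "(\<lambda>h. f' (h *\<^sub>R axis i 1)) = (*) (f' (axis i 1))"
      by (auto simp: scaleR)
    ultimately show ?thesis
      by (simp add: partial_deriv_def DERIV_imp_deriv has_field_derivative_def)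
  qed
  then have "f' h = h \<bullet> grad f x" for h
  proof -
    have "f' h = f' (\<Sum>i\<in>UNIV. (h $ i) *\<^sub>R axis i 1)"
      using basis_expansion[of h] by (simp add: scalar_mult_eq_scaleR)
    also have "\<dots> = (\<Sum>i\<in>UNIV. (h $ i) * f' (axis i 1))"
      by (simp add: sum scaleR)
    finally show ?thesis
      using \<open>\<And>i. partial_deriv i f x = f' (axis i 1)\<close> by (simp add: inner_vec_def grad_def)
  qed
  then have "f' = (\<lambda>h. h \<bullet> grad f x)" by auto
  with f' show ?thesis by (simp add: gderiv_def)
qed

lemma C_k_Suc_D: "C_k (Suc k) f \<Longrightarrow> C_k k f"
proof (induction k arbitrary: f)
  case 0
  then show ?case by (simp add: differentiable_imp_continuous_on)
next
  case (Suc k)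
  then show ?case by (metis C_k.simps(2))
qed

text \<open>The passage from the coordinate notions of the statement to the coordinate-free
  \<open>C1_grad\<close>; it is used for V, for W and for the partial derivatives of W.\<close>

lemma C_k_1_C1_grad:
  assumes "C_k (Suc 0) f"
  shows "C1_grad f (grad f)"
proof -
  have "continuous_on UNIV (\<lambda>x. \<chi> i. partial_deriv i f x)"
    using assms by (intro continuous_on_vec_lambda) auto
  then have "continuous_on UNIV (grad f)"
    by (simp add: grad_def[abs_def])
  moreover have "GDERIV f x :> grad f x" for x
    using assms by (intro gderiv_grad) (simp add: differentiable_on_def)
  ultimately show ?thesis by (simp add: C1_grad_def)
qed

lemma C1_grad_eq_0_outside:
  assumes q: "C1_grad q Dq" and supp: "\<And>x. x \<notin> cball a R \<Longrightarrow> q x = 0" and x: "x \<notin> cball a R"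
  shows "Dq x = 0"
proof -
  have "(q has_derivative (\<lambda>h. h \<bullet> Dq x)) (at x)"
    using C1_grad_D[OF q] by (simp add: gderiv_def)
  moreover have "(q has_derivative (\<lambda>h. 0)) (at x)"
    by (rule has_derivative_transform_within_open[where f="\<lambda>_. 0" and s="- cball a R"])
      (use supp x in \<open>auto simp: open_Compl\<close>)
  ultimately have "(\<lambda>h. h \<bullet> Dq x) = (\<lambda>h. 0)"
    by (rule has_derivative_unique)
  then show ?thesis
    by (metis inner_eq_zero_iff)
qed

text \<open>Green's identity without boundary term: the integrand is the divergence of
  \<open>q *\<^sub>R grad W\<close>, and its i-th summand is the derivative in direction i of the
  compactly supported \<open>q * partial_deriv i W\<close>.\<close>

lemma integral_grad_inner_eq_laplacian:
  fixes q W :: "real^'n::finite \<Rightarrow> real"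
  assumes q: "C1_grad q Dq" and supp: "\<And>x. x \<notin> cball a R \<Longrightarrow> q x = 0" and W: "C_k 2 W"
  shows "integrable lborel (\<lambda>x. q x * laplacian W x + grad W x \<bullet> Dq x)"
    and "(\<integral>x. q x * laplacian W x + grad W x \<bullet> Dq x \<partial>lborel) = 0"
proof -
  define G where "G i x = q x *\<^sub>R grad (partial_deriv i W) x + partial_deriv i W x *\<^sub>R Dq x" for i x
  have W1: "C1_grad (partial_deriv i W) (grad (partial_deriv i W))" for i
    using W by (intro C_k_1_C1_grad) (simp add: numeral_2_eq_2)
  have G: "C1_grad (\<lambda>x. q x * partial_deriv i W x) (G i)" for i
    unfolding G_def by (rule C1_grad_mult[OF q W1])
  have supp': "x \<notin> cball a R \<Longrightarrow> q x * partial_deriv i W x = 0" for i x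
    using supp by auto
  have int0: "(\<integral>x. G i x \<bullet> axis i 1 \<partial>lborel) = 0" for i
    by (rule integral_directional_deriv_eq_0[OF G supp']) auto
  have int: "integrable lborel (\<lambda>x. G i x \<bullet> axis i 1)" for i
  proof (rule integrable_lborel_compact_support[of _ a R])
    show "continuous_on UNIV (\<lambda>x. G i x \<bullet> axis i 1)"
      using C1_grad_continuous_grad[OF G] by (intro continuous_intros)
    show "G i x \<bullet> axis i 1 = 0" if "x \<notin> cball a R" for x
      using C1_grad_eq_0_outside[OF G supp' that] by simp
  qed
  have eq: "q x * laplacian W x + grad W x \<bullet> Dq x = (\<Sum>i\<in>UNIV. G i x \<bullet> axis i 1)" for x
  proof -
    have "G i x \<bullet> axis i 1 = q x * partial_deriv i (partial_deriv i W) x + partial_deriv i W x * Dq x $ i" for i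
      by (simp add: G_def inner_axis grad_def)
    then show ?thesis
      by (simp add: laplacian_def grad_def inner_vec_def sum.distrib sum_distrib_left)
  qed
  show "integrable lborel (\<lambda>x. q x * laplacian W x + grad W x \<bullet> Dq x)"
    unfolding eq using int by auto
  show "(\<integral>x. q x * laplacian W x + grad W x \<bullet> Dq x \<partial>lborel) = 0"
    unfolding eq using int int0 by simp
qed

text \<open>
  Integrating \<open>\<nabla>\<cdot>((g\<^sup>2 w / W) \<nabla>W)\<close> and completing the square gives
  \<open>\<integral> (- LW / W) g\<^sup>2 \<le> \<integral> \<bar>\<nabla>g\<bar>\<^sup>2\<close>.
\<close>

lemma lyapunov_compact_support:
  fixes V W :: "real^'n::finite \<Rightarrow> real"
  assumes V: "smooth V" and W: "C_k 2 W" and W1: "\<And>x. 1 \<le> W x" and Z: "0 \<le> Z"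
    and lyap: "\<And>x. generator V W x \<le> (- c * (dist x x0)\<^sup>2 + b) * W x"
    and g: "C1_grad g Dg" and supp: "\<And>x. x \<notin> cball a R \<Longrightarrow> g x = 0"
  shows "0 \<le> (\<integral>x. ((norm (Dg x))\<^sup>2 + (b - c * (dist x x0)\<^sup>2) * (g x)\<^sup>2) * (Z * exp (- V x)) \<partial>lborel)"
proof -
  define w where "w x = Z * exp (- V x)" for x
  have CV: "C1_grad V (grad V)"
    using V by (intro C_k_1_C1_grad) (simp add: smooth_def)
  have CW: "C1_grad W (grad W)"
    using W C_k_Suc_D[of 1 W] by (intro C_k_1_C1_grad) (simp add: numeral_2_eq_2)
  have Cw: "C1_grad w (\<lambda>x. - w x *\<^sub>R grad V x)"
    using C1_grad_cmult[OF C1_grad_exp[OF C1_grad_cmult[OF CV, of "-1"]], of Z]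
    by (simp add: w_def[abs_def])
  have Wnz: "W x \<noteq> 0" and Wpos: "W x > 0" for x
    using W1[of x] by auto
  \<comment> \<open>The test function is g^2 w / W. Its factor w has gradient - w \<nabla>V, which
    contributes the drift that turns \<open>laplacian W\<close> into
    \<open>generator V W\<close>.\<close>
  have Cq: "C1_grad (\<lambda>x. (g x * g x * w x) * inverse (W x))
    (\<lambda>x. (g x * g x * w x) *\<^sub>R (- (inverse (W x))\<^sup>2) *\<^sub>R grad W x
      + inverse (W x) *\<^sub>R ((g x * g x) *\<^sub>R (- w x *\<^sub>R grad V x) + w x *\<^sub>R (g x *\<^sub>R Dg x + g x *\<^sub>R Dg x)))"
    (is "C1_grad ?q ?Dq")
    by (intro C1_grad_mult C1_grad_inverse g Cw CW Wnz)
  have supp': "x \<notin> cball a R \<Longrightarrow> ?q x = 0" for x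
    using supp by auto
  note ibp = integral_grad_inner_eq_laplacian[OF Cq supp' W]
  define rhs where "rhs x = ((norm (Dg x))\<^sup>2 + (b - c * (dist x x0)\<^sup>2) * (g x)\<^sup>2) * w x" for x
  have "continuous_on UNIV rhs"
    unfolding rhs_def using C1_grad_continuous[OF Cw] C1_grad_continuous[OF g] C1_grad_continuous_grad[OF g]
    by (intro continuous_intros)
  then have int: "integrable lborel rhs"
    by (rule integrable_lborel_compact_support[of _ a R])
      (use C1_grad_eq_0_outside[OF g supp] supp in \<open>auto simp: rhs_def\<close>)
  have "?q x * laplacian W x + grad W x \<bullet> ?Dq x \<le> rhs x" for x
  proof -
    have w0: "0 \<le> w x" using Z by (simp add: w_def)
    define r where "r = g x / W x"
    have "?q x * laplacian W x + grad W x \<bullet> ?Dq x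
      = w x * ((g x)\<^sup>2 * (generator V W x / W x) + (2 * r * (grad W x \<bullet> Dg x) - r\<^sup>2 * (grad W x \<bullet> grad W x)))"
      using Wnz[of x]
      unfolding generator_def r_def inner_add_right inner_scaleR_right inner_minus_right
      by (simp add: power2_eq_square field_simps inner_commute[of "grad V x"])
    also have "2 * r * (grad W x \<bullet> Dg x) - r\<^sup>2 * (grad W x \<bullet> grad W x)
        = (norm (Dg x))\<^sup>2 - (norm (Dg x - r *\<^sub>R grad W x))\<^sup>2"
      unfolding power2_norm_eq_inner
      by (simp add: inner_diff_left inner_diff_right inner_commute power2_eq_square algebra_simps)
    also have "w x * ((g x)\<^sup>2 * (generator V W x / W x) + \<dots>)
        \<le> w x * ((g x)\<^sup>2 * (- c * (dist x x0)\<^sup>2 + b) + (norm (Dg x))\<^sup>2)"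
      using lyap[of x] Wpos[of x] w0
      by (intro mult_left_mono add_mono) (auto simp: pos_divide_le_eq)
    finally show ?thesis
      by (simp add: rhs_def algebra_simps)
  qed
  then have "0 \<le> (\<integral>x. rhs x \<partial>lborel)"
    using integral_mono[OF ibp(1) int] ibp(2) by simp
  then show ?thesis by (simp add: rhs_def w_def)
qed

section \<open>Poincare inequality on balls\<close>

text \<open>Cauchy-Schwarz along the segment. The bound is a nonnegative integral, so that later
  changes in the order of integration need no integrability.\<close>

lemma segment_square_le:
  fixes g :: "'a::euclidean_space \<Rightarrow> real"
  assumes g: "C1_grad g Dg"
  shows "ennreal ((g y - g x)\<^sup>2)
    \<le> (\<integral>\<^sup>+s. indicator {0..1} s * ennreal ((norm (y - x))\<^sup>2 * (norm (Dg (x + s *\<^sub>R (y - x))))\<^sup>2) \<partial>lborel)"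
proof -
  define \<phi> where "\<phi> s = Dg (x + s *\<^sub>R (y - x)) \<bullet> (y - x)" for s
  have "continuous_on UNIV (\<lambda>s. Dg (x + s *\<^sub>R (y - x)))"
    by (rule continuous_on_compose2[OF C1_grad_continuous_grad[OF g]]) (auto intro!: continuous_intros)
  then have cont: "continuous_on S \<phi>" for S
    unfolding \<phi>_def by (intro continuous_intros) (auto intro: continuous_on_subset)
  have int: "set_integrable lborel {0..1} \<phi>" "set_integrable lborel {0..1} (\<lambda>s. (\<phi> s)\<^sup>2)"
    "set_integrable lborel {0..1::real} (\<lambda>s. m\<^sup>2)" for m :: real
    by (intro borel_integrable_atLeastAtMost' continuous_intros cont)+
  define m where "m = g y - g x"
  have ftc: "(LBINT s:{0..1}. \<phi> s) = m"
    unfolding m_def set_lebesgue_integral_def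
    using integral_FTC_atLeastAtMost[of 0 1 "\<lambda>s. g (x + s *\<^sub>R (y - x))" \<phi>] cont gderiv_along_line[OF g]
    by (simp add: \<phi>_def has_real_derivative_iff_has_vector_derivative)
  have const: "(LBINT s:{0..1::real}. m\<^sup>2) = m\<^sup>2"
    by (simp add: set_lebesgue_integral_def)
  \<comment> \<open>m is the mean of \<phi> over the unit interval; a nonnegative variance is
    Jensen's inequality for the square.\<close>
  have "0 \<le> (LBINT s:{0..1}. (\<phi> s - m)\<^sup>2)"
    unfolding set_lebesgue_integral_def by (rule Bochner_Integration.integral_nonneg) auto
  also have "\<dots> = (LBINT s:{0..1}. (\<phi> s)\<^sup>2 - (2 * m) * \<phi> s + m\<^sup>2)"
    by (intro set_lebesgue_integral_cong) (auto simp: power2_diff)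
  also have "\<dots> = (LBINT s:{0..1}. (\<phi> s)\<^sup>2) - 2 * m * m + m\<^sup>2"
    using int(1,2) int(3)[of m] by (simp add: set_integral_add set_integral_diff ftc const)
  finally have "m\<^sup>2 \<le> (LBINT s:{0..1}. (\<phi> s)\<^sup>2)"
    by (simp add: power2_eq_square)
  then have "ennreal (m\<^sup>2) \<le> ennreal (\<integral>s. indicator {0..1} s * (\<phi> s)\<^sup>2 \<partial>lborel)"
    by (simp add: set_lebesgue_integral_def)
  also have "\<dots> = (\<integral>\<^sup>+s. ennreal (indicator {0..1} s * (\<phi> s)\<^sup>2) \<partial>lborel)"
    using int(2) by (intro nn_integral_eq_integral[symmetric]) (auto simp: set_integrable_def)
  also have "\<dots> \<le> (\<integral>\<^sup>+s. indicator {0..1} s * ennreal ((norm (y - x))\<^sup>2 * (norm (Dg (x + s *\<^sub>R (y - x))))\<^sup>2) \<partial>lborel)"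
  proof (intro nn_integral_mono)
    fix s
    have "(\<phi> s)\<^sup>2 \<le> (norm (Dg (x + s *\<^sub>R (y - x))) * norm (y - x))\<^sup>2"
      unfolding \<phi>_def by (rule abs_le_square_iff[THEN iffD1]) (simp add: Cauchy_Schwarz_ineq2)
    then show "ennreal (indicator {0..1} s * (\<phi> s)\<^sup>2)
        \<le> indicator {0..1} s * ennreal ((norm (y - x))\<^sup>2 * (norm (Dg (x + s *\<^sub>R (y - x))))\<^sup>2)"
      by (auto simp: indicator_def power_mult_distrib mult.commute intro!: ennreal_leI)
  qed
  finally show ?thesis by (simp add: m_def)
qed

text \<open>The Jacobian of the affine map is c^n \<ge> 2^(-n), with n the dimension.\<close>

lemma nn_integral_affine_le:
  fixes f :: "'a::euclidean_space \<Rightarrow> ennreal"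
  assumes [measurable]: "f \<in> borel_measurable borel" and c: "1 / 2 \<le> c"
  shows "(\<integral>\<^sup>+x. f (t + c *\<^sub>R x) \<partial>lborel) \<le> ennreal (2 ^ DIM('a)) * (\<integral>\<^sup>+x. f x \<partial>lborel)"
proof -
  have "(\<integral>\<^sup>+x. f x \<partial>lborel) = ennreal (c ^ DIM('a)) * (\<integral>\<^sup>+x. f (t + c *\<^sub>R x) \<partial>lborel)"
    using c by (subst lborel_affine[of c t]) (auto simp: nn_integral_density nn_integral_distr nn_integral_cmult)
  then have "ennreal (2 ^ DIM('a)) * (\<integral>\<^sup>+x. f x \<partial>lborel)
      = ennreal ((2 * c) ^ DIM('a)) * (\<integral>\<^sup>+x. f (t + c *\<^sub>R x) \<partial>lborel)"
    using c by (simp add: mult.assoc[symmetric] ennreal_mult[symmetric] power_mult_distrib)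
  moreover have "1 \<le> (2 * c) ^ DIM('a)"
    using c by (intro one_le_power) simp
  then have "1 \<le> ennreal ((2 * c) ^ DIM('a))"
    by (metis ennreal_1 ennreal_leI)
  ultimately show ?thesis
    using mult_right_mono[of 1 "ennreal ((2 * c) ^ DIM('a))" "\<integral>\<^sup>+x. f (t + c *\<^sub>R x) \<partial>lborel"] by simp
qed

text \<open>For fixed y in B the map x \<mapsto> (1 - s) x + s y sends B into B by convexity. Its
  scale 1 - s is at least 1 / 2, which keeps the Jacobian away from 0.\<close>

lemma nn_integral_convex_combination_le:
  fixes G :: "'a::euclidean_space \<Rightarrow> ennreal"
  assumes [measurable]: "G \<in> borel_measurable borel" and B: "convex B" "B \<in> sets borel" and s: "s \<in> {0..1/2}"
  shows "(\<integral>\<^sup>+y. indicator B y * (\<integral>\<^sup>+x. indicator B x * G ((1 - s) *\<^sub>R x + s *\<^sub>R y) \<partial>lborel) \<partial>lborel)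
    \<le> emeasure lborel B * (ennreal (2 ^ DIM('a)) * (\<integral>\<^sup>+x. indicator B x * G x \<partial>lborel))"
proof -
  have [measurable]: "B \<in> sets borel" by fact
  have "(\<integral>\<^sup>+x. indicator B x * G ((1 - s) *\<^sub>R x + s *\<^sub>R y) \<partial>lborel)
      \<le> ennreal (2 ^ DIM('a)) * (\<integral>\<^sup>+x. indicator B x * G x \<partial>lborel)" if y: "y \<in> B" for y
  proof -
    have "(\<integral>\<^sup>+x. indicator B x * G ((1 - s) *\<^sub>R x + s *\<^sub>R y) \<partial>lborel)
        \<le> (\<integral>\<^sup>+x. (\<lambda>x. indicator B x * G x) (s *\<^sub>R y + (1 - s) *\<^sub>R x) \<partial>lborel)"
    proof (intro nn_integral_mono)
      fix x
      have "x \<in> B \<Longrightarrow> s *\<^sub>R y + (1 - s) *\<^sub>R x \<in> B"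
        using B(1) y s by (auto intro!: convexD)
      then show "indicator B x * G ((1 - s) *\<^sub>R x + s *\<^sub>R y)
          \<le> (\<lambda>x. indicator B x * G x) (s *\<^sub>R y + (1 - s) *\<^sub>R x)"
        by (auto simp: indicator_def add.commute)
    qed
    also have "\<dots> \<le> ennreal (2 ^ DIM('a)) * (\<integral>\<^sup>+x. indicator B x * G x \<partial>lborel)"
      using s by (intro nn_integral_affine_le) auto
    finally show ?thesis .
  qed
  then have "(\<integral>\<^sup>+y. indicator B y * (\<integral>\<^sup>+x. indicator B x * G ((1 - s) *\<^sub>R x + s *\<^sub>R y) \<partial>lborel) \<partial>lborel)
    \<le> (\<integral>\<^sup>+y. indicator B y * (ennreal (2 ^ DIM('a)) * (\<integral>\<^sup>+x. indicator B x * G x \<partial>lborel)) \<partial>lborel)"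
    by (intro nn_integral_mono) (auto simp: indicator_def)
  also have "\<dots> = emeasure lborel B * (ennreal (2 ^ DIM('a)) * (\<integral>\<^sup>+x. indicator B x * G x \<partial>lborel))"
    by (subst nn_integral_multc) auto
  finally show ?thesis .
qed

text \<open>Averaged over y in B, the integral of (g x - g y)^2 over x in B is at most the
  right-hand side, so some value m = g y does not exceed it. The factor 4 R^2 is the squared
  diameter, 2^n the Jacobian bound. The argument is by contradiction: if every m fails, integration
  over y yields the opposite strict inequality.\<close>

lemma poincare_cball_lborel:
  fixes g :: "'a::euclidean_space \<Rightarrow> real" and x0 :: 'a
  assumes g: "C1_grad g Dg" and R: "0 < R"
  defines "B \<equiv> cball x0 R"
  shows "\<exists>m. (\<integral>\<^sup>+x. indicator B x * ennreal ((g x - m)\<^sup>2) \<partial>lborel)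
    \<le> ennreal (4 * R\<^sup>2 * 2 ^ DIM('a)) * (\<integral>\<^sup>+x. indicator B x * ennreal ((norm (Dg x))\<^sup>2) \<partial>lborel)"
proof (rule ccontr)
  assume neg: "\<nexists>m. (\<integral>\<^sup>+x. indicator B x * ennreal ((g x - m)\<^sup>2) \<partial>lborel)
    \<le> ennreal (4 * R\<^sup>2 * 2 ^ DIM('a)) * (\<integral>\<^sup>+x. indicator B x * ennreal ((norm (Dg x))\<^sup>2) \<partial>lborel)"
  have [measurable]: "B \<in> sets borel" and conv: "convex B" by (auto simp: B_def)
  have [measurable]: "g \<in> borel_measurable borel" "Dg \<in> borel_measurable borel"
    using C1_grad_measurable[OF g] by auto
  define G where "G x = ennreal ((norm (Dg x))\<^sup>2)" for x
  have [measurable]: "G \<in> borel_measurable borel" by (simp add: G_def[abs_def])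
  define I where "I = (\<integral>\<^sup>+x. indicator B x * G x \<partial>lborel)"
  define L where "L = ennreal (4 * R\<^sup>2 * 2 ^ DIM('a)) * I"
  have B_fin: "emeasure lborel B < \<infinity>" and B_pos: "emeasure lborel B > 0"
    unfolding B_def using R emeasure_lborel_cball_finite[of x0 R]
    by (auto simp: emeasure_cball ennreal_zero_less_mult_iff unit_ball_vol_pos)
  define h where "h s x y = indicator {0..1::real} s * (indicator B y * (indicator B x *
    (ennreal (4 * R\<^sup>2) * G ((1 - s) *\<^sub>R x + s *\<^sub>R y))))" for s x y
  have [measurable]: "(\<lambda>(s, x). h s x y) \<in> borel_measurable (borel \<Otimes>\<^sub>M borel)"
    "(\<lambda>(s, x, y). h s x y) \<in> borel_measurable (borel \<Otimes>\<^sub>M borel \<Otimes>\<^sub>M borel)" for y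
    unfolding h_def by measurable
  have slice: "(\<integral>\<^sup>+y. \<integral>\<^sup>+x. h s x y \<partial>lborel \<partial>lborel) \<le> indicator {0..1} s * (emeasure lborel B * L)" for s
  proof (cases "s \<in> {0..1}")
    case True
    have G1: "(\<integral>\<^sup>+y. indicator B y * (\<integral>\<^sup>+x. indicator B x * (ennreal (4 * R\<^sup>2) * G ((1 - s) *\<^sub>R x + s *\<^sub>R y)) \<partial>lborel) \<partial>lborel)
        \<le> emeasure lborel B * L" (is "?lhs \<le> _")
    proof (cases "s \<le> 1 / 2")
      case s: True
      have "?lhs \<le> emeasure lborel B * (ennreal (2 ^ DIM('a)) * (\<integral>\<^sup>+x. indicator B x * (ennreal (4 * R\<^sup>2) * G x) \<partial>lborel))"
        by (rule nn_integral_convex_combination_le[OF _ conv]) (use True s in auto)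
      also have "\<dots> = emeasure lborel B * L"
        unfolding L_def I_def
        by (subst mult.left_commute, subst nn_integral_cmult)
          (auto simp: ennreal_mult mult_ac)
      finally show ?thesis .
    next
      \<comment> \<open>For s > 1 / 2 the weight of y is the larger one, so x and y exchange roles
        and 1 - s takes the place of s.\<close>
      case s: False
      have "?lhs = (\<integral>\<^sup>+y. \<integral>\<^sup>+x. indicator B y * (indicator B x * (ennreal (4 * R\<^sup>2) * G ((1 - s) *\<^sub>R x + s *\<^sub>R y))) \<partial>lborel \<partial>lborel)"
        by (intro nn_integral_cong nn_integral_cmult[symmetric]) measurable
      also have "\<dots> = (\<integral>\<^sup>+x. \<integral>\<^sup>+y. indicator B y * (indicator B x * (ennreal (4 * R\<^sup>2) * G ((1 - s) *\<^sub>R x + s *\<^sub>R y))) \<partial>lborel \<partial>lborel)"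
        by (rule lborel_pair.Fubini') measurable
      also have "\<dots> = (\<integral>\<^sup>+x. indicator B x * (\<integral>\<^sup>+y. indicator B y * (ennreal (4 * R\<^sup>2) * G ((1 - (1 - s)) *\<^sub>R y + (1 - s) *\<^sub>R x)) \<partial>lborel) \<partial>lborel)"
        by (intro nn_integral_cong, subst nn_integral_cmult[symmetric])
          (auto simp: mult.left_commute add.commute intro!: nn_integral_cong)
      also have "\<dots> \<le> emeasure lborel B * (ennreal (2 ^ DIM('a)) * (\<integral>\<^sup>+x. indicator B x * (ennreal (4 * R\<^sup>2) * G x) \<partial>lborel))"
        by (rule nn_integral_convex_combination_le[OF _ conv]) (use True s in auto)
      also have "\<dots> = emeasure lborel B * L"
        unfolding L_def I_def
        by (subst mult.left_commute, subst nn_integral_cmult)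
          (auto simp: ennreal_mult mult_ac)
      finally show ?thesis .
    qed
    have "(\<integral>\<^sup>+y. \<integral>\<^sup>+x. h s x y \<partial>lborel \<partial>lborel) = ?lhs"
      using True by (intro nn_integral_cong) (auto simp: h_def intro!: nn_integral_cmult)
    with G1 True show ?thesis by simp
  qed (simp add: h_def)
  have "(\<integral>\<^sup>+y. indicator B y * (\<integral>\<^sup>+x. indicator B x * ennreal ((g x - g y)\<^sup>2) \<partial>lborel) \<partial>lborel)
      \<le> (\<integral>\<^sup>+y. \<integral>\<^sup>+x. \<integral>\<^sup>+s. h s x y \<partial>lborel \<partial>lborel \<partial>lborel)"
  proof (intro nn_integral_mono)
    fix y
    have pt: "ennreal ((g x - g y)\<^sup>2) \<le> (\<integral>\<^sup>+s. h s x y \<partial>lborel)" if "x \<in> B" "y \<in> B" for x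
    proof -
      have "norm (y - x) \<le> 2 * R"
        using that dist_triangle2[of x y x0] by (auto simp: B_def dist_norm norm_minus_commute)
      then have "(norm (y - x))\<^sup>2 \<le> 4 * R\<^sup>2"
        using power_mono[of "norm (y - x)" "2 * R" 2] by (simp add: power_mult_distrib)
      moreover have seg: "(1 - s) *\<^sub>R x + s *\<^sub>R y = x + s *\<^sub>R (y - x)" for s
        by (simp add: algebra_simps)
      ultimately have "(\<integral>\<^sup>+s. indicator {0..1} s * ennreal ((norm (y - x))\<^sup>2 * (norm (Dg (x + s *\<^sub>R (y - x))))\<^sup>2) \<partial>lborel)
         \<le> (\<integral>\<^sup>+s. h s x y \<partial>lborel)"
        using that
        by (intro nn_integral_mono)
          (auto simp: h_def G_def indicator_def ennreal_mult[symmetric] seg intro!: ennreal_leI mult_right_mono)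
      with segment_square_le[OF g, of y x] show ?thesis
        by (simp add: power2_commute)
    qed
    show "indicator B y * (\<integral>\<^sup>+x. indicator B x * ennreal ((g x - g y)\<^sup>2) \<partial>lborel)
        \<le> (\<integral>\<^sup>+x. \<integral>\<^sup>+s. h s x y \<partial>lborel \<partial>lborel)"
    proof (cases "y \<in> B")
      case True
      then show ?thesis
        by (auto intro!: nn_integral_mono simp: pt indicator_def)
    qed simp
  qed
  also have "\<dots> = (\<integral>\<^sup>+y. \<integral>\<^sup>+s. \<integral>\<^sup>+x. h s x y \<partial>lborel \<partial>lborel \<partial>lborel)"
    unfolding h_def by (intro nn_integral_cong lborel_pair.Fubini') measurable
  also have "\<dots> = (\<integral>\<^sup>+s. \<integral>\<^sup>+y. \<integral>\<^sup>+x. h s x y \<partial>lborel \<partial>lborel \<partial>lborel)"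
    unfolding h_def by (rule lborel_pair.Fubini') measurable
  also have "\<dots> \<le> (\<integral>\<^sup>+s. indicator {0..1::real} s * (emeasure lborel B * L) \<partial>lborel)"
    by (rule nn_integral_mono) (rule slice)
  also have "\<dots> = (\<integral>\<^sup>+y. indicator B y * L \<partial>lborel)"
    by (simp add: nn_integral_multc)
  finally have le: "(\<integral>\<^sup>+y. indicator B y * (\<integral>\<^sup>+x. indicator B x * ennreal ((g x - g y)\<^sup>2) \<partial>lborel) \<partial>lborel)
      \<le> (\<integral>\<^sup>+y. indicator B y * L \<partial>lborel)" .
  \<comment> \<open>L has to be finite: a pointwise strict inequality survives integration only if
    the smaller integral is finite.\<close>
  have "bounded ((\<lambda>x. (norm (Dg x))\<^sup>2) ` B)"
    using C1_grad_continuous_grad[OF g]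
    by (intro compact_imp_bounded compact_continuous_image continuous_intros) (auto simp: B_def intro: continuous_on_subset)
  then obtain D where D: "\<And>x. x \<in> B \<Longrightarrow> (norm (Dg x))\<^sup>2 \<le> D" unfolding bounded_iff by auto
  have "I \<le> (\<integral>\<^sup>+x. indicator B x * ennreal D \<partial>lborel)"
    unfolding I_def G_def by (intro nn_integral_mono) (auto simp: indicator_def D intro: ennreal_leI)
  also have "\<dots> < \<infinity>"
    using B_fin by (simp add: nn_integral_multc ennreal_mult_less_top)
  finally have L_fin: "L < \<infinity>" by (simp add: L_def ennreal_mult_less_top)
  have "L < (\<integral>\<^sup>+x. indicator B x * ennreal ((g x - g y)\<^sup>2) \<partial>lborel)" for y
    using neg unfolding L_def I_def G_def by (simp add: not_le)
  then have "(\<integral>\<^sup>+y. indicator B y * L \<partial>lborel)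
     < (\<integral>\<^sup>+y. indicator B y * (\<integral>\<^sup>+x. indicator B x * ennreal ((g x - g y)\<^sup>2) \<partial>lborel) \<partial>lborel)"
  proof (intro nn_integral_less)
    assume lt: "\<And>y. L < (\<integral>\<^sup>+x. indicator B x * ennreal ((g x - g y)\<^sup>2) \<partial>lborel)"
    show "(\<integral>\<^sup>+y. indicator B y * L \<partial>lborel) \<noteq> \<infinity>"
      using B_fin L_fin by (simp add: nn_integral_multc ennreal_mult_eq_top_iff less_top)
    show "AE y in lborel. indicator B y * L \<le> indicator B y * (\<integral>\<^sup>+x. indicator B x * ennreal ((g x - g y)\<^sup>2) \<partial>lborel)"
      using lt by (intro AE_I2 mult_left_mono) (auto simp: less_imp_le)
    show "\<not> (AE y in lborel. indicator B y * (\<integral>\<^sup>+x. indicator B x * ennreal ((g x - g y)\<^sup>2) \<partial>lborel) \<le> indicator B y * L)"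
    proof
      assume "AE y in lborel. indicator B y * (\<integral>\<^sup>+x. indicator B x * ennreal ((g x - g y)\<^sup>2) \<partial>lborel) \<le> indicator B y * L"
      then have "AE y in lborel. y \<notin> B"
      proof eventually_elim
        case (elim y)
        show ?case
        proof
          assume "y \<in> B"
          with elim have "(\<integral>\<^sup>+x. indicator B x * ennreal ((g x - g y)\<^sup>2) \<partial>lborel) \<le> L" by simp
          with lt[of y] show False by (auto dest: leD)
        qed
      qed
      then have "emeasure lborel B = 0"
        using AE_iff_measurable[of B lborel "\<lambda>y. y \<notin> B"] by simp
      with B_pos show False by simp
    qed
  qed measurable
  with le show False by (simp add: not_le)
qed

text \<open>On the compact ball w lies between two positive constants; their ratio is the only loss
  against Lebesgue measure.\<close>

lemma poincare_cball_density:
  fixes w :: "'a::euclidean_space \<Rightarrow> real" and x0 :: 'a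
  assumes w: "continuous_on UNIV w" and w_pos: "\<And>x. 0 < w x" and R: "0 < R"
  shows "\<exists>\<kappa>\<ge>0. \<forall>g Dg. C1_grad g Dg \<longrightarrow> (\<exists>m.
    (\<integral>\<^sup>+x. indicator (cball x0 R) x * ennreal ((g x - m)\<^sup>2) \<partial>density lborel w)
      \<le> ennreal \<kappa> * (\<integral>\<^sup>+x. indicator (cball x0 R) x * ennreal ((norm (Dg x))\<^sup>2) \<partial>density lborel w))"
proof -
  define B where "B = cball x0 R"
  have [measurable]: "B \<in> sets borel" by (auto simp: B_def)
  have [measurable]: "w \<in> borel_measurable borel"
    using w by (rule borel_measurable_continuous_onI)
  have comp: "compact B" and ne: "B \<noteq> {}" using R by (auto simp: B_def)
  have "continuous_on B w" using w by (rule continuous_on_subset) auto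
  then obtain lo up where lo: "\<And>x. x \<in> B \<Longrightarrow> w lo \<le> w x" and up: "\<And>x. x \<in> B \<Longrightarrow> w x \<le> w up"
    using continuous_attains_inf[OF comp ne] continuous_attains_sup[OF comp ne] by metis
  define \<kappa> where "\<kappa> = w up * (4 * R\<^sup>2 * 2 ^ DIM('a)) / w lo"
  have "\<kappa> \<ge> 0" using w_pos[of up] w_pos[of lo] by (simp add: \<kappa>_def)
  moreover have "\<exists>m. (\<integral>\<^sup>+x. indicator B x * ennreal ((g x - m)\<^sup>2) \<partial>density lborel w)
      \<le> ennreal \<kappa> * (\<integral>\<^sup>+x. indicator B x * ennreal ((norm (Dg x))\<^sup>2) \<partial>density lborel w)"
    if g: "C1_grad g Dg" for g Dg
  proof -
    have [measurable]: "g \<in> borel_measurable borel" "Dg \<in> borel_measurable borel"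
      using C1_grad_measurable[OF g] by auto
    obtain m where m: "(\<integral>\<^sup>+x. indicator B x * ennreal ((g x - m)\<^sup>2) \<partial>lborel)
      \<le> ennreal (4 * R\<^sup>2 * 2 ^ DIM('a)) * (\<integral>\<^sup>+x. indicator B x * ennreal ((norm (Dg x))\<^sup>2) \<partial>lborel)"
      using poincare_cball_lborel[OF g R, of x0] by (auto simp: B_def)
    have "(\<integral>\<^sup>+x. indicator B x * ennreal ((g x - m)\<^sup>2) \<partial>density lborel w)
        = (\<integral>\<^sup>+x. ennreal (w x) * (indicator B x * ennreal ((g x - m)\<^sup>2)) \<partial>lborel)"
      by (subst nn_integral_density) auto
    also have "\<dots> \<le> (\<integral>\<^sup>+x. ennreal (w up) * (indicator B x * ennreal ((g x - m)\<^sup>2)) \<partial>lborel)"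
      by (intro nn_integral_mono) (auto simp: indicator_def up intro!: mult_right_mono ennreal_leI)
    also have "\<dots> = ennreal (w up) * (\<integral>\<^sup>+x. indicator B x * ennreal ((g x - m)\<^sup>2) \<partial>lborel)"
      by (rule nn_integral_cmult) measurable
    also have "\<dots> \<le> ennreal (w up) * (ennreal (4 * R\<^sup>2 * 2 ^ DIM('a)) * (\<integral>\<^sup>+x. indicator B x * ennreal ((norm (Dg x))\<^sup>2) \<partial>lborel))"
      by (intro mult_left_mono m) auto
    also have "\<dots> = ennreal \<kappa> * (\<integral>\<^sup>+x. ennreal (w lo) * (indicator B x * ennreal ((norm (Dg x))\<^sup>2)) \<partial>lborel)"
      using w_pos[of up] w_pos[of lo]
      by (subst nn_integral_cmult) (auto simp: \<kappa>_def mult.assoc[symmetric] ennreal_mult[symmetric])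
    also have "\<dots> \<le> ennreal \<kappa> * (\<integral>\<^sup>+x. ennreal (w x) * (indicator B x * ennreal ((norm (Dg x))\<^sup>2)) \<partial>lborel)"
      by (intro mult_left_mono nn_integral_mono) (auto simp: indicator_def lo intro!: mult_right_mono ennreal_leI)
    also have "\<dots> = ennreal \<kappa> * (\<integral>\<^sup>+x. indicator B x * ennreal ((norm (Dg x))\<^sup>2) \<partial>density lborel w)"
      by (subst nn_integral_density) auto
    finally show ?thesis by blast
  qed
  ultimately show ?thesis unfolding B_def by blast
qed

section \<open>Functional inequalities from the Lyapunov condition\<close>

text \<open>For passing to the limit when no integrable majorant of f is known in advance;
  integrability of F is part of the conclusion.\<close>

lemma integrable_Fatou:
  fixes f :: "nat \<Rightarrow> 'a \<Rightarrow> real"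
  assumes int: "\<And>n. integrable M (f n)" and nonneg: "\<And>n x. 0 \<le> f n x"
    and lim: "\<And>x. (\<lambda>n. f n x) \<longlonglongrightarrow> F x" and le: "\<And>n. (\<integral>x. f n x \<partial>M) \<le> r n" and r: "r \<longlonglongrightarrow> R"
  shows "integrable M F" and "(\<integral>x. F x \<partial>M) \<le> R"
proof -
  have F_nonneg: "0 \<le> F x" for x
    by (rule LIMSEQ_le_const[OF lim[of x]]) (use nonneg in auto)
  have [measurable]: "F \<in> borel_measurable M"
    by (rule borel_measurable_LIMSEQ_real[where u=f]) (simp_all add: lim int borel_measurable_integrable)
  have "(\<integral>\<^sup>+x. ennreal (F x) \<partial>M) = (\<integral>\<^sup>+x. liminf (\<lambda>n. ennreal (f n x)) \<partial>M)"
    using lim by (intro nn_integral_cong lim_imp_Liminf[symmetric] tendsto_ennrealI) auto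
  also have "\<dots> \<le> liminf (\<lambda>n. \<integral>\<^sup>+x. ennreal (f n x) \<partial>M)"
    using int by (intro nn_integral_liminf) auto
  also have "\<dots> = liminf (\<lambda>n. ennreal (\<integral>x. f n x \<partial>M))"
    using int nonneg by (simp add: nn_integral_eq_integral)
  also have "\<dots> \<le> liminf (\<lambda>n. ennreal (r n))"
    using le by (intro Liminf_mono always_eventually) (auto intro: ennreal_leI)
  also have "\<dots> = ennreal R"
    using r by (intro lim_imp_Liminf tendsto_ennrealI) auto
  finally have le_R: "(\<integral>\<^sup>+x. ennreal (F x) \<partial>M) \<le> ennreal R" .
  then show int_F: "integrable M F"
    using F_nonneg by (intro integrableI_bounded) (auto intro: le_less_trans)
  have "0 \<le> R"
    using r by (rule LIMSEQ_le_const)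
      (use le nonneg in \<open>meson order_trans Bochner_Integration.integral_nonneg\<close>)
  have "ennreal (\<integral>x. F x \<partial>M) \<le> ennreal R"
    using le_R int_F F_nonneg by (simp add: nn_integral_eq_integral)
  with \<open>0 \<le> R\<close> show "(\<integral>x. F x \<partial>M) \<le> R"
    by (simp add: ennreal_le_iff)
qed

text \<open>Squaring removes the kink of max 0 y, so cutoffs built this way are continuously
  differentiable.\<close>

lemma DERIV_max_0_square: "((\<lambda>y. (max 0 y)\<^sup>2) has_real_derivative 2 * max 0 y) (at (y::real))"
proof -
  consider "y > 0" | "y < 0" | "y = 0" by linarith
  then show ?thesis
  proof cases
    case 1
    have "((\<lambda>y. y\<^sup>2) has_real_derivative 2 * y) (at y)"
      by (auto intro!: derivative_eq_intros)
    then have "((\<lambda>y. (max 0 y)\<^sup>2) has_real_derivative 2 * y) (at y)"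
      by (rule has_field_derivative_transform_within_open[where S="{0<..}"]) (use 1 in auto)
    with 1 show ?thesis by simp
  next
    case 2
    have "((\<lambda>y. 0) has_real_derivative 0) (at y)" by simp
    then have "((\<lambda>y. (max 0 y)\<^sup>2) has_real_derivative 0) (at y)"
      by (rule has_field_derivative_transform_within_open[where S="{..<0}"]) (use 2 in auto)
    with 2 show ?thesis by simp
  next
    case 3
    have "(\<lambda>h. (max 0 h)\<^sup>2 / h) \<midarrow>0\<rightarrow> (0::real)"
    proof (rule Lim_null_comparison)
      show "\<forall>\<^sub>F h in at 0. norm ((max 0 h)\<^sup>2 / h) \<le> \<bar>h::real\<bar>"
        by (intro always_eventually) (auto simp: max_def power2_eq_square)
      show "(\<lambda>h. \<bar>h::real\<bar>) \<midarrow>0\<rightarrow> 0" by (rule tendsto_rabs_zero) (rule tendsto_ident_at)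
    qed
    with 3 show ?thesis by (simp add: DERIV_def)
  qed
qed

text \<open>The left side vanishes to second order at a = 1, so (a - 1)^2 can be factored out. For a
  \<le> 2 the bound ln a \<le> a - 1 gives the factor 2 a + 1 \<le> 5; for a > 2 the logarithm is at
  most L and a^2 \<le> 4 (a - 1)^2. With a = h this bounds an entropy by a weighted square integral
  of h - 1.\<close>

lemma entropy_integrand_le:
  fixes a L :: real
  assumes a: "0 \<le> a" and L: "0 \<le> L" "a\<^sup>2 \<le> exp L"
  shows "a\<^sup>2 * ln (a\<^sup>2) - a\<^sup>2 + 1 \<le> (a - 1)\<^sup>2 * (5 + 4 * L)"
proof -
  consider "a = 0" | "0 < a" "a \<le> 2" | "2 < a" using a by linarith
  then show ?thesis
  proof cases
    case 1
    with L show ?thesis by simp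
  next
    case 2
    have "ln (a\<^sup>2) \<le> 2 * (a - 1)"
      using ln_le_minus_one[of a] 2 by (simp add: ln_realpow)
    then have "a\<^sup>2 * ln (a\<^sup>2) - a\<^sup>2 + 1 \<le> a\<^sup>2 * (2 * (a - 1)) - a\<^sup>2 + 1"
      by (intro add_mono diff_mono mult_left_mono) auto
    also have "\<dots> = (a - 1)\<^sup>2 * (2 * a + 1)"
      by (simp add: power2_eq_square algebra_simps)
    also have "\<dots> \<le> (a - 1)\<^sup>2 * (5 + 4 * L)"
      using 2 L by (intro mult_left_mono) auto
    finally show ?thesis .
  next
    case 3
    have "ln (a\<^sup>2) \<le> L"
      using L(2) 3 ln_mono[of "a\<^sup>2" "exp L"] by simp
    moreover have "a\<^sup>2 \<le> 4 * (a - 1)\<^sup>2"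
      using 3 power_mono[of a "2 * (a - 1)" 2] unfolding power_mult_distrib by simp
    ultimately have "a\<^sup>2 * ln (a\<^sup>2) \<le> 4 * (a - 1)\<^sup>2 * L"
      using 3 L by (intro mult_mono) auto
    moreover have "1 \<le> a\<^sup>2" using 3 by (intro one_le_power) auto
    moreover have "0 \<le> (a - 1)\<^sup>2" by simp
    moreover have "(a - 1)\<^sup>2 * (5 + 4 * L) = 5 * (a - 1)\<^sup>2 + 4 * (a - 1)\<^sup>2 * L"
      by (simp only: distrib_left mult_ac)
    ultimately show ?thesis by linarith
  qed
qed

lemma entropy_integrand_nonneg:
  fixes t :: real
  assumes "0 \<le> t"
  shows "t - 1 \<le> t * ln t"
proof (cases "t = 0")
  case False
  with assms have t: "0 < t" by simp
  then have "ln (1 / t) \<le> 1 / t - 1" by (intro ln_le_minus_one) simp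
  with t show ?thesis by (simp add: ln_div field_simps)
qed simp

text \<open>Everything proved in this locale sees V and W only through two inequalities: one
  controls g far from x0, the other controls it on balls.\<close>

locale lyapunov_measure = prob_space \<mu>
  for \<mu> :: "'a::euclidean_space measure" +
  fixes x0 :: 'a and c b :: real
  assumes sets_\<mu>[simp, measurable_cong]: "sets \<mu> = sets borel"
    and c_pos: "0 < c" and b_nonneg: "0 \<le> b"
    and hardy_compact: "\<And>g Dg R. C1_grad g Dg \<Longrightarrow> (\<And>x. x \<notin> cball x0 R \<Longrightarrow> g x = 0) \<Longrightarrow>
      c * (\<integral>x. (dist x x0)\<^sup>2 * (g x)\<^sup>2 \<partial>\<mu>) \<le> (\<integral>x. (norm (Dg x))\<^sup>2 \<partial>\<mu>) + b * (\<integral>x. (g x)\<^sup>2 \<partial>\<mu>)"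
    and local_poincare: "\<And>R. 0 < R \<Longrightarrow> \<exists>\<kappa>\<ge>0. \<forall>g Dg. C1_grad g Dg \<longrightarrow> (\<exists>m.
      (\<integral>\<^sup>+x. indicator (cball x0 R) x * ennreal ((g x - m)\<^sup>2) \<partial>\<mu>)
        \<le> ennreal \<kappa> * (\<integral>\<^sup>+x. indicator (cball x0 R) x * ennreal ((norm (Dg x))\<^sup>2) \<partial>\<mu>))"
begin

lemma space_\<mu>[simp]: "space \<mu> = UNIV"
  using sets_eq_imp_space_eq[OF sets_\<mu>] by simp

lemma prob_UNIV[simp]: "prob UNIV = 1"
  using prob_space by simp

lemma C1_grad_measurable_\<mu>:
  assumes "C1_grad g Dg"
  shows "g \<in> borel_measurable \<mu>" "Dg \<in> borel_measurable \<mu>"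
  using C1_grad_measurable[OF assms] by (simp_all cong: measurable_cong_sets)

lemma integrable_bounded:
  fixes f :: "'a \<Rightarrow> real"
  assumes "f \<in> borel_measurable borel" "\<And>x. \<bar>f x\<bar> \<le> B"
  shows "integrable \<mu> f"
  using assms by (intro integrable_const_bound[where B=B]) (auto cong: measurable_cong_sets)

text \<open>Cutoffs extend the inequality from compact support to finite energy. The right side
  converges by dominated convergence, the left side only by Fatou, which also yields integrability
  of the weighted square.\<close>

lemma hardy:
  assumes g: "C1_grad g Dg" and int: "integrable \<mu> (\<lambda>x. (g x)\<^sup>2)" "integrable \<mu> (\<lambda>x. (norm (Dg x))\<^sup>2)"
  shows "integrable \<mu> (\<lambda>x. (dist x x0)\<^sup>2 * (g x)\<^sup>2)"
    and "c * (\<integral>x. (dist x x0)\<^sup>2 * (g x)\<^sup>2 \<partial>\<mu>) \<le> (\<integral>x. (norm (Dg x))\<^sup>2 \<partial>\<mu>) + b * (\<integral>x. (g x)\<^sup>2 \<partial>\<mu>)"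
proof -
  define R where "R n = real (Suc n)" for n
  have R1: "1 \<le> R n" for n by (simp add: R_def)
  have Rlim: "(\<lambda>n. 1 / R n) \<longlonglongrightarrow> 0"
    unfolding R_def using LIMSEQ_inverse_real_of_nat by (simp add: inverse_eq_divide)
  \<comment> \<open>The cutoff is the square of the positive part y of 1 - d^2 / R^2. Its gradient
    has norm 4 y d / R^2, at most 4 / R on the ball and 0 outside.\<close>
  define y where "y n x = max 0 (1 - (dist x x0)\<^sup>2 / (R n)\<^sup>2)" for n x
  define cut where "cut n x = (y n x)\<^sup>2" for n x
  define Dcut where "Dcut n x = (2 * y n x * (- 1 / (R n)\<^sup>2)) *\<^sub>R (2 *\<^sub>R (x - x0))" for n x
  have y: "0 \<le> y n x" "y n x \<le> 1" for n x by (auto simp: y_def)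
  have cut: "0 \<le> cut n x" "cut n x \<le> 1" for n x using y[of n x] by (auto simp: cut_def power_le_one)
  have C: "C1_grad (cut n) (Dcut n)" for n
    unfolding cut_def[abs_def] Dcut_def[abs_def] y_def
  proof (rule C1_grad_compose[OF C1_grad_dist_square, where \<phi>="\<lambda>r. (max 0 (1 - r / (R n)\<^sup>2))\<^sup>2"
        and \<phi>'="\<lambda>r. 2 * max 0 (1 - r / (R n)\<^sup>2) * (- 1 / (R n)\<^sup>2)"])
    show "((\<lambda>r. (max 0 (1 - r / (R n)\<^sup>2))\<^sup>2) has_real_derivative
      2 * max 0 (1 - (dist x x0)\<^sup>2 / (R n)\<^sup>2) * (- 1 / (R n)\<^sup>2)) (at ((dist x x0)\<^sup>2))" for x
      by (rule DERIV_chain2[OF DERIV_max_0_square])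
        (use DERIV_diff[OF DERIV_const DERIV_cdivide[OF DERIV_ident]] in \<open>simp add: divide_minus_left[symmetric] del: divide_minus_left\<close>)
    show "continuous_on (range (\<lambda>x. (dist x x0)\<^sup>2)) (\<lambda>r. 2 * max 0 (1 - r / (R n)\<^sup>2) * (- 1 / (R n)\<^sup>2))"
      using R1[of n] by (intro continuous_intros) auto
  qed
  have supp: "cut n x = 0" if "x \<notin> cball x0 (R n)" for n x
  proof -
    have "R n \<le> dist x x0" using that by (simp add: dist_commute)
    then have "(R n)\<^sup>2 \<le> (dist x x0)\<^sup>2" using R1[of n] by (intro power_mono) auto
    then show ?thesis using R1[of n] by (simp add: cut_def y_def)
  qed
  have Dcut_le: "norm (Dcut n x) \<le> 4 * (1 / R n)" for n x
  proof (cases "dist x x0 \<le> R n")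
    case True
    have "norm (Dcut n x) = 4 * (y n x * dist x x0 / (R n)\<^sup>2)"
      using y[of n x] by (simp add: Dcut_def dist_norm abs_mult)
    also have "\<dots> \<le> 4 * (1 * R n / (R n)\<^sup>2)"
      using True y[of n x] R1[of n] by (intro mult_left_mono divide_right_mono mult_mono) auto
    finally show ?thesis using R1[of n] by (simp add: power2_eq_square)
  next
    case False
    then have "y n x = 0" using supp[of x n] by (simp add: cut_def dist_commute)
    then show ?thesis using R1[of n] by (simp add: Dcut_def)
  qed
  have Dcut_lim: "(\<lambda>n. Dcut n x) \<longlonglongrightarrow> 0" for x
    by (rule Lim_null_comparison[OF _ tendsto_mult_right_zero[OF Rlim, of 4]])
      (use Dcut_le in auto)
  have cut_lim: "(\<lambda>n. cut n x) \<longlonglongrightarrow> 1" for x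
  proof -
    have "(\<lambda>n. (max 0 (1 - (dist x x0)\<^sup>2 * (1 / R n)\<^sup>2))\<^sup>2) \<longlonglongrightarrow> (max 0 (1 - (dist x x0)\<^sup>2 * 0\<^sup>2))\<^sup>2"
      by (intro tendsto_intros Rlim)
    then show ?thesis by (simp add: cut_def y_def power_one_over)
  qed
  define gn where "gn n x = cut n x * g x" for n x
  define Dgn where "Dgn n x = cut n x *\<^sub>R Dg x + g x *\<^sub>R Dcut n x" for n x
  have Cgn: "C1_grad (gn n) (Dgn n)" for n
    unfolding gn_def[abs_def] Dgn_def[abs_def] by (rule C1_grad_mult[OF C g])
  have gn_supp: "gn n x = 0" if "x \<notin> cball x0 (R n)" for n x
    using supp[OF that] by (simp add: gn_def)
  note [measurable] = C1_grad_measurable_\<mu>[OF g] C1_grad_measurable_\<mu>[OF Cgn]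
  have gn_le: "(gn n x)\<^sup>2 \<le> (g x)\<^sup>2" for n x
    using cut[of n x] by (simp add: gn_def power_mult_distrib mult_left_le_one_le power_le_one)
  \<comment> \<open>32 = 2 * 4^2, from (a + 4 b)^2 \<le> 2 a^2 + 2 (4 b)^2 and 1 / R n \<le>
    1.\<close>
  have Dgn_le: "(norm (Dgn n x))\<^sup>2 \<le> 2 * (norm (Dg x))\<^sup>2 + 32 * (g x)\<^sup>2" for n x
  proof -
    have "norm (Dgn n x) \<le> norm (cut n x *\<^sub>R Dg x) + norm (g x *\<^sub>R Dcut n x)"
      unfolding Dgn_def by (rule norm_triangle_ineq)
    also have "\<dots> \<le> 1 * norm (Dg x) + \<bar>g x\<bar> * 4"
      using cut[of n x] Dcut_le[of n x] R1[of n] unfolding norm_scaleR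
      by (intro add_mono mult_mono) (auto intro: order_trans simp: divide_le_eq)
    finally have "(norm (Dgn n x))\<^sup>2 \<le> (norm (Dg x) + 4 * \<bar>g x\<bar>)\<^sup>2"
      by (intro power_mono) auto
    also have "\<dots> \<le> 2 * (norm (Dg x))\<^sup>2 + 32 * (g x)\<^sup>2"
      using sum_squares_bound[of "norm (Dg x)" "4 * \<bar>g x\<bar>"] by (simp add: power2_sum power_mult_distrib)
    finally show ?thesis .
  qed
  have lim1: "(\<lambda>n. \<integral>x. (gn n x)\<^sup>2 \<partial>\<mu>) \<longlonglongrightarrow> (\<integral>x. (g x)\<^sup>2 \<partial>\<mu>)"
  proof (rule integral_dominated_convergence[OF _ _ int(1)])
    show "AE x in \<mu>. (\<lambda>n. (gn n x)\<^sup>2) \<longlonglongrightarrow> (g x)\<^sup>2"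
    proof (rule AE_I2)
      fix x
      show "(\<lambda>n. (gn n x)\<^sup>2) \<longlonglongrightarrow> (g x)\<^sup>2"
        unfolding gn_def using tendsto_power[OF tendsto_mult_right[OF cut_lim[of x], of "g x"], of 2] by simp
    qed
  qed (use gn_le in auto)
  have lim2: "(\<lambda>n. \<integral>x. (norm (Dgn n x))\<^sup>2 \<partial>\<mu>) \<longlonglongrightarrow> (\<integral>x. (norm (Dg x))\<^sup>2 \<partial>\<mu>)"
  proof (rule integral_dominated_convergence[where w="\<lambda>x. 2 * (norm (Dg x))\<^sup>2 + 32 * (g x)\<^sup>2"])
    show "AE x in \<mu>. (\<lambda>n. (norm (Dgn n x))\<^sup>2) \<longlonglongrightarrow> (norm (Dg x))\<^sup>2"
    proof (rule AE_I2)
      fix x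
      have "(\<lambda>n. (norm (Dgn n x))\<^sup>2) \<longlonglongrightarrow> (norm (1 *\<^sub>R Dg x + g x *\<^sub>R 0))\<^sup>2"
        unfolding Dgn_def by (intro tendsto_intros cut_lim Dcut_lim)
      then show "(\<lambda>n. (norm (Dgn n x))\<^sup>2) \<longlonglongrightarrow> (norm (Dg x))\<^sup>2" by simp
    qed
  qed (use Dgn_le int in auto)
  have int_gn: "integrable \<mu> (\<lambda>x. (dist x x0)\<^sup>2 * (gn n x)\<^sup>2)" for n
  proof (rule Bochner_Integration.integrable_bound[OF integrable_mult_right[OF int(1), of "(R n)\<^sup>2"]])
    show "AE x in \<mu>. norm ((dist x x0)\<^sup>2 * (gn n x)\<^sup>2) \<le> norm ((R n)\<^sup>2 * (g x)\<^sup>2)"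
    proof (rule AE_I2)
      fix x
      show "norm ((dist x x0)\<^sup>2 * (gn n x)\<^sup>2) \<le> norm ((R n)\<^sup>2 * (g x)\<^sup>2)"
      proof (cases "x \<in> cball x0 (R n)")
        case True
        then show ?thesis
          using gn_le[of n x] R1[of n] by (auto simp: dist_commute intro!: mult_mono power_mono)
      qed (simp add: gn_supp)
    qed
  qed auto
  have l: "(\<lambda>n. (dist x x0)\<^sup>2 * (gn n x)\<^sup>2) \<longlonglongrightarrow> (dist x x0)\<^sup>2 * (g x)\<^sup>2" for x
    unfolding gn_def
    using tendsto_mult_left[OF tendsto_power[OF tendsto_mult_right[OF cut_lim[of x], of "g x"], of 2], of "(dist x x0)\<^sup>2"]
    by simp
  have le: "(\<integral>x. (dist x x0)\<^sup>2 * (gn n x)\<^sup>2 \<partial>\<mu>)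
      \<le> ((\<integral>x. (norm (Dgn n x))\<^sup>2 \<partial>\<mu>) + b * (\<integral>x. (gn n x)\<^sup>2 \<partial>\<mu>)) / c" for n
    using hardy_compact[of "gn n" "Dgn n" "R n", OF Cgn gn_supp] c_pos by (simp add: pos_le_divide_eq mult.commute)
  have r: "(\<lambda>n. ((\<integral>x. (norm (Dgn n x))\<^sup>2 \<partial>\<mu>) + b * (\<integral>x. (gn n x)\<^sup>2 \<partial>\<mu>)) / c)
      \<longlonglongrightarrow> ((\<integral>x. (norm (Dg x))\<^sup>2 \<partial>\<mu>) + b * (\<integral>x. (g x)\<^sup>2 \<partial>\<mu>)) / c"
    using c_pos by (intro tendsto_intros lim1 lim2) auto
  show "integrable \<mu> (\<lambda>x. (dist x x0)\<^sup>2 * (g x)\<^sup>2)"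
    by (rule integrable_Fatou(1)[OF int_gn _ l le r]) simp
  have "(\<integral>x. (dist x x0)\<^sup>2 * (g x)\<^sup>2 \<partial>\<mu>)
      \<le> ((\<integral>x. (norm (Dg x))\<^sup>2 \<partial>\<mu>) + b * (\<integral>x. (g x)\<^sup>2 \<partial>\<mu>)) / c"
    by (rule integrable_Fatou(2)[OF int_gn _ l le r]) simp
  then show "c * (\<integral>x. (dist x x0)\<^sup>2 * (g x)\<^sup>2 \<partial>\<mu>) \<le> (\<integral>x. (norm (Dg x))\<^sup>2 \<partial>\<mu>) + b * (\<integral>x. (g x)\<^sup>2 \<partial>\<mu>)"
    using c_pos by (simp add: pos_le_divide_eq mult.commute)
qed

text \<open>Insert h = exp (\<theta> d^2 / 2) with \<theta>^2 = c / 2 into \<open>hardy\<close>. The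
  squared gradient is (c / 2) d^2 h^2, half of the left side, and is absorbed there. With I and J
  the integrals of h^2 and d^2 h^2 this leaves J \<le> (2 b / c) I, which bounds I because d^2 is
  large where h is. Absorption needs finite integrals, hence a bounded truncation and Fatou at the
  end.\<close>

lemma integrable_exp_dist_square: "integrable \<mu> (\<lambda>x. exp (sqrt (c / 2) * (dist x x0)\<^sup>2))"
proof -
  define \<theta> where "\<theta> = sqrt (c / 2)"
  have \<theta>: "0 < \<theta>" "\<theta>\<^sup>2 = c / 2" using c_pos by (auto simp: \<theta>_def)
  define N where "N n = real (Suc n)" for n
  have N1: "1 \<le> N n" for n by (simp add: N_def)
  \<comment> \<open>A smooth truncation of r: bounded by N, convergent to r, and with derivative in
    [0, 1] for r \<ge> 0, so that the gradient estimate is uniform in n.\<close>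
  define s where "s n r = r / (1 + r / N n)" for n and r :: real
  have s_le: "s n r \<le> N n" "s n r \<le> r" "0 \<le> s n r" if "0 \<le> r" for n r
  proof -
    have q: "1 \<le> 1 + r / N n" using that N1[of n] by simp
    have "N n * (1 + r / N n) = N n + r" using N1[of n] by (simp add: distrib_left)
    then show "s n r \<le> N n" using q N1[of n] by (simp add: s_def pos_divide_le_eq)
    have "r * 1 \<le> r * (1 + r / N n)" using q that by (rule mult_left_mono)
    then show "s n r \<le> r" using q by (simp add: s_def pos_divide_le_eq)
    show "0 \<le> s n r" using that q by (simp add: s_def)
  qed
  define h where "h n x = exp (\<theta> / 2 * s n ((dist x x0)\<^sup>2))" for n x
  define s' where "s' n r = 1 / (1 + r / N n)\<^sup>2" for n and r :: real
  define Dh where "Dh n x = (h n x * (\<theta> / 2 * s' n ((dist x x0)\<^sup>2))) *\<^sub>R (2 *\<^sub>R (x - x0))" for n x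
  have C: "C1_grad (h n) (Dh n)" for n
    unfolding h_def[abs_def] Dh_def[abs_def]
  proof (rule C1_grad_compose[OF C1_grad_dist_square, where \<phi>="\<lambda>r. exp (\<theta> / 2 * s n r)"
        and \<phi>'="\<lambda>r. exp (\<theta> / 2 * s n r) * (\<theta> / 2 * s' n r)"])
    show "((\<lambda>r. exp (\<theta> / 2 * s n r)) has_real_derivative
       exp (\<theta> / 2 * s n ((dist x x0)\<^sup>2)) * (\<theta> / 2 * s' n ((dist x x0)\<^sup>2))) (at ((dist x x0)\<^sup>2))" for x
    proof -
      have "1 + (dist x x0)\<^sup>2 / N n > 0"
        using N1[of n] by (intro add_pos_nonneg) auto
      then have "(s n has_real_derivative s' n ((dist x x0)\<^sup>2)) (at ((dist x x0)\<^sup>2))"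
        unfolding s_def[abs_def] s'_def using N1[of n]
        by (auto intro!: derivative_eq_intros simp: power2_eq_square)
      then show ?thesis by (auto intro!: derivative_eq_intros)
    qed
    have "1 + r / N n \<noteq> 0" if "0 \<le> r" for r
      using N1[of n] that add_pos_nonneg[of 1 "r / N n"] by auto
    then show "continuous_on (range (\<lambda>x. (dist x x0)\<^sup>2)) (\<lambda>r. exp (\<theta> / 2 * s n r) * (\<theta> / 2 * s' n r))"
      unfolding s_def s'_def using N1[of n] by (intro continuous_intros) auto
  qed
  note [measurable] = C1_grad_measurable[OF C]
  have h2: "(h n x)\<^sup>2 = exp (\<theta> * s n ((dist x x0)\<^sup>2))" for n x
    by (simp add: h_def exp_double[symmetric])
  have h2_le: "(h n x)\<^sup>2 \<le> exp (\<theta> * N n)" for n x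
    unfolding h2 using \<theta> s_le(1)[of "(dist x x0)\<^sup>2" n] by simp
  have Dh2: "(norm (Dh n x))\<^sup>2 = \<theta>\<^sup>2 * ((s' n ((dist x x0)\<^sup>2))\<^sup>2 * (dist x x0)\<^sup>2) * (h n x)\<^sup>2" for n x
    by (simp add: Dh_def dist_norm power_mult_distrib power_divide)
  have s'_bd: "0 \<le> s' n r" "s' n r \<le> 1" "(s' n r)\<^sup>2 * r \<le> N n" if "0 \<le> r" for n r
  proof -
    have q: "1 \<le> 1 + r / N n" using N1[of n] that by auto
    show "0 \<le> s' n r" by (simp add: s'_def)
    show "s' n r \<le> 1" using q by (simp add: s'_def divide_le_eq one_le_power)
    have "(s' n r)\<^sup>2 * r \<le> s' n r * r"
      using \<open>0 \<le> s' n r\<close> \<open>s' n r \<le> 1\<close> that by (intro mult_right_mono) (auto simp: power2_eq_square mult_left_le_one_le)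
    also have "\<dots> = s n r / (1 + r / N n)" by (simp add: s'_def s_def power2_eq_square)
    also have "\<dots> \<le> s n r" using q s_le(3)[OF that, of n] by (simp add: divide_le_eq mult_le_cancel_left1)
    also have "\<dots> \<le> N n" by (rule s_le(1)[OF that])
    finally show "(s' n r)\<^sup>2 * r \<le> N n" .
  qed
  have int1: "integrable \<mu> (\<lambda>x. (h n x)\<^sup>2)" for n
    using h2_le by (intro integrable_bounded[where B="exp (\<theta> * N n)"]) auto
  have int2: "integrable \<mu> (\<lambda>x. (norm (Dh n x))\<^sup>2)" for n
  proof (rule integrable_bounded[where B="\<theta>\<^sup>2 * N n * exp (\<theta> * N n)"])
    show "\<bar>(norm (Dh n x))\<^sup>2\<bar> \<le> \<theta>\<^sup>2 * N n * exp (\<theta> * N n)" for x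
      unfolding Dh2 using s'_bd(3)[of "(dist x x0)\<^sup>2" n] h2_le[of n x] N1[of n]
      by (auto intro!: mult_mono)
  qed auto
  note hy = hardy[OF C int1 int2]
  \<comment> \<open>Where d^2 > \<rho>, h^2 is at most d^2 h^2 / \<rho>. The choice makes 2 b / (c
    \<rho>) = 2 b / (4 b + c) \<le> 1 / 2, so the corresponding part of I is absorbed.\<close>
  define \<rho> where "\<rho> = 4 * b / c + 1"
  have \<rho>: "1 \<le> \<rho>" using b_nonneg c_pos by (simp add: \<rho>_def)
  have bound: "(\<integral>x. (h n x)\<^sup>2 \<partial>\<mu>) \<le> 2 * exp (\<theta> * \<rho>)" for n
  proof -
    define I J where "I = (\<integral>x. (h n x)\<^sup>2 \<partial>\<mu>)" and "J = (\<integral>x. (dist x x0)\<^sup>2 * (h n x)\<^sup>2 \<partial>\<mu>)"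
    have "(\<integral>x. (norm (Dh n x))\<^sup>2 \<partial>\<mu>) \<le> (\<integral>x. c / 2 * ((dist x x0)\<^sup>2 * (h n x)\<^sup>2) \<partial>\<mu>)"
    proof (intro integral_mono int2 integrable_mult_right hy)
      fix x
      have "(s' n ((dist x x0)\<^sup>2))\<^sup>2 \<le> 1"
        using s'_bd(1,2)[of "(dist x x0)\<^sup>2" n] by (simp add: power_le_one)
      then have "c / 2 * (((s' n ((dist x x0)\<^sup>2))\<^sup>2 * (dist x x0)\<^sup>2) * (h n x)\<^sup>2) \<le> c / 2 * ((1 * (dist x x0)\<^sup>2) * (h n x)\<^sup>2)"
        using c_pos by (intro mult_left_mono mult_right_mono) auto
      then show "(norm (Dh n x))\<^sup>2 \<le> c / 2 * ((dist x x0)\<^sup>2 * (h n x)\<^sup>2)"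
        by (simp add: Dh2 \<theta>(2) mult.assoc)
    qed
    then have "c * J \<le> c / 2 * J + b * I"
      using hy(2)[of n] by (simp add: I_def J_def)
    then have J: "J \<le> 2 * b / c * I"
      using c_pos by (simp add: field_simps)
    have "I \<le> (\<integral>x. exp (\<theta> * \<rho>) + (1 / \<rho>) * ((dist x x0)\<^sup>2 * (h n x)\<^sup>2) \<partial>\<mu>)"
      unfolding I_def
    proof (intro integral_mono int1 Bochner_Integration.integrable_add integrable_mult_right hy integrable_const)
      fix x
      show "(h n x)\<^sup>2 \<le> exp (\<theta> * \<rho>) + (1 / \<rho>) * ((dist x x0)\<^sup>2 * (h n x)\<^sup>2)"
      proof (cases "(dist x x0)\<^sup>2 \<le> \<rho>")
        case True
        then have "s n ((dist x x0)\<^sup>2) \<le> \<rho>" using s_le(2)[of "(dist x x0)\<^sup>2" n] by simp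
        then have "(h n x)\<^sup>2 \<le> exp (\<theta> * \<rho>)" using \<theta> by (simp add: h2)
        then show ?thesis using \<rho> by (simp add: add_increasing2)
      next
        case False
        then have "1 * (h n x)\<^sup>2 \<le> ((dist x x0)\<^sup>2 / \<rho>) * (h n x)\<^sup>2"
          using \<rho> by (intro mult_right_mono) (auto simp: le_divide_eq)
        then show ?thesis by (simp add: add_increasing)
      qed
    qed
    also have "\<dots> = exp (\<theta> * \<rho>) + (1 / \<rho>) * J"
      using hy(1)[of n] by (simp add: J_def prob_space)
    also have "(1 / \<rho>) * J \<le> (1 / \<rho>) * (2 * b / c * I)"
      using \<rho> by (intro mult_left_mono J) auto
    also have "\<dots> = (2 * b / c / \<rho>) * I" by simp
    also have "2 * b / c / \<rho> = 2 * b / (4 * b + c)"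
      using c_pos b_nonneg by (simp add: \<rho>_def field_simps)
    also have "\<dots> * I \<le> 1 / 2 * I"
      using c_pos b_nonneg by (intro mult_right_mono) (auto simp: I_def divide_le_eq)
    finally show ?thesis by (simp add: I_def)
  qed
  have "integrable \<mu> (\<lambda>x. exp (\<theta> * (dist x x0)\<^sup>2))"
  proof (rule integrable_Fatou(1)[OF int1 _ _ bound tendsto_const])
    fix x
    have "(\<lambda>n. exp (\<theta> * ((dist x x0)\<^sup>2 / (1 + (dist x x0)\<^sup>2 * (1 / N n)))))
        \<longlonglongrightarrow> exp (\<theta> * ((dist x x0)\<^sup>2 / (1 + (dist x x0)\<^sup>2 * 0)))"
      unfolding N_def using LIMSEQ_inverse_real_of_nat
      by (intro tendsto_intros) (auto simp: inverse_eq_divide)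
    then show "(\<lambda>n. (h n x)\<^sup>2) \<longlonglongrightarrow> exp (\<theta> * (dist x x0)\<^sup>2)"
      by (simp add: h2 s_def)
  qed auto
  then show ?thesis by (simp add: \<theta>_def)
qed

text \<open>On a ball the local inequality controls g - m; outside, d^2 \<ge> R^2 and
  \<open>hardy\<close> for the same function does. The variance is at most the integral of (g - m)^2
  for every m, so m can be the constant that the local inequality supplies.\<close>

lemma poincare:
  "\<exists>C\<ge>0. \<forall>g Dg. C1_grad g Dg \<longrightarrow> integrable \<mu> (\<lambda>x. (g x)\<^sup>2) \<longrightarrow> integrable \<mu> (\<lambda>x. (norm (Dg x))\<^sup>2) \<longrightarrow>
    (\<integral>x. (g x)\<^sup>2 \<partial>\<mu>) - (\<integral>x. g x \<partial>\<mu>)\<^sup>2 \<le> C * (\<integral>x. (norm (Dg x))\<^sup>2 \<partial>\<mu>)"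
proof -
  \<comment> \<open>Then b / (c R^2) = b / (2 b + c) \<le> 1 / 2, and the zero-order term of
    \<open>hardy\<close> is absorbed.\<close>
  define R where "R = sqrt (2 * b / c + 1)"
  have R: "0 < R" and R2: "R\<^sup>2 = 2 * b / c + 1"
    using b_nonneg c_pos by (auto simp: R_def add_nonneg_pos)
  define B where "B = cball x0 R"
  have [measurable]: "B \<in> sets borel" by (simp add: B_def)
  obtain \<kappa> where \<kappa>: "0 \<le> \<kappa>" "\<And>g Dg. C1_grad g Dg \<Longrightarrow> \<exists>m.
      (\<integral>\<^sup>+x. indicator B x * ennreal ((g x - m)\<^sup>2) \<partial>\<mu>)
        \<le> ennreal \<kappa> * (\<integral>\<^sup>+x. indicator B x * ennreal ((norm (Dg x))\<^sup>2) \<partial>\<mu>)"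
    using local_poincare[OF R] unfolding B_def by blast
  define C where "C = 2 * (\<kappa> + 1 / (c * R\<^sup>2))"
  have "0 \<le> C" using \<kappa>(1) c_pos R by (simp add: C_def)
  moreover have "(\<integral>x. (g x)\<^sup>2 \<partial>\<mu>) - (\<integral>x. g x \<partial>\<mu>)\<^sup>2 \<le> C * (\<integral>x. (norm (Dg x))\<^sup>2 \<partial>\<mu>)"
    if g: "C1_grad g Dg" and int: "integrable \<mu> (\<lambda>x. (g x)\<^sup>2)" "integrable \<mu> (\<lambda>x. (norm (Dg x))\<^sup>2)" for g Dg
  proof -
    note [measurable] = C1_grad_measurable_\<mu>[OF g]
    obtain m where m: "(\<integral>\<^sup>+x. indicator B x * ennreal ((g x - m)\<^sup>2) \<partial>\<mu>)
        \<le> ennreal \<kappa> * (\<integral>\<^sup>+x. indicator B x * ennreal ((norm (Dg x))\<^sup>2) \<partial>\<mu>)"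
      using \<kappa>(2)[OF g] by blast
    define E where "E = (\<integral>x. (norm (Dg x))\<^sup>2 \<partial>\<mu>)"
    have int_g: "integrable \<mu> g"
      using square_integrable_imp_integrable[OF _ int(1)] by simp
    define p where "p x = g x - m" for x
    have p: "C1_grad p Dg" unfolding p_def by (rule C1_grad_diff_const[OF g])
    note [measurable] = C1_grad_measurable_\<mu>[OF p]
    have p2: "(p x)\<^sup>2 = (g x)\<^sup>2 - 2 * m * g x + m\<^sup>2" for x
      by (simp add: p_def power2_diff)
    have int_p: "integrable \<mu> (\<lambda>x. (p x)\<^sup>2)"
      unfolding p2 using int int_g by auto
    note hy = hardy[OF p int_p int(2)]
    have int_B: "integrable \<mu> (\<lambda>x. indicator B x * (p x)\<^sup>2)"
      by (rule Bochner_Integration.integrable_bound[OF int_p]) (auto simp: indicator_def)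
    have "ennreal (\<integral>x. indicator B x * (p x)\<^sup>2 \<partial>\<mu>) = (\<integral>\<^sup>+x. ennreal (indicator B x * (p x)\<^sup>2) \<partial>\<mu>)"
      using int_B by (intro nn_integral_eq_integral[symmetric]) auto
    also have "\<dots> = (\<integral>\<^sup>+x. indicator B x * ennreal ((g x - m)\<^sup>2) \<partial>\<mu>)"
      by (intro nn_integral_cong) (auto simp: indicator_def p_def)
    also note m
    also have "ennreal \<kappa> * (\<integral>\<^sup>+x. indicator B x * ennreal ((norm (Dg x))\<^sup>2) \<partial>\<mu>)
        \<le> ennreal \<kappa> * (\<integral>\<^sup>+x. ennreal ((norm (Dg x))\<^sup>2) \<partial>\<mu>)"
      by (intro mult_left_mono nn_integral_mono) (auto simp: indicator_def)
    also have "\<dots> = ennreal (\<kappa> * E)"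
      using int(2) \<kappa>(1) by (simp add: E_def nn_integral_eq_integral ennreal_mult)
    finally have inB: "(\<integral>x. indicator B x * (p x)\<^sup>2 \<partial>\<mu>) \<le> \<kappa> * E"
      using \<kappa>(1) by (subst (asm) ennreal_le_iff) (auto simp: E_def)
    define I where "I = (\<integral>x. (p x)\<^sup>2 \<partial>\<mu>)"
    have "I \<le> (\<integral>x. indicator B x * (p x)\<^sup>2 + (1 / R\<^sup>2) * ((dist x x0)\<^sup>2 * (p x)\<^sup>2) \<partial>\<mu>)"
      unfolding I_def
    proof (intro integral_mono int_p Bochner_Integration.integrable_add int_B integrable_mult_right hy)
      fix x
      show "(p x)\<^sup>2 \<le> indicator B x * (p x)\<^sup>2 + (1 / R\<^sup>2) * ((dist x x0)\<^sup>2 * (p x)\<^sup>2)"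
      proof (cases "x \<in> B")
        case False
        then have "R \<le> dist x x0" by (simp add: B_def dist_commute)
        then have "R\<^sup>2 \<le> (dist x x0)\<^sup>2" using R by (intro power_mono) auto
        then have "1 * (p x)\<^sup>2 \<le> ((dist x x0)\<^sup>2 / R\<^sup>2) * (p x)\<^sup>2"
          using R by (intro mult_right_mono) (auto simp: le_divide_eq)
        with False show ?thesis by simp
      qed simp
    qed
    also have "\<dots> = (\<integral>x. indicator B x * (p x)\<^sup>2 \<partial>\<mu>) + (1 / R\<^sup>2) * (\<integral>x. (dist x x0)\<^sup>2 * (p x)\<^sup>2 \<partial>\<mu>)"
      using int_B hy(1) by simp
    also have "(\<integral>x. (dist x x0)\<^sup>2 * (p x)\<^sup>2 \<partial>\<mu>) \<le> (E + b * I) / c"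
      using hy(2) c_pos by (simp add: E_def I_def pos_le_divide_eq mult.commute)
    finally have "I \<le> \<kappa> * E + (1 / R\<^sup>2) * ((E + b * I) / c)"
      using inB R by (simp add: mult_left_mono divide_right_mono)
    also have "\<dots> = (\<kappa> + 1 / (c * R\<^sup>2)) * E + (b / (c * R\<^sup>2)) * I"
      using c_pos R by (simp add: field_simps)
    also have "b / (c * R\<^sup>2) = b / (2 * b + c)"
      using c_pos by (simp add: R2 distrib_left)
    also have "\<dots> * I \<le> 1 / 2 * I"
      using c_pos b_nonneg by (intro mult_right_mono) (auto simp: I_def divide_le_eq)
    finally have "I \<le> 2 * ((\<kappa> + 1 / (c * R\<^sup>2)) * E)" by linarith
    then have "I \<le> C * E" by (simp only: C_def mult.assoc)
    moreover have "I = (\<integral>x. (g x)\<^sup>2 \<partial>\<mu>) - 2 * m * (\<integral>x. g x \<partial>\<mu>) + m\<^sup>2"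
      unfolding I_def p2 using int int_g by (simp add: prob_space)
    moreover have "0 \<le> ((\<integral>x. g x \<partial>\<mu>) - m)\<^sup>2" by simp
    ultimately show ?thesis
      by (simp add: E_def power2_diff algebra_simps)
  qed
  ultimately show ?thesis by blast
qed

text \<open>
  The constraint \<open>h\<^sup>2 \<le> exp (A + \<eta> d\<^sup>2)\<close> bounds the logarithm in the entropy by \<open>d\<^sup>2\<close>, which the
  Lyapunov condition controls; no local logarithmic Sobolev inequality is needed.
\<close>

lemma restricted_log_sobolev:
  assumes A: "0 \<le> A"
  shows "\<exists>C>0. \<forall>h Dh \<eta>. C1_grad h Dh \<longrightarrow> (\<forall>x. 0 \<le> h x) \<longrightarrow>
    integrable \<mu> (\<lambda>x. (h x)\<^sup>2) \<longrightarrow> integrable \<mu> (\<lambda>x. (norm (Dh x))\<^sup>2) \<longrightarrow> (\<integral>x. (h x)\<^sup>2 \<partial>\<mu>) = 1 \<longrightarrow>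
    0 \<le> \<eta> \<longrightarrow> \<eta> \<le> 1 \<longrightarrow> (\<forall>x. (h x)\<^sup>2 \<le> exp (A + \<eta> * (dist x x0)\<^sup>2)) \<longrightarrow>
    integrable \<mu> (\<lambda>x. (h x)\<^sup>2 * ln ((h x)\<^sup>2)) \<and>
    (\<integral>x. (h x)\<^sup>2 * ln ((h x)\<^sup>2) \<partial>\<mu>) \<le> C * (\<integral>x. (norm (Dh x))\<^sup>2 \<partial>\<mu>)"
proof -
  obtain P where P: "0 \<le> P" "\<And>g Dg. C1_grad g Dg \<Longrightarrow> integrable \<mu> (\<lambda>x. (g x)\<^sup>2) \<Longrightarrow>
      integrable \<mu> (\<lambda>x. (norm (Dg x))\<^sup>2) \<Longrightarrow>
    (\<integral>x. (g x)\<^sup>2 \<partial>\<mu>) - (\<integral>x. g x \<partial>\<mu>)\<^sup>2 \<le> P * (\<integral>x. (norm (Dg x))\<^sup>2 \<partial>\<mu>)"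
    using poincare by blast
  \<comment> \<open>Of \<eta> only the bound \<eta> \<le> 1 enters, so \<eta> may later be chosen in
    terms of C.\<close>
  define C where "C = (5 + 4 * A + 4 * (b / c)) * (2 * P) + 4 / c"
  have "0 < C"
    unfolding C_def using P(1) A c_pos b_nonneg by (intro add_nonneg_pos mult_nonneg_nonneg add_nonneg_nonneg) auto
  moreover have "integrable \<mu> (\<lambda>x. (h x)\<^sup>2 * ln ((h x)\<^sup>2)) \<and>
      (\<integral>x. (h x)\<^sup>2 * ln ((h x)\<^sup>2) \<partial>\<mu>) \<le> C * (\<integral>x. (norm (Dh x))\<^sup>2 \<partial>\<mu>)"
    if h: "C1_grad h Dh" and h0: "\<And>x. 0 \<le> h x"
      and int: "integrable \<mu> (\<lambda>x. (h x)\<^sup>2)" "integrable \<mu> (\<lambda>x. (norm (Dh x))\<^sup>2)" and h1: "(\<integral>x. (h x)\<^sup>2 \<partial>\<mu>) = 1"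
      and \<eta>: "0 \<le> \<eta>" "\<eta> \<le> 1" and le: "\<And>x. (h x)\<^sup>2 \<le> exp (A + \<eta> * (dist x x0)\<^sup>2)" for h Dh \<eta>
  proof -
    note [measurable] = C1_grad_measurable_\<mu>[OF h]
    have int_h: "integrable \<mu> h"
      using square_integrable_imp_integrable[OF _ int(1)] by simp
    define E m where "E = (\<integral>x. (norm (Dh x))\<^sup>2 \<partial>\<mu>)" and "m = (\<integral>x. h x \<partial>\<mu>)"
    have m0: "0 \<le> m" unfolding m_def using h0 by simp
    \<comment> \<open>\<open>hardy\<close> is applied to h - 1 rather than h. As h^2 has integral 1
      and mean m of h lies in [0, 1], the integral of (h - 1)^2 is 2 - 2 m \<le> 2 (1 - m^2), twice
      the variance of h. Poincare then bounds all zero-order terms by the energy, and no additive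
      defect is left.\<close>
    define g where "g x = h x - 1" for x
    have g: "C1_grad g Dh" unfolding g_def by (rule C1_grad_diff_const[OF h])
    note [measurable] = C1_grad_measurable_\<mu>[OF g]
    have g2: "(g x)\<^sup>2 = (h x)\<^sup>2 - 2 * h x + 1" for x
      by (simp add: g_def power2_diff)
    have int_g: "integrable \<mu> (\<lambda>x. (g x)\<^sup>2)"
      unfolding g2 using int int_h by auto
    note hy = hardy[OF g int_g int(2)]
    define I where "I = (\<integral>x. (g x)\<^sup>2 \<partial>\<mu>)"
    have I: "I = 2 - 2 * m"
      unfolding I_def g2 using int int_h by (simp add: prob_space m_def h1)
    have "0 \<le> I" by (simp add: I_def)
    then have "m\<^sup>2 \<le> m" using I m0 by (simp add: power2_eq_square mult_left_le)
    then have "I \<le> 2 * (1 - m\<^sup>2)" using I by simp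
    also have "1 - m\<^sup>2 \<le> P * E"
      using P(2)[OF h int] by (simp add: h1 m_def E_def)
    finally have I_le: "I \<le> 2 * P * E" by simp
    define U where "U x = (5 + 4 * A) * (g x)\<^sup>2 + 4 * ((dist x x0)\<^sup>2 * (g x)\<^sup>2)" for x
    have int_U: "integrable \<mu> U"
      unfolding U_def using int_g hy(1) by auto
    have upper: "(h x)\<^sup>2 * ln ((h x)\<^sup>2) - (h x)\<^sup>2 + 1 \<le> U x" for x
    proof -
      have "(h x)\<^sup>2 * ln ((h x)\<^sup>2) - (h x)\<^sup>2 + 1 \<le> (g x)\<^sup>2 * (5 + 4 * (A + \<eta> * (dist x x0)\<^sup>2))"
        unfolding g_def using A \<eta> by (intro entropy_integrand_le h0 le) auto
      also have "\<dots> \<le> (g x)\<^sup>2 * (5 + 4 * (A + 1 * (dist x x0)\<^sup>2))"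
        using \<eta> by (intro mult_left_mono add_mono mult_right_mono) auto
      also have "\<dots> = U x" by (simp add: U_def algebra_simps)
      finally show ?thesis .
    qed
    have lower: "(h x)\<^sup>2 - 1 \<le> (h x)\<^sup>2 * ln ((h x)\<^sup>2)" for x
      by (rule entropy_integrand_nonneg) simp
    have int_ent: "integrable \<mu> (\<lambda>x. (h x)\<^sup>2 * ln ((h x)\<^sup>2))"
    proof (rule Bochner_Integration.integrable_bound[where f="\<lambda>x. U x + (h x)\<^sup>2 + 1"])
      show "AE x in \<mu>. norm ((h x)\<^sup>2 * ln ((h x)\<^sup>2)) \<le> norm (U x + (h x)\<^sup>2 + 1)"
      proof (rule AE_I2)
        fix x
        have "0 \<le> (h x)\<^sup>2" by simp
        moreover have "0 \<le> U x" using A by (simp add: U_def)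
        ultimately show "norm ((h x)\<^sup>2 * ln ((h x)\<^sup>2)) \<le> norm (U x + (h x)\<^sup>2 + 1)"
          using upper[of x] lower[of x] unfolding real_norm_def by linarith
      qed
    qed (use int_U int in auto)
    have "(\<integral>x. (h x)\<^sup>2 * ln ((h x)\<^sup>2) \<partial>\<mu>) = (\<integral>x. (h x)\<^sup>2 * ln ((h x)\<^sup>2) - (h x)\<^sup>2 + 1 \<partial>\<mu>)"
      using int_ent int by (simp add: prob_space h1)
    also have "\<dots> \<le> (\<integral>x. U x \<partial>\<mu>)"
      using int_ent int int_U upper by (intro integral_mono) auto
    also have "\<dots> = (5 + 4 * A) * I + 4 * (\<integral>x. (dist x x0)\<^sup>2 * (g x)\<^sup>2 \<partial>\<mu>)"
      unfolding U_def I_def using int_g hy(1) by simp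
    also have "(\<integral>x. (dist x x0)\<^sup>2 * (g x)\<^sup>2 \<partial>\<mu>) \<le> (E + b * I) / c"
      using hy(2) c_pos by (simp add: E_def I_def pos_le_divide_eq mult.commute)
    also have "(5 + 4 * A) * I + 4 * ((E + b * I) / c) = (5 + 4 * A + 4 * (b / c)) * I + 4 / c * E"
      using c_pos by (simp add: field_simps)
    also have "\<dots> \<le> (5 + 4 * A + 4 * (b / c)) * (2 * P * E) + 4 / c * E"
      using A b_nonneg c_pos by (intro add_mono mult_left_mono I_le) auto
    also have "\<dots> = C * E" by (simp add: C_def algebra_simps)
    finally show ?thesis using int_ent by (simp add: E_def)
  qed
  ultimately show ?thesis by blast
qed

end

section \<open>Soft minima and the Hamilton-Jacobi argument\<close>

definition gauss_weight :: "real \<Rightarrow> ('a::euclidean_space \<Rightarrow> real) \<Rightarrow> real \<Rightarrow> 'a \<Rightarrow> 'a \<Rightarrow> real" where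
  "gauss_weight \<epsilon> \<phi> r x i = exp ((\<phi> i - r * (dist x i)\<^sup>2) / \<epsilon>)"

text \<open>Smooth approximation of the minimum over i of
  \<open>r * (dist x i)^2 - \<phi> i\<close>, the Kantorovich conjugate of \<phi> for the cost r
  d^2. For r = 1 / (2 t) this minimum is the Hopf-Lax formula at time t with initial datum -\<phi>
  on I.\<close>

definition softmin :: "real \<Rightarrow> 'a::euclidean_space set \<Rightarrow> ('a \<Rightarrow> real) \<Rightarrow> real \<Rightarrow> 'a \<Rightarrow> real" where
  "softmin \<epsilon> I \<phi> r x = - \<epsilon> * ln (\<Sum>i\<in>I. gauss_weight \<epsilon> \<phi> r x i)"

text \<open>The Gibbs weights of the soft minimum; by \<open>DERIV_softmin_potential\<close> they
  are minus its gradient in \<phi>.\<close>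

definition softmin_prob :: "real \<Rightarrow> 'a::euclidean_space set \<Rightarrow> ('a \<Rightarrow> real) \<Rightarrow> real \<Rightarrow> 'a \<Rightarrow> 'a \<Rightarrow> real" where
  "softmin_prob \<epsilon> I \<phi> r x i = gauss_weight \<epsilon> \<phi> r x i / (\<Sum>j\<in>I. gauss_weight \<epsilon> \<phi> r x j)"

lemma gauss_weight_pos: "0 < gauss_weight \<epsilon> \<phi> r x i"
  by (simp add: gauss_weight_def)

section \<open>Calculus of the soft minimum\<close>

context
  fixes I :: "'a::euclidean_space set" and \<epsilon> :: real
  assumes I: "finite I" "I \<noteq> {}" and \<epsilon>: "0 < \<epsilon>"
begin

lemma sum_gauss_weight_pos: "0 < (\<Sum>i\<in>I. gauss_weight \<epsilon> \<phi> r x i)"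
  using I by (intro sum_pos gauss_weight_pos) auto

lemma softmin_prob_pos: "0 < softmin_prob \<epsilon> I \<phi> r x i"
  unfolding softmin_prob_def by (intro divide_pos_pos gauss_weight_pos sum_gauss_weight_pos)

lemma sum_softmin_prob: "(\<Sum>i\<in>I. softmin_prob \<epsilon> I \<phi> r x i) = 1"
  using sum_gauss_weight_pos[of \<phi> r x] by (simp add: softmin_prob_def sum_divide_distrib[symmetric])

lemma softmin_prob_le_1:
  assumes "i \<in> I"
  shows "softmin_prob \<epsilon> I \<phi> r x i \<le> 1"
proof -
  have "softmin_prob \<epsilon> I \<phi> r x i \<le> (\<Sum>i\<in>I. softmin_prob \<epsilon> I \<phi> r x i)"
    using assms I by (intro member_le_sum) (auto intro: less_imp_le softmin_prob_pos)
  then show ?thesis by (simp add: sum_softmin_prob)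
qed

lemma softmin_le:
  assumes "i \<in> I"
  shows "softmin \<epsilon> I \<phi> r x \<le> r * (dist x i)\<^sup>2 - \<phi> i"
proof -
  have "gauss_weight \<epsilon> \<phi> r x i \<le> (\<Sum>i\<in>I. gauss_weight \<epsilon> \<phi> r x i)"
    using assms I by (intro member_le_sum) (auto intro: less_imp_le gauss_weight_pos)
  then have "ln (gauss_weight \<epsilon> \<phi> r x i) \<le> ln (\<Sum>i\<in>I. gauss_weight \<epsilon> \<phi> r x i)"
    by (intro ln_mono gauss_weight_pos)
  then have "\<epsilon> * ((\<phi> i - r * (dist x i)\<^sup>2) / \<epsilon>) \<le> \<epsilon> * ln (\<Sum>i\<in>I. gauss_weight \<epsilon> \<phi> r x i)"
    using \<epsilon> by (intro mult_left_mono) (auto simp: gauss_weight_def)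
  then show ?thesis
    using \<epsilon> by (simp add: softmin_def)
qed

lemma softmin_mono:
  assumes "r \<le> s"
  shows "softmin \<epsilon> I \<phi> r x \<le> softmin \<epsilon> I \<phi> s x"
proof -
  have "(\<Sum>i\<in>I. gauss_weight \<epsilon> \<phi> s x i) \<le> (\<Sum>i\<in>I. gauss_weight \<epsilon> \<phi> r x i)"
    unfolding gauss_weight_def using assms \<epsilon>
    by (intro sum_mono) (auto intro!: divide_right_mono mult_right_mono)
  then have "ln (\<Sum>i\<in>I. gauss_weight \<epsilon> \<phi> s x i) \<le> ln (\<Sum>i\<in>I. gauss_weight \<epsilon> \<phi> r x i)"
    by (intro ln_mono sum_gauss_weight_pos)
  then show ?thesis using \<epsilon> by (simp add: softmin_def)
qed

text \<open>At r = 0 the value is independent of x, and by \<open>softmin_mono\<close> it is a lower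
  bound for all r \<ge> 0.\<close>

lemma softmin_0: "softmin \<epsilon> I \<phi> 0 x = softmin \<epsilon> I \<phi> 0 y"
  by (simp add: softmin_def gauss_weight_def)

lemma C1_grad_softmin:
  "C1_grad (softmin \<epsilon> I \<phi> r) (\<lambda>x. (2 * r) *\<^sub>R (\<Sum>i\<in>I. softmin_prob \<epsilon> I \<phi> r x i *\<^sub>R (x - i)))"
proof -
  have w: "C1_grad (\<lambda>x. gauss_weight \<epsilon> \<phi> r x i)
      (\<lambda>x. gauss_weight \<epsilon> \<phi> r x i *\<^sub>R ((- r / \<epsilon>) *\<^sub>R (2 *\<^sub>R (x - i))))" for i
  proof -
    have "C1_grad (\<lambda>x. (- r / \<epsilon>) * (dist x i)\<^sup>2 - - \<phi> i / \<epsilon>) (\<lambda>x. (- r / \<epsilon>) *\<^sub>R (2 *\<^sub>R (x - i)))"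
      by (rule C1_grad_diff_const[OF C1_grad_cmult[OF C1_grad_dist_square]])
    from C1_grad_exp[OF this] show ?thesis
      by (simp add: gauss_weight_def diff_divide_distrib)
  qed
  have sum: "C1_grad (\<lambda>x. \<Sum>i\<in>J. gauss_weight \<epsilon> \<phi> r x i)
      (\<lambda>x. \<Sum>i\<in>J. gauss_weight \<epsilon> \<phi> r x i *\<^sub>R ((- r / \<epsilon>) *\<^sub>R (2 *\<^sub>R (x - i))))" if "finite J" for J
    using that
  proof induction
    case empty
    show ?case by (simp add: C1_grad_const)
  next
    case (insert i J)
    show ?case
      using C1_grad_add[OF w insert.IH] by (simp only: sum.insert[OF insert.hyps])
  qed
  have ln: "C1_grad (\<lambda>x. - \<epsilon> * ln (\<Sum>i\<in>I. gauss_weight \<epsilon> \<phi> r x i))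
      (\<lambda>x. (- \<epsilon> * (1 / (\<Sum>i\<in>I. gauss_weight \<epsilon> \<phi> r x i))) *\<^sub>R
        (\<Sum>i\<in>I. gauss_weight \<epsilon> \<phi> r x i *\<^sub>R ((- r / \<epsilon>) *\<^sub>R (2 *\<^sub>R (x - i)))))"
  proof (rule C1_grad_compose[OF sum[OF I(1)], where \<phi>="\<lambda>s. - \<epsilon> * ln s" and \<phi>'="\<lambda>s. - \<epsilon> * (1 / s)"])
    show "((\<lambda>s. - \<epsilon> * ln s) has_real_derivative - \<epsilon> * (1 / (\<Sum>i\<in>I. gauss_weight \<epsilon> \<phi> r x i)))
        (at (\<Sum>i\<in>I. gauss_weight \<epsilon> \<phi> r x i))" for x
      using sum_gauss_weight_pos by (auto intro!: derivative_eq_intros)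
    have "s \<noteq> 0" if "s \<in> range (\<lambda>x. \<Sum>i\<in>I. gauss_weight \<epsilon> \<phi> r x i)" for s
    proof -
      from that obtain x where "s = (\<Sum>i\<in>I. gauss_weight \<epsilon> \<phi> r x i)" by blast
      then show ?thesis using sum_gauss_weight_pos[of \<phi> r x] by simp
    qed
    then show "continuous_on (range (\<lambda>x. \<Sum>i\<in>I. gauss_weight \<epsilon> \<phi> r x i)) (\<lambda>s. - \<epsilon> * (1 / s))"
      by (intro continuous_intros) auto
  qed
  have "(- \<epsilon> * (1 / (\<Sum>i\<in>I. gauss_weight \<epsilon> \<phi> r x i))) *\<^sub>R
        (\<Sum>i\<in>I. gauss_weight \<epsilon> \<phi> r x i *\<^sub>R ((- r / \<epsilon>) *\<^sub>R (2 *\<^sub>R (x - i))))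
      = (2 * r) *\<^sub>R (\<Sum>i\<in>I. softmin_prob \<epsilon> I \<phi> r x i *\<^sub>R (x - i))" for x
  proof -
    have "(- \<epsilon> * (1 / s)) *\<^sub>R (w *\<^sub>R ((- r / \<epsilon>) *\<^sub>R (2 *\<^sub>R v))) = (2 * r) *\<^sub>R ((w / s) *\<^sub>R v)"
      for s w and v :: 'a
      using \<epsilon> by simp
    then show ?thesis
      by (simp only: scaleR_sum_right softmin_prob_def)
  qed
  with ln show ?thesis by (simp add: softmin_def[abs_def])
qed

lemma DERIV_softmin:
  "((\<lambda>r. softmin \<epsilon> I \<phi> r x) has_real_derivative (\<Sum>i\<in>I. softmin_prob \<epsilon> I \<phi> r x i * (dist x i)\<^sup>2)) (at r)"
proof -
  have "((\<lambda>r. softmin \<epsilon> I \<phi> r x) has_real_derivative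
     - \<epsilon> * ((\<Sum>i\<in>I. gauss_weight \<epsilon> \<phi> r x i * (- (dist x i)\<^sup>2 / \<epsilon>)) / (\<Sum>i\<in>I. gauss_weight \<epsilon> \<phi> r x i))) (at r)"
    unfolding softmin_def gauss_weight_def
    using sum_gauss_weight_pos[of \<phi> r x, unfolded gauss_weight_def] \<epsilon>
    by (auto intro!: derivative_eq_intros sum.cong)
  also have "- \<epsilon> * ((\<Sum>i\<in>I. gauss_weight \<epsilon> \<phi> r x i * (- (dist x i)\<^sup>2 / \<epsilon>)) / (\<Sum>i\<in>I. gauss_weight \<epsilon> \<phi> r x i))
     = (\<Sum>i\<in>I. softmin_prob \<epsilon> I \<phi> r x i * (dist x i)\<^sup>2)"
    unfolding sum_divide_distrib sum_distrib_left using \<epsilon>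
    by (intro sum.cong) (auto simp: softmin_prob_def)
  finally show ?thesis .
qed

lemma DERIV_softmin_potential:
  assumes "j \<in> I"
  shows "((\<lambda>s. softmin \<epsilon> I (\<phi>(j := s)) r x) has_real_derivative - softmin_prob \<epsilon> I (\<phi>(j := s)) r x j) (at s)"
proof -
  have split: "(\<Sum>i\<in>I. gauss_weight \<epsilon> (\<phi>(j := s)) r x i)
      = exp ((s - r * (dist x j)\<^sup>2) / \<epsilon>) + (\<Sum>i\<in>I - {j}. gauss_weight \<epsilon> \<phi> r x i)" for s
    using assms I by (subst sum.remove[of I j]) (auto simp: gauss_weight_def intro!: sum.cong)
  show ?thesis
    unfolding softmin_def softmin_prob_def split
    using sum_gauss_weight_pos[of "\<phi>(j := s)" r x, unfolded split] \<epsilon>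
    by (auto intro!: derivative_eq_intros simp: gauss_weight_def)
qed

text \<open>Jensen's inequality for the square, from a nonnegative variance. This is the
  Hamilton-Jacobi inequality: up to powers of r, the left side is the squared gradient of
  \<open>softmin\<close> and the right side its derivative in r.\<close>

lemma softmin_prob_barycenter_le:
  "(norm (\<Sum>i\<in>I. softmin_prob \<epsilon> I \<phi> r x i *\<^sub>R (x - i)))\<^sup>2 \<le> (\<Sum>i\<in>I. softmin_prob \<epsilon> I \<phi> r x i * (dist x i)\<^sup>2)"
proof -
  define p where "p = softmin_prob \<epsilon> I \<phi> r x"
  define m where "m = (\<Sum>i\<in>I. p i *\<^sub>R (x - i))"
  have "0 \<le> (\<Sum>i\<in>I. p i * (norm ((x - i) - m))\<^sup>2)"
    by (intro sum_nonneg mult_nonneg_nonneg) (auto simp: p_def intro: less_imp_le softmin_prob_pos)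
  also have "\<dots> = (\<Sum>i\<in>I. p i * (dist x i)\<^sup>2 - 2 * ((p i *\<^sub>R (x - i)) \<bullet> m) + p i * (m \<bullet> m))"
    by (intro sum.cong)
      (auto simp: power2_norm_eq_inner dist_norm inner_diff_left inner_diff_right inner_commute algebra_simps)
  also have "\<dots> = (\<Sum>i\<in>I. p i * (dist x i)\<^sup>2) - 2 * (m \<bullet> m) + 1 * (m \<bullet> m)"
    unfolding sum.distrib sum_subtractf sum_distrib_left[symmetric] sum_distrib_right[symmetric] inner_sum_left[symmetric] m_def[symmetric]
    by (simp add: p_def sum_softmin_prob)
  finally show ?thesis by (simp add: power2_norm_eq_inner p_def m_def)
qed

text \<open>The logarithm of a Gibbs weight p_i gives r d^2 = \<phi> i + softmin - \<epsilon> ln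
  p_i. Averaging leaves \<epsilon> times the entropy of the weights, bounded crudely by card I
  through - p ln p \<le> 1.\<close>

lemma softmin_prob_transport_cost:
  "(\<Sum>i\<in>I. softmin_prob \<epsilon> I \<phi> r x i * (r * (dist x i)\<^sup>2))
    \<le> (\<Sum>i\<in>I. softmin_prob \<epsilon> I \<phi> r x i * \<phi> i) + softmin \<epsilon> I \<phi> r x + \<epsilon> * card I"
proof -
  define p where "p = softmin_prob \<epsilon> I \<phi> r x"
  have p: "0 < p i" for i by (simp add: p_def softmin_prob_pos)
  have cost: "r * (dist x i)\<^sup>2 = \<phi> i + softmin \<epsilon> I \<phi> r x - \<epsilon> * ln (p i)" for i
  proof -
    have "ln (p i) = (\<phi> i - r * (dist x i)\<^sup>2) / \<epsilon> - ln (\<Sum>i\<in>I. gauss_weight \<epsilon> \<phi> r x i)"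
      using sum_gauss_weight_pos[of \<phi> r x] by (simp add: p_def softmin_prob_def ln_div gauss_weight_def)
    then have "\<epsilon> * ln (p i) = \<epsilon> * ((\<phi> i - r * (dist x i)\<^sup>2) / \<epsilon>) - \<epsilon> * ln (\<Sum>i\<in>I. gauss_weight \<epsilon> \<phi> r x i)"
      by (simp only: right_diff_distrib)
    then show ?thesis using \<epsilon> by (simp add: softmin_def)
  qed
  have "(\<Sum>i\<in>I. p i * (r * (dist x i)\<^sup>2)) = (\<Sum>i\<in>I. p i * \<phi> i + p i * softmin \<epsilon> I \<phi> r x - \<epsilon> * (p i * ln (p i)))"
    by (intro sum.cong refl, unfold cost) (simp add: algebra_simps)
  also have "\<dots> \<le> (\<Sum>i\<in>I. p i * \<phi> i + p i * softmin \<epsilon> I \<phi> r x + \<epsilon> * 1)"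
  proof (intro sum_mono)
    fix i
    have "- 1 \<le> p i * ln (p i)"
      using entropy_integrand_nonneg[of "p i"] p[of i] by linarith
    then have "\<epsilon> * (- 1) \<le> \<epsilon> * (p i * ln (p i))"
      using \<epsilon> by (intro mult_left_mono) auto
    then show "p i * \<phi> i + p i * softmin \<epsilon> I \<phi> r x - \<epsilon> * (p i * ln (p i))
        \<le> p i * \<phi> i + p i * softmin \<epsilon> I \<phi> r x + \<epsilon> * 1" by simp
  qed
  also have "\<dots> = (\<Sum>i\<in>I. p i * \<phi> i) + (\<Sum>i\<in>I. p i) * softmin \<epsilon> I \<phi> r x + \<epsilon> * card I"
    by (simp add: sum.distrib sum_distrib_right mult.commute)
  finally show ?thesis by (simp add: p_def sum_softmin_prob)
qed

lemma continuous_gauss_weight: "continuous_on UNIV (\<lambda>x. gauss_weight \<epsilon> \<phi> r x i)"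
  unfolding gauss_weight_def using \<epsilon> by (intro continuous_intros) auto

lemma continuous_softmin_prob: "continuous_on UNIV (\<lambda>x. softmin_prob \<epsilon> I \<phi> r x i)"
  unfolding softmin_prob_def
  by (intro continuous_intros continuous_gauss_weight) (simp add: sum_gauss_weight_pos less_imp_neq[symmetric])

lemma measurable_softmin:
  "softmin \<epsilon> I \<phi> r \<in> borel_measurable borel"
  "(\<lambda>x. softmin_prob \<epsilon> I \<phi> r x i) \<in> borel_measurable borel"
  using C1_grad_measurable(1)[OF C1_grad_softmin] continuous_softmin_prob
  by (auto intro: borel_measurable_continuous_onI)

end

text \<open>
  As long as \<open>\<Psi> \<ge> 1\<close> the hypothesis says that \<open>t \<mapsto> ln (\<Psi> t) / t\<close> is nonincreasing, and this
  quotient is negative for small \<open>t\<close>.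
\<close>

lemma le_1_if_log_derivative_le:
  fixes \<Psi> \<Psi>' :: "real \<Rightarrow> real"
  assumes deriv: "\<And>t. t \<in> {0..1} \<Longrightarrow> (\<Psi> has_real_derivative \<Psi>' t) (at t)"
    and pos: "\<And>t. t \<in> {0..1} \<Longrightarrow> 0 < \<Psi> t" and 0: "\<Psi> 0 = 1" "\<Psi>' 0 < 0"
    and ineq: "\<And>t. t \<in> {0<..1} \<Longrightarrow> 1 \<le> \<Psi> t \<Longrightarrow> t * \<Psi>' t \<le> \<Psi> t * ln (\<Psi> t)"
  shows "\<Psi> 1 \<le> 1"
proof (rule ccontr)
  assume gt: "\<not> \<Psi> 1 \<le> 1"
  obtain d where d: "0 < d" "\<And>h. 0 < h \<Longrightarrow> h < d \<Longrightarrow> \<Psi> (0 + h) < \<Psi> 0"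
    using DERIV_neg_dec_right[OF deriv[of 0] 0(2)] by auto
  define t0 where "t0 = min (d / 2) (1 / 2)"
  have t0: "0 < t0" "t0 \<le> 1" "\<Psi> t0 < 1"
    using d(1) d(2)[of t0] 0 by (auto simp: t0_def min_def)
  \<comment> \<open>The hypothesis is available only where \<Psi> \<ge> 1. Hence the mean value
    theorem is applied after the last time t1 with \<Psi> \<le> 1, where ln \<Psi> / t starts
    nonpositive; t1 \<ge> t0 > 0 avoids division by 0.\<close>
  define S where "S = {t \<in> {t0..1}. \<Psi> t \<le> 1}"
  have cont: "continuous_on {t0..1} \<Psi>"
    using deriv t0 by (intro continuous_at_imp_continuous_on) (auto intro!: DERIV_isCont[OF deriv])
  have "closed S"
    unfolding S_def by (rule continuous_on_closed_Collect_le) (use cont in auto)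
  moreover have ne: "S \<noteq> {}" and bdd: "bdd_above S"
    using t0 by (auto simp: S_def intro!: bdd_aboveI[of _ 1])
  ultimately have t1: "Sup S \<in> S" by (intro closed_contains_Sup)
  define t1 where "t1 = Sup S"
  have t1_props: "t0 \<le> t1" "t1 \<le> 1" "\<Psi> t1 \<le> 1" using t1 by (auto simp: S_def t1_def)
  have t1_lt: "t1 < 1" using t1_props gt by (cases "t1 = 1") auto
  have above: "1 < \<Psi> t" if "t1 < t" "t \<le> 1" for t
  proof (rule ccontr)
    assume "\<not> 1 < \<Psi> t"
    then have "t \<in> S" using that t1_props by (auto simp: S_def)
    then have "t \<le> t1" unfolding t1_def by (rule cSup_upper[OF _ bdd])
    with that show False by simp
  qed
  define \<Lambda>' where "\<Lambda>' t = (\<Psi>' t / \<Psi> t * t - ln (\<Psi> t)) / (t * t)" for t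
  have "\<exists>z. t1 < z \<and> z < 1 \<and> ln (\<Psi> 1) / 1 - ln (\<Psi> t1) / t1 = (1 - t1) * \<Lambda>' z"
  proof (rule MVT2[OF t1_lt])
    fix t assume t: "t1 \<le> t" "t \<le> 1"
    then have t01: "t \<in> {0..1}" "0 < t" using t0 t1_props by auto
    have "((\<lambda>t. ln (\<Psi> t)) has_real_derivative \<Psi>' t / \<Psi> t) (at t)"
      using deriv[OF t01(1)] pos[OF t01(1)] by (auto intro!: derivative_eq_intros)
    then show "((\<lambda>t. ln (\<Psi> t) / t) has_real_derivative \<Lambda>' t) (at t)"
      unfolding \<Lambda>'_def using DERIV_divide[OF _ DERIV_ident] t01(2) by force
  qed
  then obtain z where z: "t1 < z" "z < 1" "ln (\<Psi> 1) - ln (\<Psi> t1) / t1 = (1 - t1) * \<Lambda>' z" by auto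
  have zpos: "0 < z" "1 < \<Psi> z" using z t0 t1_props above[of z] by auto
  then have "z * \<Psi>' z \<le> \<Psi> z * ln (\<Psi> z)"
    using z by (intro ineq) auto
  then have "\<Psi>' z / \<Psi> z * z \<le> ln (\<Psi> z)"
    using zpos by (simp add: field_simps)
  then have "\<Lambda>' z \<le> 0" by (simp add: \<Lambda>'_def divide_nonpos_nonneg)
  then have "(1 - t1) * \<Lambda>' z \<le> 0" using t1_lt by (simp add: mult_nonneg_nonpos)
  moreover have "ln (\<Psi> t1) / t1 \<le> 0"
    using t1_props t0 pos[of t1] by (auto intro!: divide_nonpos_nonneg)
  ultimately have "ln (\<Psi> 1) \<le> 0" using z(3) by linarith
  with gt pos[of 1] show False by simp
qed

text \<open>One run of the flow for a fixed potential. \<open>upper\<close> bounds the normalized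
  solution by A + d^2 during the whole run; multiplied by \<rho> t \<le> \<rho> this is the growth
  constraint in \<open>log_sobolev\<close>. \<open>initial\<close> makes the derivative of the
  exponential functional at time 0 strictly negative.\<close>

locale soft_hopf_lax = lyapunov_measure \<mu> x0 c b
  for \<mu> :: "'a::euclidean_space measure" and x0 c b +
  fixes I :: "'a set" and \<phi> :: "'a \<Rightarrow> real" and \<epsilon> M A \<rho> :: real
  assumes I: "finite I" "I \<noteq> {}" and \<epsilon>: "0 < \<epsilon>" and \<rho>: "0 < \<rho>" "\<rho> \<le> 1" and A: "0 \<le> A"
    and upper: "\<And>r x. 0 \<le> r \<Longrightarrow> r \<le> 1 / 2 \<Longrightarrow> softmin \<epsilon> I \<phi> r x \<le> M + A + (dist x x0)\<^sup>2"
    and initial: "(\<integral>x. softmin \<epsilon> I \<phi> (1 / 2) x \<partial>\<mu>) < M"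
    and exp_moment: "integrable \<mu> (\<lambda>x. exp (2 * \<rho> * (dist x x0)\<^sup>2))"
    and log_sobolev: "\<And>h Dh. C1_grad h Dh \<Longrightarrow> (\<And>x. 0 \<le> h x) \<Longrightarrow>
      integrable \<mu> (\<lambda>x. (h x)\<^sup>2) \<Longrightarrow> integrable \<mu> (\<lambda>x. (norm (Dh x))\<^sup>2) \<Longrightarrow> (\<integral>x. (h x)\<^sup>2 \<partial>\<mu>) = 1 \<Longrightarrow>
      (\<And>x. (h x)\<^sup>2 \<le> exp (A + \<rho> * (dist x x0)\<^sup>2)) \<Longrightarrow>
      (\<integral>x. (h x)\<^sup>2 * ln ((h x)\<^sup>2) \<partial>\<mu>) \<le> 2 / \<rho> * (\<integral>x. (norm (Dh x))\<^sup>2 \<partial>\<mu>)"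
begin

text \<open>
  The Hopf-Lax kernel \<open>(dist x i)\<^sup>2 / (2 t)\<close> is started at time 1, so that nothing is singular at
  \<open>t = 0\<close>.
\<close>

definition U :: "real \<Rightarrow> 'a \<Rightarrow> real" where
  "U t x = softmin \<epsilon> I \<phi> (1 / (2 * (t + 1))) x - M"

text \<open>Mean squared displacement under the Gibbs weights; by \<open>DERIV_U\<close> it is - 2
  (t + 1)^2 times the time derivative of U.\<close>

definition Q :: "real \<Rightarrow> 'a \<Rightarrow> real" where
  "Q t x = (\<Sum>i\<in>I. softmin_prob \<epsilon> I \<phi> (1 / (2 * (t + 1))) x i * (dist x i)\<^sup>2)"

definition DU :: "real \<Rightarrow> 'a \<Rightarrow> 'a" where
  "DU t x = (1 / (t + 1)) *\<^sub>R (\<Sum>i\<in>I. softmin_prob \<epsilon> I \<phi> (1 / (2 * (t + 1))) x i *\<^sub>R (x - i))"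

lemma C1_grad_U: "C1_grad (U t) (DU t)"
proof -
  have "2 * (1 / (2 * (t + 1))) = 1 / (t + 1)"
    using mult_divide_mult_cancel_left[of 2 1 "t + 1"] by simp
  then show ?thesis
    using C1_grad_diff_const[OF C1_grad_softmin[OF I \<epsilon>, of \<phi> "1 / (2 * (t + 1))"], of M]
    unfolding U_def[abs_def] DU_def[abs_def] by (simp only:)
qed

lemma measurable_Q: "Q t \<in> borel_measurable borel"
  unfolding Q_def[abs_def] using measurable_softmin(2)[OF I \<epsilon>] by measurable

lemma DERIV_U:
  assumes "- 1 < t"
  shows "((\<lambda>t. U t x) has_real_derivative - Q t x / (2 * (t + 1)\<^sup>2)) (at t)"
proof -
  have "((\<lambda>t. 1 / (2 * (t + 1))) has_real_derivative - (1 / (2 * (t + 1)\<^sup>2))) (at t)"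
  proof -
    have "((\<lambda>t. inverse (t + 1) / 2) has_real_derivative - (inverse (t + 1))\<^sup>2 / 2) (at t)"
      using assms by (auto intro!: derivative_eq_intros simp: power2_eq_square)
    moreover have "inverse (t + 1) / 2 = 1 / (2 * (t + 1))" for t :: real
      by (metis divide_divide_eq_left inverse_eq_divide mult.commute)
    moreover have "- (inverse (t + 1))\<^sup>2 / 2 = - (1 / (2 * (t + 1)\<^sup>2))"
      by (simp add: inverse_eq_divide power_one_over)
    ultimately show ?thesis by (simp only:)
  qed
  from DERIV_chain2[OF DERIV_softmin[OF I \<epsilon>] this] show ?thesis
    unfolding U_def Q_def
    by (auto intro!: derivative_eq_intros)
qed

lemma Q_nonneg: "0 \<le> Q t x"
  unfolding Q_def by (intro sum_nonneg mult_nonneg_nonneg) (auto intro: less_imp_le softmin_prob_pos[OF I \<epsilon>])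

text \<open>Together with \<open>DERIV_U\<close> this is the Hamilton-Jacobi inequality for
  U.\<close>

lemma norm_DU_le:
  "(norm (DU t x))\<^sup>2 \<le> Q t x / (t + 1)\<^sup>2"
  using softmin_prob_barycenter_le[OF I \<epsilon>, of \<phi> "1 / (2 * (t + 1))" x]
  by (simp add: DU_def Q_def power_mult_distrib power_divide divide_right_mono)

text \<open>Majorants on an open interval around [0, 1], so that two-sided derivatives exist at both
  ends. B may depend on \<phi>, I and \<epsilon>: it serves integrability and does not enter the
  final constant.\<close>

lemma bounds:
  obtains B where "0 \<le> B" "\<And>t x. t \<in> {-1/2<..<3/2} \<Longrightarrow> \<bar>U t x\<bar> \<le> B * (1 + (dist x x0)\<^sup>2)"
    "\<And>t x. Q t x \<le> B * (1 + (dist x x0)\<^sup>2)"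
    "\<And>t x. t \<in> {-1/2<..<3/2} \<Longrightarrow> exp (\<rho> * t * U t x) \<le> B * exp (3 / 2 * \<rho> * (dist x x0)\<^sup>2)"
proof -
  obtain i0 where i0: "i0 \<in> I" using I by auto
  define D where "D = (\<Sum>i\<in>I. (dist i x0)\<^sup>2)"
  have D: "(dist i x0)\<^sup>2 \<le> D" if "i \<in> I" for i
    unfolding D_def using that I by (intro member_le_sum) auto
  have D0: "0 \<le> D" by (simp add: D_def sum_nonneg)
  have dist2: "(dist x i)\<^sup>2 \<le> 2 * (dist x x0)\<^sup>2 + 2 * D" if "i \<in> I" for x i
  proof -
    have "(dist x i)\<^sup>2 \<le> (dist x x0 + dist i x0)\<^sup>2"
      by (intro power_mono dist_triangle2) auto
    also have "\<dots> \<le> 2 * (dist x x0)\<^sup>2 + 2 * (dist i x0)\<^sup>2"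
      using sum_squares_bound[of "dist x x0" "dist i x0"] by (simp add: power2_sum)
    finally show ?thesis using D[OF that] by simp
  qed
  define L where "L = \<bar>softmin \<epsilon> I \<phi> 0 x0 - M\<bar>"
  have r: "0 \<le> 1 / (2 * (t + 1))" "1 / (2 * (t + 1)) \<le> 1" if "t \<in> {-1/2<..<3/2}" for t :: real
    using that by (auto simp: divide_le_eq)
  have U_lower: "- L \<le> U t x" if "t \<in> {-1/2<..<3/2}" for t x
    using softmin_mono[OF I \<epsilon> r(1)[OF that], of \<phi> x] softmin_0[OF I \<epsilon>, of \<phi> x x0]
    by (simp add: U_def L_def)
  have U_upper: "U t x \<le> 2 * (dist x x0)\<^sup>2 + (2 * D + \<bar>\<phi> i0\<bar> + \<bar>M\<bar>)" if t: "t \<in> {-1/2<..<3/2}" for t x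
  proof -
    have "1 / (2 * (t + 1)) * (dist x i0)\<^sup>2 \<le> 1 * (dist x i0)\<^sup>2"
      by (intro mult_right_mono r(2)[OF t]) auto
    then show ?thesis
      using softmin_le[OF I \<epsilon> i0, of \<phi> "1 / (2 * (t + 1))" x] dist2[OF i0, of x] unfolding U_def by linarith
  qed
  define K where "K = exp (2 * A + L)"
  define B where "B = 2 * D + 2 + \<bar>\<phi> i0\<bar> + \<bar>M\<bar> + L + K"
  have L0: "0 \<le> L" and K0: "0 \<le> K" by (auto simp: L_def K_def)
  have BB: "2 * (dist x x0)\<^sup>2 + (2 * D + \<bar>\<phi> i0\<bar> + \<bar>M\<bar>) + L \<le> B * (1 + (dist x x0)\<^sup>2)" for x
  proof -
    have "0 \<le> (B - 2) * (dist x x0)\<^sup>2"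
      using D0 L0 K0 by (intro mult_nonneg_nonneg) (auto simp: B_def)
    then have "B + 2 * (dist x x0)\<^sup>2 \<le> B * (1 + (dist x x0)\<^sup>2)" by (simp add: algebra_simps)
    moreover have "(2 * D + \<bar>\<phi> i0\<bar> + \<bar>M\<bar>) + L \<le> B" using K0 by (simp add: B_def)
    ultimately show ?thesis by linarith
  qed
  show thesis
  proof (rule that[of B])
    show "0 \<le> B" using D0 L0 K0 by (simp add: B_def)
    show "\<bar>U t x\<bar> \<le> B * (1 + (dist x x0)\<^sup>2)" if "t \<in> {-1/2<..<3/2}" for t x
    proof -
      have "0 \<le> (dist x x0)\<^sup>2" by simp
      then show ?thesis
        using U_lower[OF that, of x] U_upper[OF that, of x] BB[of x] L0 D0 by linarith
    qed
    show "Q t x \<le> B * (1 + (dist x x0)\<^sup>2)" for t x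
    proof -
      have "Q t x \<le> (\<Sum>i\<in>I. softmin_prob \<epsilon> I \<phi> (1 / (2 * (t + 1))) x i * (2 * (dist x x0)\<^sup>2 + 2 * D))"
        unfolding Q_def
        by (intro sum_mono mult_left_mono dist2) (auto intro: less_imp_le softmin_prob_pos[OF I \<epsilon>])
      also have "\<dots> = 2 * (dist x x0)\<^sup>2 + 2 * D"
        by (simp add: sum_distrib_right[symmetric] sum_softmin_prob[OF I \<epsilon>])
      finally show ?thesis using BB[of x] L0 by linarith
    qed
    show "exp (\<rho> * t * U t x) \<le> B * exp (3 / 2 * \<rho> * (dist x x0)\<^sup>2)" if t: "t \<in> {-1/2<..<3/2}" for t x
    proof -
      have "\<rho> * t * U t x \<le> 2 * A + L + 3 / 2 * \<rho> * (dist x x0)\<^sup>2"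
      proof (cases "0 \<le> t")
        case True
        have "U t x \<le> A + (dist x x0)\<^sup>2"
          using upper[of "1 / (2 * (t + 1))" x] True by (simp add: U_def divide_le_eq)
        then have "\<rho> * t * U t x \<le> \<rho> * t * (A + (dist x x0)\<^sup>2)"
          using True \<rho> by (intro mult_left_mono) auto
        also have "\<dots> \<le> \<rho> * (3 / 2) * (A + (dist x x0)\<^sup>2)"
          using True t \<rho> A by (intro mult_right_mono mult_left_mono) auto
        also have "\<dots> = \<rho> * (3 / 2 * A) + 3 / 2 * \<rho> * (dist x x0)\<^sup>2" by (simp add: algebra_simps)
        also have "\<rho> * (3 / 2 * A) \<le> 1 * (3 / 2 * A)"
          using \<rho> A by (intro mult_right_mono) auto
        finally show ?thesis using A L0 by simp
      next
        case False
        have "\<rho> * t * U t x = (\<rho> * - t) * (- U t x)" by simp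
        also have "\<dots> \<le> (\<rho> * - t) * L"
          using False \<rho> U_lower[OF t, of x] by (intro mult_left_mono) (auto simp: mult_nonneg_nonpos)
        also have "\<dots> \<le> 1 * L"
          using False t \<rho> L0 by (intro mult_right_mono mult_le_one) auto
        finally show ?thesis using A \<rho> by (simp add: add_increasing add_increasing2)
      qed
      then have "exp (\<rho> * t * U t x) \<le> exp (2 * A + L + 3 / 2 * \<rho> * (dist x x0)\<^sup>2)" by simp
      also have "\<dots> = K * exp (3 / 2 * \<rho> * (dist x x0)\<^sup>2)" by (simp add: K_def exp_add)
      also have "\<dots> \<le> B * exp (3 / 2 * \<rho> * (dist x x0)\<^sup>2)"
        using D0 L0 by (intro mult_right_mono) (auto simp: B_def)
      finally show ?thesis .
    qed
  qed
qed

text \<open>3 / 2 is the right end of the time interval in \<open>bounds\<close>; the polynomial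
  factor accounts for U and Q in the time derivative. The gap to the exponent 2 \<rho> of
  \<open>exp_moment\<close> absorbs that factor.\<close>

definition dominator :: "'a \<Rightarrow> real" where
  "dominator x = (1 + (dist x x0)\<^sup>2) * exp (3 / 2 * \<rho> * (dist x x0)\<^sup>2)"

lemma dominator_ge: "exp (3 / 2 * \<rho> * (dist x x0)\<^sup>2) \<le> dominator x" "0 \<le> dominator x"
  by (simp_all add: dominator_def)

lemma integrable_dominator: "integrable \<mu> dominator"
proof (rule Bochner_Integration.integrable_bound[OF integrable_mult_right[OF exp_moment, of "1 + 2 / \<rho>"]])
  show "AE x in \<mu>. norm (dominator x) \<le> norm ((1 + 2 / \<rho>) * exp (2 * \<rho> * (dist x x0)\<^sup>2))"
  proof (rule AE_I2)
    fix x
    define e where "e = exp (\<rho> * (dist x x0)\<^sup>2 / 2)"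
    have "1 \<le> e" using \<rho> by (simp add: e_def)
    moreover have "(dist x x0)\<^sup>2 \<le> 2 / \<rho> * e"
      using exp_ge_add_one_self[of "\<rho> * (dist x x0)\<^sup>2 / 2"] \<rho> by (simp add: e_def field_simps)
    ultimately have "1 + (dist x x0)\<^sup>2 \<le> (1 + 2 / \<rho>) * e" by (simp add: distrib_right)
    then have "dominator x \<le> ((1 + 2 / \<rho>) * e) * exp (3 / 2 * \<rho> * (dist x x0)\<^sup>2)"
      unfolding dominator_def by (intro mult_right_mono) auto
    also have "\<dots> = (1 + 2 / \<rho>) * exp (2 * \<rho> * (dist x x0)\<^sup>2)"
      by (simp add: e_def exp_add[symmetric] field_simps)
    finally show "norm (dominator x) \<le> norm ((1 + 2 / \<rho>) * exp (2 * \<rho> * (dist x x0)\<^sup>2))"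
      using dominator_ge(2)[of x] by simp
  qed
qed (simp add: dominator_def[abs_def])

lemma integrable_dominated:
  assumes "f \<in> borel_measurable borel" "\<And>x. \<bar>f x\<bar> \<le> K * dominator x"
  shows "integrable \<mu> f"
proof (rule Bochner_Integration.integrable_bound[OF integrable_mult_right[OF integrable_dominator, of K]])
  show "AE x in \<mu>. norm (f x) \<le> norm (K * dominator x)"
    by (rule AE_I2) (use order_trans[OF assms(2) abs_ge_self] in simp)
qed (use assms(1) in \<open>simp cong: measurable_cong_sets\<close>)

text \<open>The functional of the Bobkov-Gentil-Ledoux argument with linear exponent \<rho> t: it is
  1 at t = 0, and at t = 1 it is the exponential moment needed for entropy duality.\<close>

definition \<Psi> :: "real \<Rightarrow> real" where "\<Psi> t = (\<integral>x. exp (\<rho> * t * U t x) \<partial>\<mu>)"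

definition F' :: "real \<Rightarrow> 'a \<Rightarrow> real" where
  "F' t x = exp (\<rho> * t * U t x) * (\<rho> * (U t x - t * Q t x / (2 * (t + 1)\<^sup>2)))"

lemma measurable_U: "U t \<in> borel_measurable borel" "DU t \<in> borel_measurable borel"
  using C1_grad_measurable[OF C1_grad_U] by auto

lemma exp_mult_le_dominator:
  assumes "0 \<le> B" "e \<le> B * exp (3 / 2 * \<rho> * (dist x x0)\<^sup>2)" "\<bar>v\<bar> \<le> K * (1 + (dist x x0)\<^sup>2)" "0 \<le> e"
  shows "\<bar>e * v\<bar> \<le> (B * K) * dominator x"
proof -
  have "\<bar>e * v\<bar> \<le> (B * exp (3 / 2 * \<rho> * (dist x x0)\<^sup>2)) * (K * (1 + (dist x x0)\<^sup>2))"
    using assms by (simp add: abs_mult mult_mono)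
  then show ?thesis by (simp add: dominator_def mult_ac)
qed

lemma integrable_exp_U:
  assumes t: "t \<in> {-1/2<..<3/2}"
  shows "integrable \<mu> (\<lambda>x. exp (\<rho> * t * U t x))"
    and "integrable \<mu> (\<lambda>x. exp (\<rho> * t * U t x) * U t x)"
    and "integrable \<mu> (\<lambda>x. exp (\<rho> * t * U t x) * Q t x)"
proof -
  obtain B where B: "0 \<le> B" "\<And>t x. t \<in> {-1/2<..<3/2} \<Longrightarrow> \<bar>U t x\<bar> \<le> B * (1 + (dist x x0)\<^sup>2)"
    "\<And>t x. Q t x \<le> B * (1 + (dist x x0)\<^sup>2)"
    "\<And>t x. t \<in> {-1/2<..<3/2} \<Longrightarrow> exp (\<rho> * t * U t x) \<le> B * exp (3 / 2 * \<rho> * (dist x x0)\<^sup>2)"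
    using bounds by metis
  note [measurable] = measurable_U measurable_Q
  have "\<bar>exp (\<rho> * t * U t x)\<bar> \<le> B * dominator x" for x
    using B(4)[OF t, of x] mult_left_mono[OF dominator_ge(1)[of x] B(1)] by simp
  then show "integrable \<mu> (\<lambda>x. exp (\<rho> * t * U t x))"
    by (intro integrable_dominated[where K=B]) measurable
  have "\<bar>exp (\<rho> * t * U t x) * U t x\<bar> \<le> (B * B) * dominator x" for x
    by (rule exp_mult_le_dominator[OF B(1) B(4)[OF t] B(2)[OF t]]) auto
  then show "integrable \<mu> (\<lambda>x. exp (\<rho> * t * U t x) * U t x)"
    by (intro integrable_dominated[where K="B * B"]) auto
  have "\<bar>exp (\<rho> * t * U t x) * Q t x\<bar> \<le> (B * B) * dominator x" for x
    by (rule exp_mult_le_dominator[OF B(1) B(4)[OF t]]) (use B(3) Q_nonneg in auto)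
  then show "integrable \<mu> (\<lambda>x. exp (\<rho> * t * U t x) * Q t x)"
    by (intro integrable_dominated[where K="B * B"]) auto
qed

lemma DERIV_\<Psi>:
  assumes t: "t \<in> {-1/2<..<3/2}"
  shows "(\<Psi> has_real_derivative (\<integral>x. F' t x \<partial>\<mu>)) (at t)"
proof -
  obtain B where B: "0 \<le> B" "\<And>t x. t \<in> {-1/2<..<3/2} \<Longrightarrow> \<bar>U t x\<bar> \<le> B * (1 + (dist x x0)\<^sup>2)"
    "\<And>t x. Q t x \<le> B * (1 + (dist x x0)\<^sup>2)"
    "\<And>t x. t \<in> {-1/2<..<3/2} \<Longrightarrow> exp (\<rho> * t * U t x) \<le> B * exp (3 / 2 * \<rho> * (dist x x0)\<^sup>2)"
    using bounds by metis
  note [measurable] = measurable_U measurable_Q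
  show ?thesis
    unfolding \<Psi>_def[abs_def]
  proof (rule has_real_derivative_integral_dominated[OF t, where w="\<lambda>x. (B * (4 * B)) * dominator x"])
    show "((\<lambda>s. exp (\<rho> * s * U s x)) has_real_derivative F' s x) (at s)" if "s \<in> {-1/2<..<3/2}" for s x
      unfolding F'_def using that
      by (auto intro!: derivative_eq_intros DERIV_U simp: field_simps)
    show "\<bar>F' s x\<bar> \<le> (B * (4 * B)) * dominator x" if s: "s \<in> {-1/2<..<3/2}" for s x
      unfolding F'_def
    proof (rule exp_mult_le_dominator[OF B(1) B(4)[OF s]])
      \<comment> \<open>s + 1 > 1 / 2 and \<bar>s\<bar> < 3 / 2 give the factor 3; the bound on U
        itself raises it to 4.\<close>
      have "(1 / 2)\<^sup>2 \<le> (s + 1)\<^sup>2" using s by (intro power_mono) auto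
      then have "\<bar>s\<bar> / (2 * (s + 1)\<^sup>2) \<le> 3"
        using s by (auto simp: divide_le_eq power2_eq_square)
      then have "\<bar>s\<bar> / (2 * (s + 1)\<^sup>2) * Q s x \<le> 3 * (B * (1 + (dist x x0)\<^sup>2))"
        by (intro mult_mono B Q_nonneg) auto
      moreover have "\<bar>s * Q s x / (2 * (s + 1)\<^sup>2)\<bar> = \<bar>s\<bar> / (2 * (s + 1)\<^sup>2) * Q s x"
        using Q_nonneg by (simp add: abs_mult)
      ultimately have "\<bar>U s x - s * Q s x / (2 * (s + 1)\<^sup>2)\<bar> \<le> 4 * B * (1 + (dist x x0)\<^sup>2)"
        using B(2)[OF s, of x] by linarith
      then have "\<rho> * \<bar>U s x - s * Q s x / (2 * (s + 1)\<^sup>2)\<bar> \<le> 1 * (4 * B * (1 + (dist x x0)\<^sup>2))"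
        using \<rho> by (intro mult_mono) auto
      then show "\<bar>\<rho> * (U s x - s * Q s x / (2 * (s + 1)\<^sup>2))\<bar> \<le> 4 * B * (1 + (dist x x0)\<^sup>2)"
        using \<rho> by (simp add: abs_mult)
    qed simp
    show "integrable \<mu> (\<lambda>x. (B * (4 * B)) * dominator x)"
      using integrable_dominator by simp
    show "F' t \<in> borel_measurable \<mu>"
      unfolding F'_def[abs_def] by measurable
  qed (rule integrable_exp_U)
qed

lemma \<Psi>_pos:
  assumes t: "t \<in> {-1/2<..<3/2}"
  shows "0 < \<Psi> t"
proof -
  have "\<Psi> t \<noteq> 0"
    unfolding \<Psi>_def
    using integral_nonneg_eq_0_iff_AE[OF integrable_exp_U(1)[OF t]] AE_False by auto
  moreover have "0 \<le> \<Psi> t" by (simp add: \<Psi>_def)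
  ultimately show ?thesis by simp
qed

text \<open>The logarithmic Sobolev inequality for h^2 = exp (\<rho> t U) / \<Psi> t. Since
  \<nabla>h = (\<rho> t / 2) h \<nabla>U, its right side integrates (2 / \<rho>) (\<rho> t)^2 / 4 *
  \<bar>\<nabla>U\<bar>^2 = \<rho> t^2 \<bar>\<nabla>U\<bar>^2 / 2 against h^2 d\<mu>. The time
  derivative of U enters t \<Psi>' with the factor \<rho> t^2, so the Hamilton-Jacobi inequality
  cancels this term exactly; that fixes the constant 2 / \<rho>.\<close>

lemma \<Psi>_log_derivative_le:
  assumes t: "0 < t" "t \<le> 1" and ge: "1 \<le> \<Psi> t"
  shows "t * (\<integral>x. F' t x \<partial>\<mu>) \<le> \<Psi> t * ln (\<Psi> t)"
proof -
  have t': "t \<in> {-1/2<..<3/2}" using t by auto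
  note [measurable] = measurable_U measurable_Q
  note int = integrable_exp_U[OF t']
  define s where "s = \<Psi> t"
  have s: "1 \<le> s" "0 < s" using ge by (auto simp: s_def)
  define e where "e x = exp (\<rho> * t * U t x)" for x
  have int_e: "integrable \<mu> e" "integrable \<mu> (\<lambda>x. e x * U t x)" "integrable \<mu> (\<lambda>x. e x * Q t x)"
    using int by (simp_all add: e_def[abs_def])
  \<comment> \<open>With the normalization in the exponent, h is the exponential of a continuously
    differentiable function, and no square root has to be differentiated.\<close>
  define h where "h x = exp (\<rho> * t / 2 * U t x - ln s / 2)" for x
  define Dh where "Dh x = h x *\<^sub>R ((\<rho> * t / 2) *\<^sub>R DU t x)" for x
  have C: "C1_grad h Dh"
    unfolding h_def[abs_def] Dh_def[abs_def]
    by (intro C1_grad_exp C1_grad_diff_const C1_grad_cmult C1_grad_U)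
  note [measurable] = C1_grad_measurable[OF C]
  have h2: "(h x)\<^sup>2 = e x / s" for x
  proof -
    have "(h x)\<^sup>2 = exp (2 * (\<rho> * t / 2 * U t x - ln s / 2))"
      unfolding h_def by (rule exp_double[symmetric])
    also have "2 * (\<rho> * t / 2 * U t x - ln s / 2) = \<rho> * t * U t x - ln s"
      by simp
    finally show ?thesis using s by (simp add: exp_diff e_def)
  qed
  have Dh2: "(norm (Dh x))\<^sup>2 \<le> (\<rho> * t)\<^sup>2 / (4 * s * (t + 1)\<^sup>2) * (e x * Q t x)" for x
  proof -
    have "(norm (Dh x))\<^sup>2 = e x / s * ((\<rho> * t)\<^sup>2 / 4 * (norm (DU t x))\<^sup>2)"
      by (simp add: Dh_def power_mult_distrib h2 power_divide)
    also have "\<dots> \<le> e x / s * ((\<rho> * t)\<^sup>2 / 4 * (Q t x / (t + 1)\<^sup>2))"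
      using s by (intro mult_left_mono norm_DU_le) (auto simp: e_def)
    finally show ?thesis by (simp add: mult_ac)
  qed
  have int_h: "integrable \<mu> (\<lambda>x. (h x)\<^sup>2)"
    unfolding h2 using int_e by simp
  have int_Dh: "integrable \<mu> (\<lambda>x. (norm (Dh x))\<^sup>2)"
  proof (rule Bochner_Integration.integrable_bound[OF integrable_mult_right[OF int_e(3), of "(\<rho> * t)\<^sup>2 / (4 * s * (t + 1)\<^sup>2)"]])
    show "AE x in \<mu>. norm ((norm (Dh x))\<^sup>2) \<le> norm ((\<rho> * t)\<^sup>2 / (4 * s * (t + 1)\<^sup>2) * (e x * Q t x))"
      unfolding real_norm_def abs_power2
      by (rule AE_I2) (rule order_trans[OF Dh2 abs_ge_self])
  qed auto
  have "(\<integral>x. (h x)\<^sup>2 \<partial>\<mu>) = 1"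
    unfolding h2 using s by (simp add: s_def \<Psi>_def e_def)
  moreover have "(h x)\<^sup>2 \<le> exp (A + \<rho> * (dist x x0)\<^sup>2)" for x
  proof -
    have "U t x \<le> A + (dist x x0)\<^sup>2"
      using upper[of "1 / (2 * (t + 1))" x] t by (simp add: U_def divide_le_eq)
    then have "\<rho> * t * U t x \<le> \<rho> * t * (A + (dist x x0)\<^sup>2)"
      using t \<rho> by (intro mult_left_mono) auto
    also have "\<dots> \<le> \<rho> * 1 * (A + (dist x x0)\<^sup>2)"
      using t \<rho> A by (intro mult_right_mono mult_left_mono) auto
    also have "\<dots> \<le> A + \<rho> * (dist x x0)\<^sup>2"
      using \<rho> A by (simp add: distrib_left mult_left_le_one_le)
    finally have "e x \<le> exp (A + \<rho> * (dist x x0)\<^sup>2)" by (simp add: e_def)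
    \<comment> \<open>Here \<Psi> t \<ge> 1 is used: normalizing does not push h^2 above the growth
      constraint.\<close>
    moreover have "e x / s \<le> e x" using s by (simp add: e_def divide_le_eq mult_le_cancel_left1)
    ultimately show ?thesis by (simp add: h2)
  qed
  ultimately have ls: "(\<integral>x. (h x)\<^sup>2 * ln ((h x)\<^sup>2) \<partial>\<mu>) \<le> 2 / \<rho> * (\<integral>x. (norm (Dh x))\<^sup>2 \<partial>\<mu>)"
    using int_h int_Dh by (intro log_sobolev[OF C]) (auto simp: h_def)
  define X Y where "X = (\<integral>x. e x * U t x \<partial>\<mu>)" and "Y = (\<integral>x. e x * Q t x \<partial>\<mu>)"
  have "(h x)\<^sup>2 * ln ((h x)\<^sup>2) = (\<rho> * t / s) * (e x * U t x) - (ln s / s) * e x" for x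
    unfolding h2 using s by (simp add: ln_div e_def right_diff_distrib diff_divide_distrib mult_ac)
  then have "(\<integral>x. (h x)\<^sup>2 * ln ((h x)\<^sup>2) \<partial>\<mu>) = (\<rho> * t / s) * X - (ln s / s) * (\<integral>x. e x \<partial>\<mu>)"
    using int_e by (simp add: X_def)
  also have "(\<integral>x. e x \<partial>\<mu>) = s" by (simp add: s_def \<Psi>_def e_def)
  finally have L: "(\<integral>x. (h x)\<^sup>2 * ln ((h x)\<^sup>2) \<partial>\<mu>) = (\<rho> * t * X) / s - ln s"
    using s by simp
  have "2 / \<rho> * (\<integral>x. (norm (Dh x))\<^sup>2 \<partial>\<mu>) \<le> 2 / \<rho> * ((\<rho> * t)\<^sup>2 / (4 * s * (t + 1)\<^sup>2) * Y)"
  proof (intro mult_left_mono)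
    have "(\<integral>x. (norm (Dh x))\<^sup>2 \<partial>\<mu>) \<le> (\<integral>x. (\<rho> * t)\<^sup>2 / (4 * s * (t + 1)\<^sup>2) * (e x * Q t x) \<partial>\<mu>)"
      by (intro integral_mono int_Dh integrable_mult_right int_e Dh2)
    then show "(\<integral>x. (norm (Dh x))\<^sup>2 \<partial>\<mu>) \<le> (\<rho> * t)\<^sup>2 / (4 * s * (t + 1)\<^sup>2) * Y"
      by (simp add: Y_def)
  qed (use \<rho> in auto)
  also have "\<dots> = (\<rho> * t * (t / (2 * (t + 1)\<^sup>2) * Y)) / s"
  proof -
    have *: "2 / \<rho> * ((\<rho> * t)\<^sup>2 / (4 * s * q) * Y) = (\<rho> * t * (t / (2 * q) * Y)) / s" if "0 < q" for q
      using that \<rho> s by (simp add: power2_eq_square field_simps)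
    show ?thesis by (rule *) (use t in simp)
  qed
  finally have "(\<rho> * t * X) / s - ln s \<le> (\<rho> * t * (t / (2 * (t + 1)\<^sup>2) * Y)) / s"
    using ls L by simp
  then have "\<rho> * t * X - \<rho> * t * (t / (2 * (t + 1)\<^sup>2) * Y) \<le> s * ln s"
    using s by (simp add: field_simps)
  moreover have "t * (\<integral>x. F' t x \<partial>\<mu>) = \<rho> * t * X - \<rho> * t * (t / (2 * (t + 1)\<^sup>2) * Y)"
  proof -
    have "F' t x = \<rho> * (e x * U t x) - (\<rho> * (t / (2 * (t + 1)\<^sup>2))) * (e x * Q t x)" for x
      by (simp add: F'_def e_def algebra_simps)
    then have *: "(\<integral>x. F' t x \<partial>\<mu>) = \<rho> * X - (\<rho> * (t / (2 * (t + 1)\<^sup>2))) * Y"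
      using int_e by (simp add: X_def Y_def)
    show ?thesis unfolding * by (simp add: algebra_simps)
  qed
  ultimately show ?thesis by (simp add: s_def)
qed

text \<open>The dual form of the transport inequality. Times 0 and 1 of the flow correspond to r = 1
  / 2 and r = 1 / 4.\<close>

lemma exp_softmin_bound:
  "integrable \<mu> (\<lambda>x. exp (\<rho> * (softmin \<epsilon> I \<phi> (1 / 4) x - M)))"
  "(\<integral>x. exp (\<rho> * (softmin \<epsilon> I \<phi> (1 / 4) x - M)) \<partial>\<mu>) \<le> 1"
proof -
  show "integrable \<mu> (\<lambda>x. exp (\<rho> * (softmin \<epsilon> I \<phi> (1 / 4) x - M)))"
    using integrable_exp_U(1)[of 1] by (simp add: U_def)
  have int_U: "integrable \<mu> (\<lambda>x. U 0 x)"
    using integrable_exp_U(2)[of 0] by simp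
  then have int_u: "integrable \<mu> (softmin \<epsilon> I \<phi> (1 / 2))"
    using Bochner_Integration.integrable_add[OF int_U integrable_const[of M]] by (simp add: U_def)
  have "\<Psi> 1 \<le> 1"
  proof (rule le_1_if_log_derivative_le)
    show "\<Psi> 0 = 1" by (simp add: \<Psi>_def)
    have "(\<integral>x. F' 0 x \<partial>\<mu>) = \<rho> * ((\<integral>x. softmin \<epsilon> I \<phi> (1 / 2) x \<partial>\<mu>) - M)"
      using int_u by (simp add: F'_def U_def)
    also have "\<dots> < 0" using initial \<rho> by (simp add: mult_less_0_iff)
    finally show "(\<integral>x. F' 0 x \<partial>\<mu>) < 0" .
  qed (use DERIV_\<Psi> \<Psi>_pos \<Psi>_log_derivative_le in auto)
  then show "(\<integral>x. exp (\<rho> * (softmin \<epsilon> I \<phi> (1 / 4) x - M)) \<partial>\<mu>) \<le> 1"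
    by (simp add: \<Psi>_def U_def)
qed

end

section \<open>Entropic optimal transport\<close>

text \<open>As \<delta> may have either sign, this gives both the Lipschitz bound in the potential
  and the rule that adding a constant to the potential subtracts it from the soft minimum.\<close>

lemma softmin_le_add:
  assumes I: "finite I" "I \<noteq> {}" and \<epsilon>: "0 < \<epsilon>" and le: "\<And>i. i \<in> I \<Longrightarrow> \<phi> i \<le> \<psi> i + \<delta>"
  shows "softmin \<epsilon> I \<psi> r x \<le> softmin \<epsilon> I \<phi> r x + \<delta>"
proof -
  have "(\<Sum>i\<in>I. gauss_weight \<epsilon> \<phi> r x i) \<le> (\<Sum>i\<in>I. exp (\<delta> / \<epsilon>) * gauss_weight \<epsilon> \<psi> r x i)"
  proof (intro sum_mono)
    fix i assume "i \<in> I"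
    then have "(\<phi> i - r * (dist x i)\<^sup>2) / \<epsilon> \<le> (\<delta> + (\<psi> i - r * (dist x i)\<^sup>2)) / \<epsilon>"
      using le[of i] \<epsilon> by (intro divide_right_mono) auto
    then show "gauss_weight \<epsilon> \<phi> r x i \<le> exp (\<delta> / \<epsilon>) * gauss_weight \<epsilon> \<psi> r x i"
      by (simp add: gauss_weight_def exp_add[symmetric] add_divide_distrib[symmetric])
  qed
  also have "\<dots> = exp (\<delta> / \<epsilon>) * (\<Sum>i\<in>I. gauss_weight \<epsilon> \<psi> r x i)"
    by (simp add: sum_distrib_left)
  finally have "ln (\<Sum>i\<in>I. gauss_weight \<epsilon> \<phi> r x i) \<le> ln (exp (\<delta> / \<epsilon>) * (\<Sum>i\<in>I. gauss_weight \<epsilon> \<psi> r x i))"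
    by (rule ln_mono[OF _ sum_gauss_weight_pos[OF I \<epsilon>]])
  also have "\<dots> = \<delta> / \<epsilon> + ln (\<Sum>i\<in>I. gauss_weight \<epsilon> \<psi> r x i)"
    using sum_gauss_weight_pos[OF I \<epsilon>, of \<psi> r x] by (simp add: ln_mult)
  finally have "\<epsilon> * ln (\<Sum>i\<in>I. gauss_weight \<epsilon> \<phi> r x i) \<le> \<epsilon> * (\<delta> / \<epsilon> + ln (\<Sum>i\<in>I. gauss_weight \<epsilon> \<psi> r x i))"
    using \<epsilon> by (intro mult_left_mono) auto
  then show ?thesis using \<epsilon> by (simp add: softmin_def distrib_left)
qed

text \<open>
  The first order condition for a maximizer of the entropic Kantorovich functional
  \<open>\<phi> \<mapsto> \<Sum>\<^sub>i m\<^sub>i \<phi>\<^sub>i + \<integral> softmin \<phi> d\<nu>\<close> says that \<open>softmin_prob\<close> is the disintegration of a coupling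
  of \<open>\<nu>\<close> and \<open>\<Sum>\<^sub>i m\<^sub>i \<delta>\<^sub>i\<close>.
\<close>

lemma optimal_potential:
  fixes \<nu> :: "'a::euclidean_space measure" and m :: "'a \<Rightarrow> real"
  assumes I: "finite I" "I \<noteq> {}" and \<epsilon>: "0 < \<epsilon>" and r: "0 \<le> r"
    and \<nu>: "prob_space \<nu>" and sets_\<nu>: "sets \<nu> = sets borel"
    and mom: "\<And>a. integrable \<nu> (\<lambda>x. (dist x a)\<^sup>2)"
    and m: "\<And>i. i \<in> I \<Longrightarrow> 0 < m i" "(\<Sum>i\<in>I. m i) = 1"
  obtains \<phi> where "\<And>\<psi>. integrable \<nu> (softmin \<epsilon> I \<psi> r)"
    and "\<And>i. i \<in> I \<Longrightarrow> (\<integral>x. softmin_prob \<epsilon> I \<phi> r x i \<partial>\<nu>) = m i"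
proof -
  interpret prob_space \<nu> by (rule \<nu>)
  note [measurable_cong] = sets_\<nu>
  have [simp]: "prob UNIV = 1" using prob_space sets_eq_imp_space_eq[OF sets_\<nu>] by simp
  note [measurable] = measurable_softmin[OF I \<epsilon>]
  obtain i0 where i0: "i0 \<in> I" using I by auto
  have int: "integrable \<nu> (softmin \<epsilon> I \<psi> r)" for \<psi>
  proof (rule Bochner_Integration.integrable_bound)
    define L where "L = \<bar>softmin \<epsilon> I \<psi> 0 i0\<bar> + \<bar>\<psi> i0\<bar>"
    show "integrable \<nu> (\<lambda>x. L + r * (dist x i0)\<^sup>2)" using mom by auto
    show "AE x in \<nu>. norm (softmin \<epsilon> I \<psi> r x) \<le> norm (L + r * (dist x i0)\<^sup>2)"
    proof (rule AE_I2)
      fix x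
      have "0 \<le> r * (dist x i0)\<^sup>2" using r by simp
      then show "norm (softmin \<epsilon> I \<psi> r x) \<le> norm (L + r * (dist x i0)\<^sup>2)"
        using softmin_le[OF I \<epsilon> i0, of \<psi> r x] softmin_mono[OF I \<epsilon> r, of \<psi> x] softmin_0[OF I \<epsilon>, of \<psi> x i0]
        unfolding L_def real_norm_def by linarith
    qed
  qed measurable
  define D where "D \<psi> = (\<Sum>i\<in>I. m i * \<psi> i) + (\<integral>x. softmin \<epsilon> I \<psi> r x \<partial>\<nu>)" for \<psi>
  define B where "B = r * (\<Sum>i\<in>I. \<integral>x. (dist x i)\<^sup>2 \<partial>\<nu>)"
  define m0 where "m0 = Min (m ` I)"
  have m0: "0 < m0" "\<And>i. i \<in> I \<Longrightarrow> m0 \<le> m i"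
    using I m(1) by (auto simp: m0_def)
  \<comment> \<open>If the maximum of \<psi> on I is 0 and some coordinate is below - K, the
    weighted sum is at most - m0 K, while \<open>softmin_le\<close> at a maximal point bounds the
    integral by B. As m0 K exceeds B + \<bar>D 0\<bar>, such a \<psi> loses to the zero
    potential.\<close>
  define K where "K = (B + \<bar>D (\<lambda>_. 0)\<bar>) / m0 + 1"
  have B0: "0 \<le> B" using r by (auto simp: B_def intro!: mult_nonneg_nonneg sum_nonneg)
  have K0: "0 \<le> K" using m0 B0 by (simp add: K_def)
  have far: "D \<psi> < D (\<lambda>_. 0)"
    if le: "\<And>i. i \<in> I \<Longrightarrow> \<psi> i \<le> 0" and j: "j \<in> I" "\<psi> j = 0" and k: "k \<in> I" "\<psi> k < - K" for \<psi> j k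
  proof -
    have "(\<Sum>i\<in>I. m i * \<psi> i) = m k * \<psi> k + (\<Sum>i\<in>I - {k}. m i * \<psi> i)"
      using I k by (simp add: sum.remove)
    also have "(\<Sum>i\<in>I - {k}. m i * \<psi> i) \<le> 0"
      using le m(1) by (intro sum_nonpos) (auto intro: mult_nonneg_nonpos less_imp_le)
    also have "m k * \<psi> k \<le> m k * (- K)"
      using m(1)[OF k(1)] k by (intro mult_left_mono) auto
    also have "m k * (- K) \<le> m0 * (- K)"
      using m0(2)[OF k(1)] K0 by (simp add: mult_right_mono)
    also have "m0 * (- K) = - B - \<bar>D (\<lambda>_. 0)\<bar> - m0"
      using m0 by (simp add: K_def field_simps)
    finally have 1: "(\<Sum>i\<in>I. m i * \<psi> i) \<le> - B - \<bar>D (\<lambda>_. 0)\<bar> - m0" by simp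
    have "(\<integral>x. softmin \<epsilon> I \<psi> r x \<partial>\<nu>) \<le> (\<integral>x. r * (dist x j)\<^sup>2 \<partial>\<nu>)"
      using softmin_le[OF I \<epsilon> j(1), of \<psi> r] j(2) mom by (intro integral_mono int) auto
    also have "\<dots> \<le> B"
      unfolding B_def using r I j by (simp, intro mult_left_mono member_le_sum) auto
    finally show ?thesis using 1 m0 unfolding D_def by linarith
  qed
  \<comment> \<open>Since the bound involves finitely many coordinates, D is continuous for the
    product topology.\<close>
  have lip: "\<bar>D \<psi> - D \<psi>'\<bar> \<le> 2 * (\<Sum>i\<in>I. \<bar>\<psi> i - \<psi>' i\<bar>)" for \<psi> \<psi>'
  proof -
    have half: "D \<psi> - D \<psi>' \<le> 2 * (\<Sum>i\<in>I. \<bar>\<psi> i - \<psi>' i\<bar>)" for \<psi> \<psi>'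
    proof -
      define \<delta> where "\<delta> = (\<Sum>i\<in>I. \<bar>\<psi> i - \<psi>' i\<bar>)"
      have \<delta>: "\<bar>\<psi> i - \<psi>' i\<bar> \<le> \<delta>" if "i \<in> I" for i
        unfolding \<delta>_def using that I by (intro member_le_sum) auto
      have "(\<Sum>i\<in>I. m i * \<psi> i) \<le> (\<Sum>i\<in>I. m i * (\<psi>' i + \<delta>))"
      proof (intro sum_mono mult_left_mono)
        fix i assume "i \<in> I"
        then show "\<psi> i \<le> \<psi>' i + \<delta>" "0 \<le> m i" using \<delta>[of i] m(1)[of i] by auto
      qed
      also have "\<dots> = (\<Sum>i\<in>I. m i * \<psi>' i) + \<delta>"
        by (simp add: distrib_left sum.distrib sum_distrib_right[symmetric] m(2))
      finally have 1: "(\<Sum>i\<in>I. m i * \<psi> i) \<le> (\<Sum>i\<in>I. m i * \<psi>' i) + \<delta>" .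
      have "softmin \<epsilon> I \<psi> r x \<le> softmin \<epsilon> I \<psi>' r x + \<delta>" for x
        by (rule softmin_le_add[OF I \<epsilon>]) (use \<delta> in fastforce)
      then have "(\<integral>x. softmin \<epsilon> I \<psi> r x \<partial>\<nu>) \<le> (\<integral>x. softmin \<epsilon> I \<psi>' r x + \<delta> \<partial>\<nu>)"
        using int by (intro integral_mono) auto
      also have "\<dots> = (\<integral>x. softmin \<epsilon> I \<psi>' r x \<partial>\<nu>) + \<delta>"
        using int sets_eq_imp_space_eq[OF sets_\<nu>] by simp
      finally show ?thesis using 1 by (simp add: D_def \<delta>_def)
    qed
    from half[of \<psi> \<psi>'] half[of \<psi>' \<psi>] show ?thesis
      by (simp add: abs_minus_commute abs_le_iff)
  qed
  \<comment> \<open>Potentials are functions on the whole space, so compactness comes from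
    Tychonoff's theorem although D depends only on the coordinates in I.\<close>
  define Box where "Box = (PiE UNIV (\<lambda>_. {- K..0}) :: ('a \<Rightarrow> real) set)"
  have "compactin (product_topology (\<lambda>_::'a. euclideanreal) UNIV) Box"
    unfolding Box_def compactin_PiE by (auto simp: compactin_euclidean_iff)
  then have comp: "compact Box"
    by (simp add: euclidean_product_topology compactin_euclidean_iff)
  have "continuous_on Box D"
    unfolding continuous_on_def
  proof
    fix \<psi> assume "\<psi> \<in> Box"
    have "((\<lambda>\<psi>'. 2 * (\<Sum>i\<in>I. \<bar>\<psi>' i - \<psi> i\<bar>)) \<longlongrightarrow> 2 * (\<Sum>i\<in>I. \<bar>\<psi> i - \<psi> i\<bar>)) (at \<psi> within Box)"
    proof (intro tendsto_intros)
      fix i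
      have "continuous_on UNIV (\<lambda>\<psi> :: 'a \<Rightarrow> real. \<psi> i)" by simp
      then show "((\<lambda>\<psi>'. \<psi>' i) \<longlongrightarrow> \<psi> i) (at \<psi> within Box)"
        by (meson UNIV_I continuous_on_def subset_UNIV tendsto_within_subset)
    qed
    then have lim0: "((\<lambda>\<psi>'. 2 * (\<Sum>i\<in>I. \<bar>\<psi>' i - \<psi> i\<bar>)) \<longlongrightarrow> 0) (at \<psi> within Box)"
      by simp
    have "((\<lambda>\<psi>'. D \<psi>' - D \<psi>) \<longlongrightarrow> 0) (at \<psi> within Box)"
    proof (rule Lim_null_comparison[OF _ lim0])
      show "\<forall>\<^sub>F \<psi>' in at \<psi> within Box. norm (D \<psi>' - D \<psi>) \<le> 2 * (\<Sum>i\<in>I. \<bar>\<psi>' i - \<psi> i\<bar>)"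
        unfolding real_norm_def by (rule always_eventually) (rule allI, rule lip)
    qed
    then show "(D \<longlongrightarrow> D \<psi>) (at \<psi> within Box)" by (simp add: LIM_zero_iff)
  qed
  moreover have zero: "(\<lambda>_. 0) \<in> Box" using K0 by (simp add: Box_def PiE_iff)
  ultimately obtain \<phi> where \<phi>: "\<phi> \<in> Box" "\<And>\<psi>. \<psi> \<in> Box \<Longrightarrow> D \<psi> \<le> D \<phi>"
    using continuous_attains_sup[OF comp] by blast
  have max: "D \<psi> \<le> D \<phi>" for \<psi>
  proof -
    \<comment> \<open>D does not change when a constant is added to \<psi>, because m sums to 1; so
      the maximum on I may be moved to 0. Resetting the potential to 0 off I keeps it in the
      box.\<close>
    define a where "a = Max (\<psi> ` I)"
    have a: "\<psi> i \<le> a" if "i \<in> I" for i using that I by (simp add: a_def)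
    have "a \<in> \<psi> ` I" unfolding a_def using I by (intro Max_in) auto
    then obtain j where j: "j \<in> I" "\<psi> j = a" by auto
    define \<psi>' where "\<psi>' i = (if i \<in> I then \<psi> i - a else 0)" for i
    have "softmin \<epsilon> I \<psi>' r x = softmin \<epsilon> I \<psi> r x + a" for x
    proof (rule antisym)
      show "softmin \<epsilon> I \<psi>' r x \<le> softmin \<epsilon> I \<psi> r x + a"
        by (rule softmin_le_add[OF I \<epsilon>]) (simp add: \<psi>'_def)
      have "softmin \<epsilon> I \<psi> r x \<le> softmin \<epsilon> I \<psi>' r x + (- a)"
        by (rule softmin_le_add[OF I \<epsilon>]) (simp add: \<psi>'_def)
      then show "softmin \<epsilon> I \<psi> r x + a \<le> softmin \<epsilon> I \<psi>' r x" by simp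
    qed
    then have "(\<integral>x. softmin \<epsilon> I \<psi>' r x \<partial>\<nu>) = (\<integral>x. softmin \<epsilon> I \<psi> r x \<partial>\<nu>) + a"
      using int sets_eq_imp_space_eq[OF sets_\<nu>] by simp
    moreover have "(\<Sum>i\<in>I. m i * \<psi>' i) = (\<Sum>i\<in>I. m i * \<psi> i) - a"
      by (simp add: \<psi>'_def right_diff_distrib sum_subtractf sum_distrib_right[symmetric] m(2))
    ultimately have eq: "D \<psi> = D \<psi>'" by (simp add: D_def)
    show ?thesis
    proof (cases "\<exists>k\<in>I. \<psi>' k < - K")
      case True
      then obtain k where k: "k \<in> I" "\<psi>' k < - K" by auto
      have "D \<psi>' < D (\<lambda>_. 0)"
        by (rule far[of \<psi>' j k]) (use a j k in \<open>auto simp: \<psi>'_def\<close>)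
      with \<phi>(2)[OF zero] eq show ?thesis by simp
    next
      case False
      then have "\<psi>' \<in> Box" using a K0 by (auto simp: Box_def \<psi>'_def not_less)
      with \<phi>(2) eq show ?thesis by simp
    qed
  qed
  have "(\<integral>x. softmin_prob \<epsilon> I \<phi> r x j \<partial>\<nu>) = m j" if j: "j \<in> I" for j
  proof -
    have "((\<lambda>s. \<integral>x. softmin \<epsilon> I (\<phi>(j := s)) r x \<partial>\<nu>) has_real_derivative
        (\<integral>x. - softmin_prob \<epsilon> I (\<phi>(j := \<phi> j)) r x j \<partial>\<nu>)) (at (\<phi> j))"
    proof (rule has_real_derivative_integral_dominated[where a="\<phi> j - 1" and b="\<phi> j + 1" and w="\<lambda>_. 1"])
      show "\<bar>- softmin_prob \<epsilon> I (\<phi>(j := s)) r x j\<bar> \<le> 1" for s x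
        using softmin_prob_pos[OF I \<epsilon>, of "\<phi>(j := s)" r x j] softmin_prob_le_1[OF I \<epsilon> j, of "\<phi>(j := s)" r x] by simp
      show "((\<lambda>s. softmin \<epsilon> I (\<phi>(j := s)) r x) has_real_derivative
          - softmin_prob \<epsilon> I (\<phi>(j := s)) r x j) (at s)" for s x
        by (rule DERIV_softmin_potential[OF I \<epsilon> j])
    qed (auto intro: int)
    moreover have "(\<Sum>i\<in>I. m i * (\<phi>(j := s)) i) = m j * s + (\<Sum>i\<in>I - {j}. m i * \<phi> i)" for s
      using I j by (simp add: sum.remove)
    ultimately have "((\<lambda>s. D (\<phi>(j := s))) has_real_derivative m j - (\<integral>x. softmin_prob \<epsilon> I \<phi> r x j \<partial>\<nu>)) (at (\<phi> j))"
      unfolding D_def by (auto intro!: derivative_eq_intros)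
    then have "m j - (\<integral>x. softmin_prob \<epsilon> I \<phi> r x j \<partial>\<nu>) = 0"
      by (rule DERIV_local_max[of _ _ _ 1]) (use max in auto)
    then show ?thesis by simp
  qed
  with int show thesis by (rule that)
qed

text \<open>The coupling draws x from \<nu>, then i with probability p i x, then y from \<mu>
  conditioned on T y = i. The factors 2 come from the triangle inequality through T y.\<close>

lemma wasserstein2_le_semidiscrete:
  fixes \<mu> \<nu> :: "'a::euclidean_space measure" and p :: "'a \<Rightarrow> 'a \<Rightarrow> real"
  assumes \<mu>: "prob_space \<mu>" "sets \<mu> = sets borel" and \<nu>: "prob_space \<nu>" "sets \<nu> = sets borel"
    and I: "finite I" and T[measurable]: "T \<in> borel_measurable borel"
    and m: "\<And>i. i \<in> I \<Longrightarrow> m i = measure \<mu> {y. T y = i}" "\<And>i. i \<in> I \<Longrightarrow> 0 < m i" "(\<Sum>i\<in>I. m i) = 1"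
    and p[measurable]: "\<And>i. p i \<in> borel_measurable borel" and p_nonneg: "\<And>i x. 0 \<le> p i x"
    and p_sum: "\<And>x. (\<Sum>i\<in>I. p i x) = 1" and p_int: "\<And>i. i \<in> I \<Longrightarrow> (\<integral>\<^sup>+x. ennreal (p i x) \<partial>\<nu>) = ennreal (m i)"
    and cost1: "(\<integral>\<^sup>+x. (\<Sum>i\<in>I. ennreal (p i x * (dist x i)\<^sup>2)) \<partial>\<nu>) \<le> ennreal c1" "0 \<le> c1"
    and cost2: "(\<integral>\<^sup>+y. ennreal ((dist y (T y))\<^sup>2) \<partial>\<mu>) \<le> ennreal c2" "0 \<le> c2"
  shows "wasserstein2 \<nu> \<mu> \<le> ereal (sqrt (2 * c1 + 2 * c2))"
proof -
  interpret M: prob_space \<mu> by fact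
  interpret N: prob_space \<nu> by fact
  interpret MN: pair_sigma_finite \<nu> \<mu> ..
  note [measurable_cong] = \<mu>(2) \<nu>(2)
  have [simp]: "space \<mu> = UNIV" "space \<nu> = UNIV"
    using sets_eq_imp_space_eq[OF \<mu>(2)] sets_eq_imp_space_eq[OF \<nu>(2)] by auto
  \<comment> \<open>The density of this coupling with respect to
    \<open>\<nu> \<Otimes>\<^sub>M \<mu>\<close>; m i is the probability of the fibre over i, so
    dividing by it is the conditioning.\<close>
  define k where "k x y = (\<Sum>i\<in>I. indicator {y. T y = i} y * ennreal (p i x / m i))" for x y
  have [measurable]: "{y. T y = i} \<in> sets borel" for i
    using measurable_sets[OF T, of "{i}"] by (simp add: vimage_def)
  have k_meas[measurable]: "(\<lambda>(x, y). k x y) \<in> borel_measurable (borel \<Otimes>\<^sub>M borel)"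
    unfolding k_def by measurable
  define P where "P = density (\<nu> \<Otimes>\<^sub>M \<mu>) (\<lambda>(x, y). k x y)"
  \<comment> \<open>T may take values outside I; they have probability 0 because m sums to 1 over
    I.\<close>
  have AE_I: "AE y in \<mu>. T y \<in> I"
  proof -
    have "measure \<mu> (\<Union>i\<in>I. {y. T y = i}) = (\<Sum>i\<in>I. measure \<mu> {y. T y = i})"
      using I by (intro M.finite_measure_finite_Union) (auto simp: disjoint_family_on_def)
    also have "\<dots> = 1" using m by simp
    finally have "AE y in \<mu>. y \<in> (\<Union>i\<in>I. {y. T y = i})"
      using I by (subst (asm) M.prob_eq_1) auto
    then show ?thesis by simp
  qed
  have k_fst: "(\<integral>\<^sup>+y. k x y * G (T y) \<partial>\<mu>) = (\<Sum>i\<in>I. ennreal (p i x) * G i)" for x and G :: "'a \<Rightarrow> ennreal"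
  proof -
    have "(\<integral>\<^sup>+y. k x y * G (T y) \<partial>\<mu>) = (\<integral>\<^sup>+y. (\<Sum>i\<in>I. (ennreal (p i x / m i) * G i) * indicator {y. T y = i} y) \<partial>\<mu>)"
      by (intro nn_integral_cong) (auto simp: k_def sum_distrib_right indicator_def intro!: sum.cong)
    also have "\<dots> = (\<Sum>i\<in>I. (ennreal (p i x / m i) * G i) * emeasure \<mu> {y. T y = i})"
      by (subst nn_integral_sum) (auto simp: nn_integral_cmult_indicator)
    also have "\<dots> = (\<Sum>i\<in>I. ennreal (p i x) * G i)"
    proof (intro sum.cong refl)
      fix i assume i: "i \<in> I"
      have "ennreal (p i x / m i) * emeasure \<mu> {y. T y = i} = ennreal (p i x)"
        using m(1,2)[OF i] p_nonneg[of i x]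
        by (simp add: M.emeasure_eq_measure ennreal_mult[symmetric])
      then show "(ennreal (p i x / m i) * G i) * emeasure \<mu> {y. T y = i} = ennreal (p i x) * G i"
        by (metis mult.assoc mult.commute)
    qed
    finally show ?thesis .
  qed
  have k_snd: "(\<integral>\<^sup>+x. k x y \<partial>\<nu>) = indicator I (T y)" for y
  proof -
    have "(\<integral>\<^sup>+x. k x y \<partial>\<nu>) = (\<Sum>i\<in>I. indicator {y. T y = i} y * (\<integral>\<^sup>+x. ennreal (p i x / m i) \<partial>\<nu>))"
      unfolding k_def by (subst nn_integral_sum) (auto simp: nn_integral_cmult)
    also have "\<dots> = (\<Sum>i\<in>I. if T y = i then 1 else 0)"
    proof (intro sum.cong refl)
      fix i assume i: "i \<in> I"
      have "(\<integral>\<^sup>+x. ennreal (p i x / m i) \<partial>\<nu>) = (\<integral>\<^sup>+x. ennreal (1 / m i) * ennreal (p i x) \<partial>\<nu>)"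
        using m(2)[OF i] p_nonneg by (intro nn_integral_cong) (simp add: ennreal_mult[symmetric])
      also have "\<dots> = ennreal (1 / m i) * ennreal (m i)"
        by (subst nn_integral_cmult) (auto simp: p_int[OF i])
      also have "\<dots> = 1" using m(2)[OF i] by (simp add: ennreal_mult[symmetric])
      finally show "indicator {y. T y = i} y * (\<integral>\<^sup>+x. ennreal (p i x / m i) \<partial>\<nu>) = (if T y = i then 1 else 0)"
        by simp
    qed
    also have "\<dots> = indicator I (T y)" using I by (simp add: indicator_def)
    finally show ?thesis .
  qed
  have int_P: "(\<integral>\<^sup>+z. G z \<partial>P) = (\<integral>\<^sup>+x. \<integral>\<^sup>+y. k x y * G (x, y) \<partial>\<mu> \<partial>\<nu>)"
    if [measurable]: "G \<in> borel_measurable (borel \<Otimes>\<^sub>M borel)" for G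
    unfolding P_def
    by (subst nn_integral_density) (auto simp: M.nn_integral_fst[symmetric] split_beta')
  have int_P': "(\<integral>\<^sup>+z. G z \<partial>P) = (\<integral>\<^sup>+y. \<integral>\<^sup>+x. k x y * G (x, y) \<partial>\<nu> \<partial>\<mu>)"
    if [measurable]: "G \<in> borel_measurable (borel \<Otimes>\<^sub>M borel)" for G
    unfolding int_P[OF that] by (rule MN.Fubini'[symmetric]) measurable
  have sets_P[measurable_cong]: "sets P = sets (borel \<Otimes>\<^sub>M borel)"
    unfolding P_def by (simp cong: sets_pair_measure_cong add: \<mu>(2) \<nu>(2))
  have P_fst: "distr P borel fst = \<nu>"
  proof (rule measure_eqI)
    fix A assume "A \<in> sets (distr P borel fst)"
    then have [measurable]: "A \<in> sets borel" by simp
    have "emeasure (distr P borel fst) A = (\<integral>\<^sup>+x. indicator A x \<partial>distr P borel fst)"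
      by simp
    also have "\<dots> = (\<integral>\<^sup>+z. indicator A (fst z) \<partial>P)"
      by (rule nn_integral_distr) measurable
    also have "\<dots> = (\<integral>\<^sup>+x. \<integral>\<^sup>+y. k x y * indicator A x \<partial>\<mu> \<partial>\<nu>)"
      by (subst int_P) auto
    also have "\<dots> = (\<integral>\<^sup>+x. indicator A x \<partial>\<nu>)"
    proof (intro nn_integral_cong)
      fix x
      have "(\<integral>\<^sup>+y. k x y * indicator A x \<partial>\<mu>) = (\<Sum>i\<in>I. ennreal (p i x)) * indicator A x"
        using k_fst[of x "\<lambda>_. indicator A x"] by (simp add: sum_distrib_right)
      also have "(\<Sum>i\<in>I. ennreal (p i x)) = 1"
        using p_nonneg p_sum[of x] by (subst sum_ennreal) auto
      finally show "(\<integral>\<^sup>+y. k x y * indicator A x \<partial>\<mu>) = indicator A x" by simp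
    qed
    finally show "emeasure (distr P borel fst) A = emeasure \<nu> A" by simp
  qed (simp add: \<nu>(2))
  have P_snd: "distr P borel snd = \<mu>"
  proof (rule measure_eqI)
    fix A assume "A \<in> sets (distr P borel snd)"
    then have [measurable]: "A \<in> sets borel" by simp
    have "emeasure (distr P borel snd) A = (\<integral>\<^sup>+x. indicator A x \<partial>distr P borel snd)"
      by simp
    also have "\<dots> = (\<integral>\<^sup>+z. indicator A (snd z) \<partial>P)"
      by (rule nn_integral_distr) measurable
    also have "\<dots> = (\<integral>\<^sup>+y. \<integral>\<^sup>+x. k x y * indicator A y \<partial>\<nu> \<partial>\<mu>)"
      by (subst int_P') auto
    also have "\<dots> = (\<integral>\<^sup>+y. indicator I (T y) * indicator A y \<partial>\<mu>)"
      by (intro nn_integral_cong) (subst nn_integral_multc, auto simp: k_snd)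
    also have "\<dots> = (\<integral>\<^sup>+y. indicator A y \<partial>\<mu>)"
      using AE_I by (intro nn_integral_cong_AE) (auto simp: indicator_def)
    finally show "emeasure (distr P borel snd) A = emeasure \<mu> A" by simp
  qed (simp add: \<mu>(2))
  have "prob_space P"
  proof
    have "emeasure P (space P) = emeasure (distr P borel fst) UNIV"
      by (subst emeasure_distr) auto
    also have "\<dots> = 1" using N.emeasure_space_1 by (simp add: P_fst)
    finally show "emeasure P (space P) = 1" .
  qed
  have le: "ennreal ((dist x y)\<^sup>2) \<le> 2 * ennreal ((dist x (T y))\<^sup>2) + 2 * ennreal ((dist y (T y))\<^sup>2)" for x y
  proof -
    have "(dist x y)\<^sup>2 \<le> (dist x (T y) + dist y (T y))\<^sup>2"
      by (intro power_mono dist_triangle2) auto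
    also have "\<dots> \<le> 2 * (dist x (T y))\<^sup>2 + 2 * (dist y (T y))\<^sup>2"
      using sum_squares_bound[of "dist x (T y)" "dist y (T y)"] by (simp add: power2_sum)
    finally have "ennreal ((dist x y)\<^sup>2) \<le> ennreal (2 * (dist x (T y))\<^sup>2 + 2 * (dist y (T y))\<^sup>2)"
      by (rule ennreal_leI)
    also have "\<dots> = 2 * ennreal ((dist x (T y))\<^sup>2) + 2 * ennreal ((dist y (T y))\<^sup>2)"
      by (simp add: ennreal_plus ennreal_mult)
    finally show ?thesis .
  qed
  have "(\<integral>\<^sup>+z. ennreal ((dist (fst z) (snd z))\<^sup>2) \<partial>P)
      \<le> (\<integral>\<^sup>+z. 2 * ennreal ((dist (fst z) (T (snd z)))\<^sup>2) + 2 * ennreal ((dist (snd z) (T (snd z)))\<^sup>2) \<partial>P)"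
    by (intro nn_integral_mono le)
  also have "\<dots> = 2 * (\<integral>\<^sup>+z. ennreal ((dist (fst z) (T (snd z)))\<^sup>2) \<partial>P) + 2 * (\<integral>\<^sup>+z. ennreal ((dist (snd z) (T (snd z)))\<^sup>2) \<partial>P)"
    by (subst nn_integral_add) (auto simp: nn_integral_cmult)
  also have "(\<integral>\<^sup>+z. ennreal ((dist (fst z) (T (snd z)))\<^sup>2) \<partial>P)
      = (\<integral>\<^sup>+x. \<integral>\<^sup>+y. k x y * ennreal ((dist x (T y))\<^sup>2) \<partial>\<mu> \<partial>\<nu>)"
    by (subst int_P) auto
  also have "\<dots> = (\<integral>\<^sup>+x. (\<Sum>i\<in>I. ennreal (p i x * (dist x i)\<^sup>2)) \<partial>\<nu>)"
  proof (intro nn_integral_cong)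
    fix x
    show "(\<integral>\<^sup>+y. k x y * ennreal ((dist x (T y))\<^sup>2) \<partial>\<mu>) = (\<Sum>i\<in>I. ennreal (p i x * (dist x i)\<^sup>2))"
      using k_fst[of x "\<lambda>i. ennreal ((dist x i)\<^sup>2)"] p_nonneg by (simp add: ennreal_mult)
  qed
  also have "(\<integral>\<^sup>+z. ennreal ((dist (snd z) (T (snd z)))\<^sup>2) \<partial>P)
      = (\<integral>\<^sup>+y. \<integral>\<^sup>+x. k x y * ennreal ((dist y (T y))\<^sup>2) \<partial>\<nu> \<partial>\<mu>)"
    by (subst int_P') auto
  also have "\<dots> = (\<integral>\<^sup>+y. indicator I (T y) * ennreal ((dist y (T y))\<^sup>2) \<partial>\<mu>)"
    by (intro nn_integral_cong) (subst nn_integral_multc, auto simp: k_snd)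
  also have "\<dots> = (\<integral>\<^sup>+y. ennreal ((dist y (T y))\<^sup>2) \<partial>\<mu>)"
    using AE_I by (intro nn_integral_cong_AE) (auto simp: indicator_def)
  also have "2 * (\<integral>\<^sup>+x. (\<Sum>i\<in>I. ennreal (p i x * (dist x i)\<^sup>2)) \<partial>\<nu>) + 2 * (\<integral>\<^sup>+y. ennreal ((dist y (T y))\<^sup>2) \<partial>\<mu>)
      \<le> 2 * ennreal c1 + 2 * ennreal c2"
    by (intro add_mono mult_left_mono cost1 cost2) auto
  also have "\<dots> = ennreal (2 * c1 + 2 * c2)"
    using cost1(2) cost2(2) by (simp add: ennreal_plus ennreal_mult)
  finally have cost: "(\<integral>\<^sup>+z. ennreal ((dist (fst z) (snd z))\<^sup>2) \<partial>P) \<le> ennreal (2 * c1 + 2 * c2)" .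
  obtain v where v: "(\<integral>\<^sup>+z. ennreal ((dist (fst z) (snd z))\<^sup>2) \<partial>P) = ennreal v" "0 \<le> v"
    using cost by (cases "\<integral>\<^sup>+z. ennreal ((dist (fst z) (snd z))\<^sup>2) \<partial>P") (auto simp: top_unique)
  have "v \<le> 2 * c1 + 2 * c2"
    using cost cost1(2) cost2(2) unfolding v(1) by (subst (asm) ennreal_le_iff) auto
  have "wasserstein2 \<nu> \<mu> \<le> ereal_sqrt (enn2ereal (\<integral>\<^sup>+z. ennreal ((dist (fst z) (snd z))\<^sup>2) \<partial>P))"
    by (rule wasserstein2_le[OF \<open>prob_space P\<close> _ _ P_fst P_snd]) measurable
  also have "\<dots> = ereal (sqrt v)"
    using v by (simp add: ereal_sqrt_def enn2ereal_ennreal)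
  also have "\<dots> \<le> ereal (sqrt (2 * c1 + 2 * c2))"
    using \<open>v \<le> 2 * c1 + 2 * c2\<close> by simp
  finally show ?thesis .
qed

section \<open>The transport inequality\<close>

text \<open>Young's inequality for the conjugate functions t ln t - t and exp; at t = 0 it reads 0
  \<le> exp g.\<close>

lemma mult_le_entropy_plus_exp:
  fixes t g :: real
  assumes "0 \<le> t"
  shows "t * g \<le> t * ln t - t + exp g"
proof (cases "t = 0")
  case False
  with assms have t: "0 < t" by simp
  have "1 + (g - ln t) \<le> exp (g - ln t)" by (rule exp_ge_add_one_self)
  then have "t * (1 + (g - ln t)) \<le> t * exp (g - ln t)"
    using t by (intro mult_left_mono) auto
  also have "t * exp (g - ln t) = exp g" using t by (simp add: exp_diff)
  finally show ?thesis by (simp add: algebra_simps)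
qed simp

text \<open>The negative part of f ln f is at most 1, so a finite \<open>kullback\<close> forces the
  positive part to be integrable.\<close>

lemma kullback_eq_ereal:
  assumes M: "prob_space M" and f: "prob_density M f" and fin: "kullback M f \<noteq> \<infinity>"
  shows "integrable M (\<lambda>x. f x * ln (f x))"
    and "kullback M f = ereal (\<integral>x. f x * ln (f x) \<partial>M)"
proof -
  interpret prob_space M by fact
  have [measurable]: "f \<in> borel_measurable M" and f0: "\<And>x. 0 \<le> f x"
    using f by (auto simp: prob_density_def)
  have "(\<integral>\<^sup>+x. ennreal (- (f x * ln (f x))) \<partial>M) \<le> (\<integral>\<^sup>+x. 1 \<partial>M)"
  proof (intro nn_integral_mono)
    fix x
    have "- (f x * ln (f x)) \<le> 1"
      using entropy_integrand_nonneg[OF f0, of x] f0[of x] by linarith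
    then show "ennreal (- (f x * ln (f x))) \<le> 1" by (metis ennreal_1 ennreal_leI)
  qed
  then have neg: "(\<integral>\<^sup>+x. ennreal (- (f x * ln (f x))) \<partial>M) < \<infinity>"
    by (simp add: emeasure_space_1 le_less_trans)
  have pos: "(\<integral>\<^sup>+x. ennreal (f x * ln (f x)) \<partial>M) \<noteq> \<infinity>"
  proof
    assume "(\<integral>\<^sup>+x. ennreal (f x * ln (f x)) \<partial>M) = \<infinity>"
    with fin neg show False
      by (cases "\<integral>\<^sup>+x. ennreal (- (f x * ln (f x))) \<partial>M") (auto simp: kullback_def)
  qed
  show int: "integrable M (\<lambda>x. f x * ln (f x))"
    using pos neg by (auto simp: real_integrable_def)
  show "kullback M f = ereal (\<integral>x. f x * ln (f x) \<partial>M)"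
    using pos neg
    by (cases "\<integral>\<^sup>+x. ennreal (f x * ln (f x)) \<partial>M"; cases "\<integral>\<^sup>+x. ennreal (- (f x * ln (f x))) \<partial>M")
      (auto simp: kullback_def real_lebesgue_integral_def[OF int])
qed

context prob_space
begin

lemma prob_density_integral:
  assumes "prob_density M f"
  shows "integrable M f" "(\<integral>x. f x \<partial>M) = 1"
proof -
  have [measurable]: "f \<in> borel_measurable M" and f0: "\<And>x. 0 \<le> f x" and f1: "(\<integral>\<^sup>+x. ennreal (f x) \<partial>M) = 1"
    using assms by (auto simp: prob_density_def)
  show "integrable M f" using f0 f1 by (intro integrableI_bounded) auto
  show "(\<integral>x. f x \<partial>M) = 1" using f0 f1 by (subst integral_eq_nn_integral) auto
qed

text \<open>Young's inequality provides the majorant. With g = \<theta> d^2 this gives the second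
  moment of the measure with density f.\<close>

lemma integrable_mult_prob_density:
  assumes f: "prob_density M f" and int: "integrable M (\<lambda>x. f x * ln (f x))"
    and g: "g \<in> borel_measurable M" "\<And>x. 0 \<le> g x" "integrable M (\<lambda>x. exp (g x))"
  shows "integrable M (\<lambda>x. f x * g x)"
proof (rule Bochner_Integration.integrable_bound)
  show "integrable M (\<lambda>x. f x * ln (f x) - f x + exp (g x))"
    using prob_density_integral[OF f] int g(3) by auto
  show "AE x in M. norm (f x * g x) \<le> norm (f x * ln (f x) - f x + exp (g x))"
  proof (rule AE_I2)
    fix x
    have "0 \<le> f x * g x" using f g(2) by (simp add: prob_density_def)
    moreover have "f x * g x \<le> f x * ln (f x) - f x + exp (g x)"
      using f by (intro mult_le_entropy_plus_exp) (simp add: prob_density_def)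
    ultimately show "norm (f x * g x) \<le> norm (f x * ln (f x) - f x + exp (g x))"
      unfolding real_norm_def by linarith
  qed
qed (use f g(1) in \<open>auto simp: prob_density_def\<close>)

text \<open>One half of the variational formula for entropy: integrated, Young's inequality gives
  the entropy minus 1 plus the exponential integral.\<close>

lemma integral_le_entropy:
  assumes f: "prob_density M f" and int: "integrable M (\<lambda>x. f x * ln (f x))"
    and g: "integrable M (\<lambda>x. f x * g x)" "integrable M (\<lambda>x. exp (g x))" "(\<integral>x. exp (g x) \<partial>M) \<le> 1"
  shows "(\<integral>x. f x * g x \<partial>M) \<le> (\<integral>x. f x * ln (f x) \<partial>M)"
proof -
  have "(\<integral>x. f x * g x \<partial>M) \<le> (\<integral>x. f x * ln (f x) - f x + exp (g x) \<partial>M)"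
    using prob_density_integral[OF f] int g f
    by (intro integral_mono) (auto simp: prob_density_def intro: mult_le_entropy_plus_exp)
  also have "\<dots> = (\<integral>x. f x * ln (f x) \<partial>M) - 1 + (\<integral>x. exp (g x) \<partial>M)"
    using prob_density_integral[OF f] int g(2) by simp
  finally show ?thesis using g(3) by simp
qed

end

section \<open>Discretization and assembly of the transport inequality\<close>

context lyapunov_measure
begin

lemma integrable_dist_square: "integrable \<mu> (\<lambda>x. (dist x x0)\<^sup>2)"
proof (rule Bochner_Integration.integrable_bound[OF integrable_mult_right[OF integrable_exp_dist_square, of "1 / sqrt (c / 2)"]])
  show "AE x in \<mu>. norm ((dist x x0)\<^sup>2) \<le> norm (1 / sqrt (c / 2) * exp (sqrt (c / 2) * (dist x x0)\<^sup>2))"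
  proof (rule AE_I2)
    fix x
    have "sqrt (c / 2) * (dist x x0)\<^sup>2 \<le> exp (sqrt (c / 2) * (dist x x0)\<^sup>2)"
      using exp_ge_add_one_self[of "sqrt (c / 2) * (dist x x0)\<^sup>2"] by linarith
    then show "norm ((dist x x0)\<^sup>2) \<le> norm (1 / sqrt (c / 2) * exp (sqrt (c / 2) * (dist x x0)\<^sup>2))"
      using c_pos by (simp add: pos_le_divide_eq mult.commute)
  qed
qed simp

text \<open>The bound of d(T x, x0) by 2 d(x, x0) keeps the constant A of the growth constraint
  independent of T; it also gives the majorant 9 d^2 for dominated convergence.\<close>

lemma simple_approximation:
  assumes "0 < e"
  obtains T where "T \<in> borel_measurable borel" "finite (range T)"
    "\<And>x. dist (T x) x0 \<le> 2 * dist x x0"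
    "integrable \<mu> (\<lambda>x. (dist x (T x))\<^sup>2)" "(\<integral>x. (dist x (T x))\<^sup>2 \<partial>\<mu>) < e"
proof -
  obtain F where F: "\<And>i. simple_function \<mu> (F i)" "\<And>x. (\<lambda>i. F i x) \<longlonglongrightarrow> x"
    "\<And>i x. dist (F i x) x0 \<le> 2 * dist x x0"
    using borel_measurable_implies_sequence_metric[of "\<lambda>x. x" \<mu> x0] by (auto cong: measurable_cong_sets)
  have [measurable]: "F i \<in> borel_measurable \<mu>" for i
    using F(1) by (rule borel_measurable_simple_function)
  have int9: "integrable \<mu> (\<lambda>x. 9 * (dist x x0)\<^sup>2)" using integrable_dist_square by simp
  have bound: "norm ((dist x (F i x))\<^sup>2) \<le> 9 * (dist x x0)\<^sup>2" for i x
  proof -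
    have "dist x (F i x) \<le> 3 * dist x x0"
      using dist_triangle2[of x "F i x" x0] F(3)[of i x] by simp
    then have "(dist x (F i x))\<^sup>2 \<le> (3 * dist x x0)\<^sup>2" by (intro power_mono) auto
    then show ?thesis by (simp add: power_mult_distrib)
  qed
  have "(\<lambda>i. \<integral>x. (dist x (F i x))\<^sup>2 \<partial>\<mu>) \<longlonglongrightarrow> (\<integral>x. 0 \<partial>\<mu>)"
  proof (rule integral_dominated_convergence[OF _ _ int9])
    show "AE x in \<mu>. (\<lambda>i. (dist x (F i x))\<^sup>2) \<longlonglongrightarrow> 0"
    proof (rule AE_I2)
      fix x
      have "(\<lambda>i. (dist x (F i x))\<^sup>2) \<longlonglongrightarrow> (dist x x)\<^sup>2"
        by (intro tendsto_intros F(2))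
      then show "(\<lambda>i. (dist x (F i x))\<^sup>2) \<longlonglongrightarrow> 0" by simp
    qed
  qed (use bound in auto)
  then have "\<forall>\<^sub>F i in sequentially. (\<integral>x. (dist x (F i x))\<^sup>2 \<partial>\<mu>) < e"
    using assms by (intro order_tendstoD(2)) auto
  then obtain i where i: "(\<integral>x. (dist x (F i x))\<^sup>2 \<partial>\<mu>) < e"
    by (auto dest: eventually_happens)
  show thesis
  proof (rule that[of "F i"])
    show "F i \<in> borel_measurable borel" by measurable
    show "finite (range (F i))" using F(1)[of i] by (simp add: simple_function_def)
    show "integrable \<mu> (\<lambda>x. (dist x (F i x))\<^sup>2)"
      by (rule Bochner_Integration.integrable_bound[OF int9]) (use bound in auto)
  qed (use F(3) i in auto)
qed

lemma talagrand_inequality: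
  "\<exists>K>0. \<forall>f. prob_density \<mu> f \<longrightarrow>
    wasserstein2 (density \<mu> (\<lambda>x. ennreal (f x))) \<mu> \<le> ereal_sqrt (ereal K * kullback \<mu> f)"
proof -
  define m2 where "m2 = (\<integral>x. (dist x x0)\<^sup>2 \<partial>\<mu>)"
  \<comment> \<open>From d(x, T y)^2 / 2 \<le> d(x, x0)^2 + 4 d(y, x0)^2, integrated in y.\<close>
  define A where "A = 4 * m2"
  have A: "0 \<le> A" by (simp add: A_def m2_def)
  obtain C where C: "0 < C" and lsi: "\<And>h Dh \<eta>. C1_grad h Dh \<Longrightarrow> (\<And>x. 0 \<le> h x) \<Longrightarrow>
      integrable \<mu> (\<lambda>x. (h x)\<^sup>2) \<Longrightarrow> integrable \<mu> (\<lambda>x. (norm (Dh x))\<^sup>2) \<Longrightarrow> (\<integral>x. (h x)\<^sup>2 \<partial>\<mu>) = 1 \<Longrightarrow>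
      0 \<le> \<eta> \<Longrightarrow> \<eta> \<le> 1 \<Longrightarrow> (\<And>x. (h x)\<^sup>2 \<le> exp (A + \<eta> * (dist x x0)\<^sup>2)) \<Longrightarrow>
      (\<integral>x. (h x)\<^sup>2 * ln ((h x)\<^sup>2) \<partial>\<mu>) \<le> C * (\<integral>x. (norm (Dh x))\<^sup>2 \<partial>\<mu>)"
    using restricted_log_sobolev[OF A] by blast
  define \<theta> where "\<theta> = sqrt (c / 2)"
  have \<theta>: "0 < \<theta>" using c_pos by (simp add: \<theta>_def)
  have exp_\<theta>: "integrable \<mu> (\<lambda>x. exp (\<theta> * (dist x x0)\<^sup>2))"
    unfolding \<theta>_def by (rule integrable_exp_dist_square)
  \<comment> \<open>Three demands: \<eta> = \<rho> \<le> 1 in the growth constraint, C \<le> 2 /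
    \<rho>, and a finite moment of exponent 2 \<rho> \<le> \<theta>.\<close>
  define \<rho> where "\<rho> = min 1 (min (2 / C) (\<theta> / 2))"
  have \<rho>: "0 < \<rho>" "\<rho> \<le> 1" "\<rho> \<le> 2 / C" "2 * \<rho> \<le> \<theta>"
    using C \<theta> by (auto simp: \<rho>_def)
  have C_le: "C \<le> 2 / \<rho>" using \<rho>(1,3) C by (simp add: field_simps)
  have exp_\<rho>: "integrable \<mu> (\<lambda>x. exp (2 * \<rho> * (dist x x0)\<^sup>2))"
    by (rule Bochner_Integration.integrable_bound[OF exp_\<theta>]) (use \<rho>(4) in \<open>auto intro!: mult_right_mono\<close>)
  \<comment> \<open>With H the entropy, this is 2 c1 + 2 e where the discrete cost c1 is at most 4
    (H / \<rho> + 2 e).\<close>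
  have main: "wasserstein2 (density \<mu> (\<lambda>x. ennreal (f x))) \<mu>
      \<le> ereal (sqrt (8 / \<rho> * (\<integral>x. f x * ln (f x) \<partial>\<mu>) + 18 * e))"
    if f: "prob_density \<mu> f" and ent: "integrable \<mu> (\<lambda>x. f x * ln (f x))" and e: "0 < e" for f e
  proof -
    define \<nu> where "\<nu> = density \<mu> (\<lambda>x. ennreal (f x))"
    have [measurable]: "f \<in> borel_measurable \<mu>" and f0: "\<And>x. 0 \<le> f x" and f1: "(\<integral>\<^sup>+x. ennreal (f x) \<partial>\<mu>) = 1"
      using f by (auto simp: prob_density_def)
    have sets_\<nu>[measurable_cong]: "sets \<nu> = sets borel" by (simp add: \<nu>_def)
    have prob_\<nu>: "prob_space \<nu>"
      by (rule prob_spaceI) (simp add: \<nu>_def emeasure_density f1)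
    have int_\<nu>: "integrable \<nu> g \<longleftrightarrow> integrable \<mu> (\<lambda>x. f x * g x)"
      and integral_\<nu>: "(\<integral>x. g x \<partial>\<nu>) = (\<integral>x. f x * g x \<partial>\<mu>)"
      if "g \<in> borel_measurable borel" for g :: "'a \<Rightarrow> real"
    proof -
      have [measurable]: "g \<in> borel_measurable \<mu>" using that by (simp cong: measurable_cong_sets)
      show "integrable \<nu> g \<longleftrightarrow> integrable \<mu> (\<lambda>x. f x * g x)"
        unfolding \<nu>_def using f0 by (subst integrable_real_density) auto
      show "(\<integral>x. g x \<partial>\<nu>) = (\<integral>x. f x * g x \<partial>\<mu>)"
        unfolding \<nu>_def using f0 by (subst integral_real_density) auto
    qed
    have "integrable \<mu> (\<lambda>x. f x * (\<theta> * (dist x x0)\<^sup>2))"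
      by (rule integrable_mult_prob_density[OF f ent _ _ exp_\<theta>]) (use \<theta> in auto)
    then have "integrable \<mu> (\<lambda>x. (1 / \<theta>) * (f x * (\<theta> * (dist x x0)\<^sup>2)))"
      by (rule integrable_mult_right)
    then have "integrable \<mu> (\<lambda>x. f x * (dist x x0)\<^sup>2)" using \<theta> by simp
    then have mom0: "integrable \<nu> (\<lambda>x. (dist x x0)\<^sup>2)" by (subst int_\<nu>) auto
    interpret N: prob_space \<nu> by (rule prob_\<nu>)
    have mom: "integrable \<nu> (\<lambda>x. (dist x a)\<^sup>2)" for a
    proof (rule Bochner_Integration.integrable_bound)
      show "integrable \<nu> (\<lambda>x. 2 * (dist x x0)\<^sup>2 + 2 * (dist a x0)\<^sup>2)" using mom0 by auto
      have "(dist x a)\<^sup>2 \<le> 2 * (dist x x0)\<^sup>2 + 2 * (dist a x0)\<^sup>2" for x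
      proof -
        have "(dist x a)\<^sup>2 \<le> (dist x x0 + dist a x0)\<^sup>2" by (intro power_mono dist_triangle2) auto
        then show ?thesis using sum_squares_bound[of "dist x x0" "dist a x0"] by (simp add: power2_sum)
      qed
      then show "AE x in \<nu>. norm ((dist x a)\<^sup>2) \<le> norm (2 * (dist x x0)\<^sup>2 + 2 * (dist a x0)\<^sup>2)" by simp
    qed measurable
    obtain T where T[measurable]: "T \<in> borel_measurable borel" and T_fin: "finite (range T)"
      and T_le: "\<And>x. dist (T x) x0 \<le> 2 * dist x x0"
      and T_int: "integrable \<mu> (\<lambda>x. (dist x (T x))\<^sup>2)" and T_e: "(\<integral>x. (dist x (T x))\<^sup>2 \<partial>\<mu>) < e"
      by (rule simple_approximation[OF e]) blast
    have T_sets[measurable]: "{y. T y = i} \<in> sets borel" for i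
      using measurable_sets[OF T, of "{i}"] by (simp add: vimage_def)
    define m where "m i = prob {y. T y = i}" for i
    \<comment> \<open>Values of probability 0 are discarded because \<open>optimal_potential\<close>
      needs positive weights.\<close>
    define I where "I = {i \<in> range T. 0 < m i}"
    have I_fin: "finite I" using T_fin by (simp add: I_def)
    have AE_I: "AE y in \<mu>. T y \<in> I"
    proof -
      have "AE y in \<mu>. \<forall>i\<in>range T - I. T y \<noteq> i"
      proof (subst AE_finite_all)
        show "\<forall>i\<in>range T - I. AE y in \<mu>. T y \<noteq> i"
        proof
          fix i assume "i \<in> range T - I"
          then have "m i = 0" using measure_nonneg[of \<mu> "{y. T y = i}"] by (auto simp: I_def m_def less_le)
          then have "emeasure \<mu> {y. T y = i} = 0" by (simp add: m_def emeasure_eq_measure)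
          then show "AE y in \<mu>. T y \<noteq> i" by (subst AE_iff_measurable[OF _ refl]) auto
        qed
      qed (use T_fin in simp)
      then show ?thesis by eventually_elim auto
    qed
    have push: "integrable \<mu> (\<lambda>y. G (T y))" "(\<integral>y. G (T y) \<partial>\<mu>) = (\<Sum>i\<in>I. m i * G i)" for G :: "'a \<Rightarrow> real"
    proof -
      have meas: "(\<lambda>y. G (T y)) \<in> borel_measurable \<mu>"
        by (rule borel_measurable_simple_function, rule simple_function_compose1[of _ T G])
          (use T_fin in \<open>auto simp: simple_function_def vimage_def\<close>)
      have ae: "AE y in \<mu>. (\<Sum>i\<in>I. indicator {y. T y = i} y * G i) = G (T y)"
        using AE_I by eventually_elim (simp add: I_fin indicator_def if_distrib[of "\<lambda>z. z * _"] cong: if_cong)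
      have int: "integrable \<mu> (\<lambda>y. \<Sum>i\<in>I. indicator {y. T y = i} y * G i)"
        by (intro Bochner_Integration.integrable_sum integrable_mult_left integrable_real_indicator) (auto simp: emeasure_eq_measure)
      show "integrable \<mu> (\<lambda>y. G (T y))"
        using integrable_cong_AE_imp[OF int meas] ae by auto
      have "(\<integral>y. G (T y) \<partial>\<mu>) = (\<integral>y. (\<Sum>i\<in>I. indicator {y. T y = i} y * G i) \<partial>\<mu>)"
        using ae by (intro integral_cong_AE) (auto simp: meas)
      also have "\<dots> = (\<Sum>i\<in>I. \<integral>y. indicator {y. T y = i} y * G i \<partial>\<mu>)"
        by (intro Bochner_Integration.integral_sum integrable_mult_left integrable_real_indicator) (auto simp: emeasure_eq_measure)
      finally show "(\<integral>y. G (T y) \<partial>\<mu>) = (\<Sum>i\<in>I. m i * G i)" by (simp add: m_def)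
    qed
    have m_sum: "(\<Sum>i\<in>I. m i) = 1" using push(2)[of "\<lambda>_. 1"] by simp
    have m_pos: "0 < m i" if "i \<in> I" for i using that by (simp add: I_def)
    have I_ne: "I \<noteq> {}" using m_sum by auto
    \<comment> \<open>The entropic error in \<open>softmin_prob_transport_cost\<close> becomes e,
      whatever the size of I.\<close>
    define \<epsilon> where "\<epsilon> = e / card I"
    have \<epsilon>: "0 < \<epsilon>" "\<epsilon> * card I = e" using e I_fin I_ne by (auto simp: \<epsilon>_def card_gt_0_iff)
    note I = I_fin I_ne
    note [measurable] = measurable_softmin[OF I \<epsilon>(1)]
    obtain \<phi> where u_int: "\<And>\<psi>. integrable \<nu> (softmin \<epsilon> I \<psi> (1 / 4))"
      and \<phi>: "\<And>i. i \<in> I \<Longrightarrow> (\<integral>x. softmin_prob \<epsilon> I \<phi> (1 / 4) x i \<partial>\<nu>) = m i"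
      using optimal_potential[OF I \<epsilon>(1) _ prob_\<nu> sets_\<nu> mom m_pos m_sum, of "1 / 4"] by auto
    \<comment> \<open>The summand e makes \<open>initial\<close> strict: by
      \<open>softmin_le\<close> with i = T x, the soft minimum at r = 1 / 2 integrates to less than
      e / 2 minus the weighted sum of \<phi>.\<close>
    define M where "M = e - (\<Sum>i\<in>I. m i * \<phi> i)"
    interpret S: soft_hopf_lax \<mu> x0 c b I \<phi> \<epsilon> M A \<rho>
    proof
      show "softmin \<epsilon> I \<phi> r x \<le> M + A + (dist x x0)\<^sup>2" if r: "0 \<le> r" "r \<le> 1 / 2" for r x
      proof -
        \<comment> \<open>\<open>softmin_le\<close> holds for every i. Averaging it with the weights
          m, instead of choosing one i, produces the same weighted sum of \<phi> as in M, so the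
          bound does not depend on the potential.\<close>
        have "softmin \<epsilon> I \<phi> r x = (\<Sum>i\<in>I. m i * softmin \<epsilon> I \<phi> r x)"
          by (simp add: sum_distrib_right[symmetric] m_sum)
        also have "\<dots> \<le> (\<Sum>i\<in>I. m i * (1 / 2 * (dist x i)\<^sup>2 - \<phi> i))"
        proof (intro sum_mono mult_left_mono)
          fix i assume i: "i \<in> I"
          have "r * (dist x i)\<^sup>2 \<le> 1 / 2 * (dist x i)\<^sup>2" using r by (intro mult_right_mono) auto
          then show "softmin \<epsilon> I \<phi> r x \<le> 1 / 2 * (dist x i)\<^sup>2 - \<phi> i"
            using softmin_le[OF I \<epsilon>(1) i, of \<phi> r x] by linarith
          show "0 \<le> m i" using m_pos[OF i] by simp
        qed
        also have "\<dots> = (\<Sum>i\<in>I. m i * (1 / 2 * (dist x i)\<^sup>2)) - (\<Sum>i\<in>I. m i * \<phi> i)"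
          by (simp only: right_diff_distrib sum_subtractf)
        also have "(\<Sum>i\<in>I. m i * (1 / 2 * (dist x i)\<^sup>2)) = (\<integral>y. 1 / 2 * (dist x (T y))\<^sup>2 \<partial>\<mu>)"
          by (rule push(2)[symmetric])
        also have "\<dots> \<le> (\<integral>y. (dist x x0)\<^sup>2 + 4 * (dist y x0)\<^sup>2 \<partial>\<mu>)"
        proof (intro integral_mono push Bochner_Integration.integrable_add integrable_mult_right integrable_dist_square)
          fix y
          have "(dist x (T y))\<^sup>2 \<le> (dist x x0 + dist (T y) x0)\<^sup>2"
            by (intro power_mono dist_triangle2) auto
          also have "\<dots> \<le> 2 * (dist x x0)\<^sup>2 + 2 * (dist (T y) x0)\<^sup>2"
            using sum_squares_bound[of "dist x x0" "dist (T y) x0"] by (simp add: power2_sum)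
          also have "(dist (T y) x0)\<^sup>2 \<le> (2 * dist y x0)\<^sup>2"
            by (intro power_mono T_le) auto
          finally show "1 / 2 * (dist x (T y))\<^sup>2 \<le> (dist x x0)\<^sup>2 + 4 * (dist y x0)\<^sup>2"
            by (simp add: power_mult_distrib)
        qed
        also have "\<dots> = (dist x x0)\<^sup>2 + A"
          using integrable_dist_square by (simp add: A_def m2_def)
        finally show ?thesis using e by (simp add: M_def)
      qed
      have int1: "integrable \<mu> (\<lambda>x. 1 / 2 * (dist x (T x))\<^sup>2 - \<phi> (T x))"
        using T_int push(1)[of \<phi>] by auto
      have ae: "AE x in \<mu>. softmin \<epsilon> I \<phi> (1 / 2) x \<le> 1 / 2 * (dist x (T x))\<^sup>2 - \<phi> (T x)"
        using AE_I by eventually_elim (rule softmin_le[OF I \<epsilon>(1)])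
      have int2: "integrable \<mu> (softmin \<epsilon> I \<phi> (1 / 2))"
      proof (rule Bochner_Integration.integrable_bound)
        show "integrable \<mu> (\<lambda>x. \<bar>1 / 2 * (dist x (T x))\<^sup>2 - \<phi> (T x)\<bar> + \<bar>softmin \<epsilon> I \<phi> 0 x0\<bar>)"
          using int1 by auto
        show "AE x in \<mu>. norm (softmin \<epsilon> I \<phi> (1 / 2) x)
            \<le> norm (\<bar>1 / 2 * (dist x (T x))\<^sup>2 - \<phi> (T x)\<bar> + \<bar>softmin \<epsilon> I \<phi> 0 x0\<bar>)"
          using ae
        proof eventually_elim
          case (elim x)
          then show ?case
            using softmin_mono[OF I \<epsilon>(1), of 0 "1 / 2" \<phi> x] softmin_0[OF I \<epsilon>(1), of \<phi> x x0]
            unfolding real_norm_def by linarith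
        qed
      qed measurable
      have "(\<integral>x. softmin \<epsilon> I \<phi> (1 / 2) x \<partial>\<mu>) \<le> (\<integral>x. 1 / 2 * (dist x (T x))\<^sup>2 - \<phi> (T x) \<partial>\<mu>)"
        by (rule integral_mono_AE[OF int2 int1 ae])
      also have "\<dots> = 1 / 2 * (\<integral>x. (dist x (T x))\<^sup>2 \<partial>\<mu>) - (\<Sum>i\<in>I. m i * \<phi> i)"
        using T_int push[of \<phi>] by simp
      finally show "(\<integral>x. softmin \<epsilon> I \<phi> (1 / 2) x \<partial>\<mu>) < M"
        using T_e e by (simp add: M_def)
      show "(\<integral>x. (h x)\<^sup>2 * ln ((h x)\<^sup>2) \<partial>\<mu>) \<le> 2 / \<rho> * (\<integral>x. (norm (Dh x))\<^sup>2 \<partial>\<mu>)"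
        if "C1_grad h Dh" "\<And>x. 0 \<le> h x" "integrable \<mu> (\<lambda>x. (h x)\<^sup>2)" "integrable \<mu> (\<lambda>x. (norm (Dh x))\<^sup>2)"
          "(\<integral>x. (h x)\<^sup>2 \<partial>\<mu>) = 1" "\<And>x. (h x)\<^sup>2 \<le> exp (A + \<rho> * (dist x x0)\<^sup>2)" for h Dh
      proof -
        have "(\<integral>x. (h x)\<^sup>2 * ln ((h x)\<^sup>2) \<partial>\<mu>) \<le> C * (\<integral>x. (norm (Dh x))\<^sup>2 \<partial>\<mu>)"
          by (rule lsi[of h Dh \<rho>]) (use that \<rho> in auto)
        also have "\<dots> \<le> 2 / \<rho> * (\<integral>x. (norm (Dh x))\<^sup>2 \<partial>\<mu>)"
          using C_le by (intro mult_right_mono) auto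
        finally show ?thesis .
      qed
    qed (use I \<epsilon> \<rho> A exp_\<rho> in auto)
    define H where "H = (\<integral>x. f x * ln (f x) \<partial>\<mu>)"
    define u where "u = softmin \<epsilon> I \<phi> (1 / 4)"
    have [measurable]: "u \<in> borel_measurable borel" by (simp add: u_def)
    have "integrable \<nu> (\<lambda>x. \<rho> * (u x - M))"
      using u_int by (auto simp: u_def)
    then have "integrable \<mu> (\<lambda>x. f x * (\<rho> * (u x - M)))" by (subst (asm) int_\<nu>) auto
    \<comment> \<open>Entropy duality for \<rho> (u - M), whose exponential has \<mu>-integral at
      most 1.\<close>
    then have "(\<integral>x. f x * (\<rho> * (u x - M)) \<partial>\<mu>) \<le> H"
      unfolding H_def using S.exp_softmin_bound by (intro integral_le_entropy[OF f ent]) (auto simp: u_def)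
    then have "(\<integral>x. \<rho> * (u x - M) \<partial>\<nu>) \<le> H"
      by (subst integral_\<nu>) auto
    then have "\<rho> * ((\<integral>x. u x \<partial>\<nu>) - M) \<le> H"
      using u_int[of \<phi>] N.prob_space by (simp add: u_def)
    define k where "k = H / \<rho>"
    have u_le: "(\<integral>x. u x \<partial>\<nu>) - M \<le> k"
      using \<open>\<rho> * ((\<integral>x. u x \<partial>\<nu>) - M) \<le> H\<close> \<rho>(1) by (simp add: k_def pos_le_divide_eq mult.commute)
    define p where "p i x = softmin_prob \<epsilon> I \<phi> (1 / 4) x i" for i x
    have p_meas[measurable]: "p i \<in> borel_measurable borel" for i by (simp add: p_def[abs_def])
    have p0: "0 \<le> p i x" for i x by (simp add: p_def less_imp_le softmin_prob_pos[OF I \<epsilon>(1)])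
    have p1: "p i x \<le> 1" if "i \<in> I" for i x using softmin_prob_le_1[OF I \<epsilon>(1) that] by (simp add: p_def)
    have p_int: "integrable \<nu> (p i)" if "i \<in> I" for i
      by (rule N.integrable_const_bound[where B=1]) (use p0 p1[OF that] in auto)
    have p_integral: "integral\<^sup>L \<nu> (p i) = m i" if "i \<in> I" for i
      using \<phi>[OF that] by (simp add: p_def[abs_def])
    have p_dist_int: "integrable \<nu> (\<lambda>x. p i x * (dist x i)\<^sup>2)" if "i \<in> I" for i
      by (rule Bochner_Integration.integrable_bound[OF mom[of i]])
        (use p0 p1[OF that] in \<open>auto simp: abs_mult mult_left_le_one_le\<close>)
    define c1 where "c1 = (\<integral>x. (\<Sum>i\<in>I. p i x * (dist x i)\<^sup>2) \<partial>\<nu>)"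
    have "c1 / 4 = (\<integral>x. (\<Sum>i\<in>I. p i x * (1 / 4 * (dist x i)\<^sup>2)) \<partial>\<nu>)"
      unfolding c1_def by (simp add: sum_distrib_left[symmetric] mult.left_commute[of _ "1/4"] sum_divide_distrib[symmetric])
    also have "\<dots> \<le> (\<integral>x. (\<Sum>i\<in>I. p i x * \<phi> i) + u x + e \<partial>\<nu>)"
    proof (intro integral_mono)
      show "(\<Sum>i\<in>I. p i x * (1 / 4 * (dist x i)\<^sup>2)) \<le> (\<Sum>i\<in>I. p i x * \<phi> i) + u x + e" for x
        using softmin_prob_transport_cost[OF I \<epsilon>(1), of \<phi> "1 / 4" x] by (simp only: p_def u_def \<epsilon>(2))
      show "integrable \<nu> (\<lambda>x. \<Sum>i\<in>I. p i x * (1 / 4 * (dist x i)\<^sup>2))"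
        using p_dist_int by (simp add: mult.left_commute[of _ "1/4"])
      show "integrable \<nu> (\<lambda>x. (\<Sum>i\<in>I. p i x * \<phi> i) + u x + e)"
        using p_int u_int[of \<phi>] by (auto simp: u_def)
    qed
    \<comment> \<open>The marginal condition of the optimal potential turns the mean of \<phi> under
      the coupling into the weighted sum with m, which cancels against M up to e.\<close>
    also have "\<dots> = (\<Sum>i\<in>I. m i * \<phi> i) + (\<integral>x. u x \<partial>\<nu>) + e"
      using p_int p_integral u_int[of \<phi>] N.prob_space by (simp add: u_def cong: sum.cong)
    also have "\<dots> \<le> k + 2 * e" using u_le by (simp add: M_def)
    finally have c1_le: "c1 \<le> 4 * (k + 2 * e)" by simp
    have "wasserstein2 \<nu> \<mu> \<le> ereal (sqrt (2 * c1 + 2 * e))"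
    proof (rule wasserstein2_le_semidiscrete[OF prob_space_axioms sets_\<mu> prob_\<nu> sets_\<nu> I_fin T _ _ m_sum p_meas p0])
      show "(\<Sum>i\<in>I. p i x) = 1" for x by (simp add: p_def sum_softmin_prob[OF I \<epsilon>(1)])
      show "(\<integral>\<^sup>+x. ennreal (p i x) \<partial>\<nu>) = ennreal (m i)" if "i \<in> I" for i
        using p_int[OF that] p0 p_integral[OF that] by (simp add: nn_integral_eq_integral)
      have "(\<integral>\<^sup>+x. (\<Sum>i\<in>I. ennreal (p i x * (dist x i)\<^sup>2)) \<partial>\<nu>) = (\<integral>\<^sup>+x. ennreal (\<Sum>i\<in>I. p i x * (dist x i)\<^sup>2) \<partial>\<nu>)"
        using p0 by (intro nn_integral_cong sum_ennreal) auto
      also have "\<dots> = ennreal c1"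
        unfolding c1_def using p_dist_int p0 by (intro nn_integral_eq_integral) (auto intro!: sum_nonneg)
      finally show "(\<integral>\<^sup>+x. (\<Sum>i\<in>I. ennreal (p i x * (dist x i)\<^sup>2)) \<partial>\<nu>) \<le> ennreal c1" by simp
      show "0 \<le> c1" unfolding c1_def using p0 by (intro Bochner_Integration.integral_nonneg sum_nonneg) auto
      show "(\<integral>\<^sup>+y. ennreal ((dist y (T y))\<^sup>2) \<partial>\<mu>) \<le> ennreal e"
        using T_int T_e by (subst nn_integral_eq_integral) (auto intro: ennreal_leI)
    qed (use e m_pos in \<open>auto simp: m_def\<close>)
    also have "\<dots> \<le> ereal (sqrt (8 * k + 18 * e))"
      using c1_le by simp
    also have "8 * k = 8 / \<rho> * H" by (simp add: k_def)
    finally show ?thesis by (simp add: \<nu>_def H_def)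
  qed
  have "wasserstein2 (density \<mu> (\<lambda>x. ennreal (f x))) \<mu> \<le> ereal_sqrt (ereal (8 / \<rho>) * kullback \<mu> f)"
    if f: "prob_density \<mu> f" for f
  proof (cases "kullback \<mu> f = \<infinity>")
    case True
    then show ?thesis using \<rho>(1) by (simp add: ereal_sqrt_def)
  next
    case False
    note ent = kullback_eq_ereal[OF prob_space_axioms f False]
    define H where "H = (\<integral>x. f x * ln (f x) \<partial>\<mu>)"
    \<comment> \<open>The error e = 1 / (n + 1) tends to 0, while \<rho> does not depend on
      e.\<close>
    have "(\<lambda>n. sqrt (8 / \<rho> * H + 18 * (1 / real (Suc n)))) \<longlonglongrightarrow> sqrt (8 / \<rho> * H + 18 * 0)"
      using LIMSEQ_inverse_real_of_nat by (intro tendsto_intros) (auto simp: inverse_eq_divide)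
    then have lim: "(\<lambda>n. ereal (sqrt (8 / \<rho> * H + 18 * (1 / real (Suc n))))) \<longlonglongrightarrow> ereal (sqrt (8 / \<rho> * H))"
      by simp
    have le: "wasserstein2 (density \<mu> (\<lambda>x. ennreal (f x))) \<mu>
        \<le> ereal (sqrt (8 / \<rho> * H + 18 * (1 / real (Suc n))))" for n
      unfolding H_def by (rule main[OF f ent(1)]) simp
    have "wasserstein2 (density \<mu> (\<lambda>x. ennreal (f x))) \<mu> \<le> ereal (sqrt (8 / \<rho> * H))"
      by (rule LIMSEQ_le_const[OF lim]) (intro exI allI impI le)
    then show ?thesis by (simp add: ent(2) ereal_sqrt_def H_def)
  qed
  then show ?thesis using \<rho>(1) by (intro exI[of _ "8 / \<rho>"]) auto
qed

end

section \<open>Gibbs measures under the Lyapunov condition\<close>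

theorem theorem4p1:
  fixes V W :: "real^'n::finite \<Rightarrow> real" and Z b c :: real and x0 :: "real^'n"
    and \<mu> :: "(real^'n) measure"
  defines "\<mu> \<equiv> gibbs_measure Z V"
  assumes V_smooth: "smooth V"
    and \<mu>_prob: "prob_space \<mu>"
    and W_C2: "C_k 2 W"
    and W_ge_1: "\<And>x. 1 \<le> W x"
    and c_pos: "0 < c"
    and lyapunov: "\<And>x. generator V W x \<le> (- c * (dist x x0)\<^sup>2 + b) * W x"
  shows "\<exists>K>0. \<forall>f. prob_density \<mu> f \<longrightarrow>
    wasserstein2 (density \<mu> (\<lambda>x. ennreal (f x))) \<mu> \<le> ereal_sqrt (ereal K * kullback \<mu> f)"
proof -
  interpret prob_space \<mu> by (rule \<mu>_prob)
  define w where "w x = Z * exp (- V x)" for x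
  have \<mu>: "\<mu> = density lborel (\<lambda>x. ennreal (w x))"
    by (simp add: \<mu>_def gibbs_measure_def w_def)
  have "continuous_on UNIV V"
    using V_smooth C_k.simps(1)[of V] unfolding smooth_def by blast
  then have w_cont: "continuous_on UNIV w"
    unfolding w_def by (intro continuous_intros)
  then have w_meas[measurable]: "w \<in> borel_measurable borel"
    by (rule borel_measurable_continuous_onI)
  \<comment> \<open>For Z \<le> 0 the density is nonpositive and \<open>ennreal\<close> sends it to
    0, which contradicts total mass 1.\<close>
  have Z: "0 < Z"
  proof (rule ccontr)
    assume "\<not> 0 < Z"
    then have "w x \<le> 0" for x by (simp add: w_def mult_nonpos_nonneg)
    then have "emeasure \<mu> (space \<mu>) = 0"
      by (simp add: \<mu> emeasure_density ennreal_neg)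
    then show False by (simp add: emeasure_space_1)
  qed
  have w_pos: "0 < w x" for x using Z by (simp add: w_def)
  \<comment> \<open>The locale asks for a nonnegative constant; since W is positive, enlarging b
    preserves the Lyapunov inequality.\<close>
  define b' where "b' = max b 0"
  have lyapunov': "generator V W x \<le> (- c * (dist x x0)\<^sup>2 + b') * W x" for x
  proof -
    have "(- c * (dist x x0)\<^sup>2 + b) * W x \<le> (- c * (dist x x0)\<^sup>2 + b') * W x"
      using W_ge_1[of x] by (intro mult_right_mono) (auto simp: b'_def)
    with lyapunov[of x] show ?thesis by linarith
  qed
  interpret lyapunov_measure \<mu> x0 c b'
  proof
    show "sets \<mu> = sets borel" by (simp add: \<mu>)
    show "0 < c" by (rule c_pos)
    show "0 \<le> b'" by (simp add: b'_def)
    show "\<exists>\<kappa>\<ge>0. \<forall>g Dg. C1_grad g Dg \<longrightarrow> (\<exists>m.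
      (\<integral>\<^sup>+x. indicator (cball x0 R) x * ennreal ((g x - m)\<^sup>2) \<partial>\<mu>)
        \<le> ennreal \<kappa> * (\<integral>\<^sup>+x. indicator (cball x0 R) x * ennreal ((norm (Dg x))\<^sup>2) \<partial>\<mu>))" if "0 < R" for R
      unfolding \<mu> by (rule poincare_cball_density[OF w_cont w_pos that])
    fix g Dg R
    assume g: "C1_grad g Dg" and supp: "\<And>x. x \<notin> cball x0 R \<Longrightarrow> g x = 0"
    have int: "integrable \<mu> k" and integral: "(\<integral>x. k x \<partial>\<mu>) = (\<integral>x. k x * w x \<partial>lborel)"
      if k: "continuous_on UNIV k" "\<And>x. x \<notin> cball x0 R \<Longrightarrow> k x = 0" for k :: "real^'n \<Rightarrow> real"
    proof -
      have [measurable]: "k \<in> borel_measurable borel"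
        using k(1) by (rule borel_measurable_continuous_onI)
      have "integrable lborel (\<lambda>x. w x * k x)"
        by (rule integrable_lborel_compact_support[of _ x0 R]) (use k w_cont in \<open>auto intro!: continuous_intros\<close>)
      then show "integrable \<mu> k"
        unfolding \<mu> using w_pos by (subst integrable_real_density) (auto intro: less_imp_le)
      show "(\<integral>x. k x \<partial>\<mu>) = (\<integral>x. k x * w x \<partial>lborel)"
        unfolding \<mu> using w_pos by (subst integral_real_density) (auto intro: less_imp_le simp: mult.commute)
    qed
    have Dg0: "Dg x = 0" if "x \<notin> cball x0 R" for x
      by (rule C1_grad_eq_0_outside[OF g supp that])
    note cont = C1_grad_continuous[OF g] C1_grad_continuous_grad[OF g]
    let ?k1 = "\<lambda>x. (dist x x0)\<^sup>2 * (g x)\<^sup>2" and ?k2 = "\<lambda>x. (norm (Dg x))\<^sup>2" and ?k3 = "\<lambda>x. (g x)\<^sup>2"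
    have i1: "integrable \<mu> ?k1" by (rule int) (use supp cont in \<open>auto intro!: continuous_intros\<close>)
    have i2: "integrable \<mu> ?k2" by (rule int) (use Dg0 cont in \<open>auto intro!: continuous_intros\<close>)
    have i3: "integrable \<mu> ?k3" by (rule int) (use supp cont in \<open>auto intro!: continuous_intros\<close>)
    have "0 \<le> (\<integral>x. ((norm (Dg x))\<^sup>2 + (b' - c * (dist x x0)\<^sup>2) * (g x)\<^sup>2) * (Z * exp (- V x)) \<partial>lborel)"
      by (rule lyapunov_compact_support[OF V_smooth W_C2 W_ge_1 less_imp_le[OF Z] lyapunov' g supp])
    also have "\<dots> = (\<integral>x. (norm (Dg x))\<^sup>2 + (b' - c * (dist x x0)\<^sup>2) * (g x)\<^sup>2 \<partial>\<mu>)"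
      unfolding w_def[symmetric]
      by (rule integral[symmetric]) (use supp Dg0 cont in \<open>auto intro!: continuous_intros\<close>)
    also have "\<dots> = (\<integral>x. (norm (Dg x))\<^sup>2 + b' * (g x)\<^sup>2 - c * ((dist x x0)\<^sup>2 * (g x)\<^sup>2) \<partial>\<mu>)"
      by (intro Bochner_Integration.integral_cong refl) (simp add: algebra_simps)
    also have "\<dots> = (\<integral>x. ?k2 x \<partial>\<mu>) + b' * (\<integral>x. ?k3 x \<partial>\<mu>) - c * (\<integral>x. ?k1 x \<partial>\<mu>)"
      using i1 i2 i3 by simp
    finally show "c * (\<integral>x. ?k1 x \<partial>\<mu>) \<le> (\<integral>x. ?k2 x \<partial>\<mu>) + b' * (\<integral>x. ?k3 x \<partial>\<mu>)" by simp
  qed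
  show ?thesis by (rule talagrand_inequality)
qed

end
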